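(* For any $\alpha\in[0,1]$ and any stochastically constrained adversarial regime with a unique best arm (i.e., $\Delta_i>0$ for all $i$ except a unique index $i^*$ for which $\Delta_{i^*}=0$), the pseudo-regret of $\alpha$-Tsallis-INF with (IW) loss estimators, learning rate $$\eta_t=\frac{16^\alpha}{4}\cdot\frac{1-\overline{t}^{\,-1+\alpha}}{(1-\alpha)t^\alpha},\qquad \overline t=\max\{e,t\},$$ and asymmetric regularizer with parameters $\xi_i=\Delta_i^{1-2\alpha}$ for $i\ne i^*$ and $\xi_{i^*}=\Delta_{\min}^{1-2\alpha}$, where $\Delta_{\min}=\min_{i\ne i^*}\Delta_i$, satisfies at any time $T$ $$\overline{Reg}_T\le\sum_{i\ne i^*}\left(\frac{\left(8\min\{\frac{1}{1-\alpha},\log(T)\}+64\right)\log(T)}{\Delta_i}\right)+\frac{16\log^4\!\left(\frac{16}{\Delta_{\min}^2}\log^2\!\left(\frac{16}{\Delta_{\min}^2}\right)\right)}{\Delta_{\min}}+4.$$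
   Context: Bandit setting. There are $K$ arms. In each round $t=1,2,\dots$ the environment picks a loss vector $\ell_t\in[0,1]^K$ and the agent chooses an arm $I_t\in\{1,\dots,K\}$ (without $\ell_t$ depending on $I_t$); the agent observes and suffers only $\ell_{t,I_t}$. The pseudo-regret is $\overline{Reg}_T=\mathbb{E}[\sum_{t=1}^T\ell_{t,I_t}]-\min_i\mathbb{E}[\sum_{t=1}^T\ell_{t,i}]$, with expectation over the randomization of both the algorithm and the environment. $\log$ is the natural logarithm; $\Delta^{K-1}$ is the probability simplex in $\mathbb{R}^K$. Stochastically constrained adversarial regime. The losses are drawn from distributions with fixed gaps: $\mathbb{E}[\ell_{t,i}-\ell_{t,j}]=\tilde\Delta_{i,j}$ in every round $t$ (conditionally on the past), independently of $t$, while the means and all other parameters of the distributions may change with time and may depend on the agent's past actions $I_1,\dots,I_{t-1}$. An optimal arm is $i^*\in\arg\min_i\tilde\Delta_{i,1}$, and the suboptimality gaps are $\Delta_i=\tilde\Delta_{i,i^*}$. Algorithm ($\alpha$-Tsallis-INF with parameters $\xi_i>0$). For $\alpha\in(0,1)$ let $\Psi(w)=-\sum_{i=1}^K\frac{w_i^\alpha-\alpha w_i}{\alpha(1-\alpha)\xi_i}$; for $\alpha\in\{0,1\}$ one uses the limits of $-\sum_i\frac{w_i^\alpha-\alpha w_i-(1-\alpha)}{\alpha(1-\alpha)\xi_i}$: $\Psi(w)=-\sum_i\xi_i^{-1}(\log w_i-w_i+1)$ for $\alpha=0$ and $\Psi(w)=\sum_i\xi_i^{-1}(w_i\log w_i-w_i+1)$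 for $\alpha=1$. Put $\Psi_t=\Psi/\eta_t$ and $\hat L_0=0$. In each round $t$: let $w_t=\arg\max_{w\in\Delta^{K-1}}\{\langle w,-\hat L_{t-1}\rangle-\Psi_t(w)\}$; sample $I_t\sim w_t$; observe $\ell_{t,I_t}$; set $\hat\ell_{t,i}=\frac{\mathbf 1[I_t=i]\ell_{t,i}}{w_{t,i}}$ (the (IW) estimator) and $\hat L_t=\hat L_{t-1}+\hat\ell_t$. For $\alpha=1$, $\eta_t$ is read as its limit $4\log(\overline t)/t$, and $\frac1{1-\alpha}$ as $+\infty$. *)

theory Defs
  imports "HOL-Probability.Probability"
begin

text \<open>
  Arms form a finite type \<open>'k\<close>; rounds are the naturals \<open>t \<ge> 1\<close>. A bandit game on a probability
  space \<open>M\<close> is given by the actions \<open>I t \<omega>\<close> and the losses \<open>l t \<omega> i\<close>.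
\<close>

definition prob_simplex :: "('k::finite \<Rightarrow> real) set" where
  "prob_simplex = {v. (\<forall>i. 0 \<le> v i) \<and> (\<Sum>i\<in>UNIV. v i) = 1}"

text \<open>
  The \<open>\<sigma>\<close>-algebra generated by the actions of rounds \<open>1, \<dots>, p\<close> and the loss vectors of
  rounds \<open>1, \<dots>, q\<close>. The past before round \<open>t\<close> is the case \<open>p = q = t - 1\<close>.
\<close>

definition history ::
  "'w measure \<Rightarrow> (nat \<Rightarrow> 'w \<Rightarrow> 'k) \<Rightarrow> (nat \<Rightarrow> 'w \<Rightarrow> 'k \<Rightarrow> real) \<Rightarrow> nat \<Rightarrow> nat \<Rightarrow> 'w measure" where
  "history M I l p q = sigma (space M)
     ({I s -` A \<inter> space M | s A. s \<in> {1..p}} \<union>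
      {(\<lambda>\<omega>. l s \<omega> i) -` B \<inter> space M | s i B. s \<in> {1..q} \<and> B \<in> sets borel})"

definition bandit_game ::
  "'w measure \<Rightarrow> (nat \<Rightarrow> 'w \<Rightarrow> 'k::finite) \<Rightarrow> (nat \<Rightarrow> 'w \<Rightarrow> 'k \<Rightarrow> real) \<Rightarrow> bool" where
  "bandit_game M I l \<longleftrightarrow> prob_space M \<and>
     (\<forall>t\<ge>1. I t \<in> measurable M (count_space UNIV) \<and>
            (\<forall>i. (\<lambda>\<omega>. l t \<omega> i) \<in> borel_measurable M) \<and>
            (\<forall>\<omega>\<in>space M. \<forall>i. l t \<omega> i \<in> {0..1}))"

definition pseudo_regret ::
  "'w measure \<Rightarrow> (nat \<Rightarrow> 'w \<Rightarrow> 'k::finite) \<Rightarrow> (nat \<Rightarrow> 'w \<Rightarrow> 'k \<Rightarrow> real) \<Rightarrow> nat \<Rightarrow> real" where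
  "pseudo_regret M I l T =
     (LINT \<omega>|M. (\<Sum>t=1..T. l t \<omega> (I t \<omega>))) - (MIN i. (LINT \<omega>|M. (\<Sum>t=1..T. l t \<omega> i)))"

text \<open>\<open>D i j\<close> is the fixed gap between the mean losses of the arms \<open>i\<close> and \<open>j\<close>.\<close>

definition stochastically_constrained ::
  "'w measure \<Rightarrow> (nat \<Rightarrow> 'w \<Rightarrow> 'k::finite) \<Rightarrow> (nat \<Rightarrow> 'w \<Rightarrow> 'k \<Rightarrow> real) \<Rightarrow> ('k \<Rightarrow> 'k \<Rightarrow> real) \<Rightarrow> bool" where
  "stochastically_constrained M I l D \<longleftrightarrow>
     (\<forall>t\<ge>1. \<forall>i j. AE \<omega> in M.
        real_cond_exp M (history M I l (t - 1) (t - 1)) (\<lambda>\<omega>. l t \<omega> i - l t \<omega> j) \<omega> = D i j)"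

text \<open>The reference arm \<open>j\<close> is immaterial, since gaps of means satisfy \<open>D i j = D i k + D k j\<close>.\<close>

definition optimal_arm :: "('k \<Rightarrow> 'k \<Rightarrow> real) \<Rightarrow> 'k \<Rightarrow> bool" where
  "optimal_arm D i \<longleftrightarrow> (\<forall>j. is_arg_min (\<lambda>k. D k j) (\<lambda>_. True) i)"

definition min_gap :: "('k::finite \<Rightarrow> real) \<Rightarrow> 'k \<Rightarrow> real" where
  "min_gap \<Delta> istar = Min (\<Delta> ` (UNIV - {istar}))"

text \<open>
  The value is extended because the logarithmic barrier of \<open>\<alpha> = 0\<close> is infinite on the boundary of
  the simplex, whereas \<open>ln 0 = 0\<close>. For \<open>\<alpha> > 0\<close> the boundary needs no special treatment, as
  \<open>0 powr \<alpha> = 0\<close> and \<open>0 * ln 0 = 0\<close>.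
\<close>

definition tsallis_reg :: "real \<Rightarrow> ('k::finite \<Rightarrow> real) \<Rightarrow> ('k \<Rightarrow> real) \<Rightarrow> ereal" where
  "tsallis_reg \<alpha> \<xi> v =
     (if \<alpha> = 0 then
        (if \<forall>i. 0 < v i then ereal (- (\<Sum>i\<in>UNIV. (ln (v i) - v i + 1) / \<xi> i)) else \<infinity>)
      else if \<alpha> = 1 then ereal (\<Sum>i\<in>UNIV. (v i * ln (v i) - v i + 1) / \<xi> i)
      else ereal (- (\<Sum>i\<in>UNIV. (v i powr \<alpha> - \<alpha> * v i) / (\<alpha> * (1 - \<alpha>) * \<xi> i))))"

definition iw_estimate ::
  "(nat \<Rightarrow> 'w \<Rightarrow> 'k) \<Rightarrow> (nat \<Rightarrow> 'w \<Rightarrow> 'k \<Rightarrow> real) \<Rightarrow> (nat \<Rightarrow> 'w \<Rightarrow> 'k \<Rightarrow> real) \<Rightarrow> nat \<Rightarrow> 'w \<Rightarrow> 'k \<Rightarrow> real" where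
  "iw_estimate I l w t \<omega> i = of_bool (I t \<omega> = i) * l t \<omega> i / w t \<omega> i"

definition iw_cum_estimate ::
  "(nat \<Rightarrow> 'w \<Rightarrow> 'k) \<Rightarrow> (nat \<Rightarrow> 'w \<Rightarrow> 'k \<Rightarrow> real) \<Rightarrow> (nat \<Rightarrow> 'w \<Rightarrow> 'k \<Rightarrow> real) \<Rightarrow> nat \<Rightarrow> 'w \<Rightarrow> 'k \<Rightarrow> real" where
  "iw_cum_estimate I l w t \<omega> i = (\<Sum>s=1..t. iw_estimate I l w s \<omega> i)"

text \<open>
  The sampling rule conditions on the past and on the loss vector of the current round: this states
  both that the action has law \<open>w t\<close> given the past and that, given the past, the current losses do
  not depend on it.
\<close>

definition tsallis_inf ::
  "'w measure \<Rightarrow> (nat \<Rightarrow> 'w \<Rightarrow> 'k::finite) \<Rightarrow> (nat \<Rightarrow> 'w \<Rightarrow> 'k \<Rightarrow> real) \<Rightarrow>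
   real \<Rightarrow> ('k \<Rightarrow> real) \<Rightarrow> (nat \<Rightarrow> real) \<Rightarrow> (nat \<Rightarrow> 'w \<Rightarrow> 'k \<Rightarrow> real) \<Rightarrow> bool" where
  "tsallis_inf M I l \<alpha> \<xi> \<eta> w \<longleftrightarrow>
     (\<forall>t\<ge>1.
        (\<forall>\<omega>\<in>space M. is_arg_max
           (\<lambda>v. ereal (\<Sum>i\<in>UNIV. v i * (- iw_cum_estimate I l w (t - 1) \<omega> i))
                 - tsallis_reg \<alpha> \<xi> v / ereal (\<eta> t))
           (\<lambda>v. v \<in> prob_simplex) (w t \<omega>)) \<and>
        (\<forall>i. AE \<omega> in M.
           real_cond_exp M (history M I l (t - 1) t) (\<lambda>\<omega>. of_bool (I t \<omega> = i)) \<omega> = w t \<omega> i))"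

text \<open>At \<open>\<alpha> = 1\<close> this is the limit of the formula for \<open>\<alpha> < 1\<close>.\<close>

definition learning_rate :: "real \<Rightarrow> nat \<Rightarrow> real" where
  "learning_rate \<alpha> t =
     (let tbar = max (exp 1) (real t) in
      if \<alpha> = 1 then 4 * ln tbar / real t
      else 16 powr \<alpha> / 4 * ((1 - tbar powr (- 1 + \<alpha>)) / ((1 - \<alpha>) * real t powr \<alpha>)))"

definition asym_param :: "real \<Rightarrow> ('k::finite \<Rightarrow> real) \<Rightarrow> 'k \<Rightarrow> 'k \<Rightarrow> real" where
  "asym_param \<alpha> \<Delta> istar i =
     (if i = istar then min_gap \<Delta> istar powr (1 - 2 * \<alpha>) else \<Delta> i powr (1 - 2 * \<alpha>))"

text \<open>\<open>min {1 / (1 - \<alpha>), log T}\<close>, where \<open>1 / (1 - \<alpha>)\<close> means \<open>+\<infinity>\<close> at \<open>\<alpha> = 1\<close>.\<close>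

definition min_inv_log :: "real \<Rightarrow> nat \<Rightarrow> real" where
  "min_inv_log \<alpha> T = (if \<alpha> = 1 then ln (real T) else min (1 / (1 - \<alpha>)) (ln (real T)))"

end

theory Submission
  imports Defs
begin

text \<open>
  Let \<open>R\<close> be the regret, the expected sum of \<open>\<Delta> i * w t i\<close>. Follow-the-regularised-leader splits it into
  a stability term, of order \<open>\<eta> t * \<xi> i * w t i powr (1 - \<alpha>)\<close> for each arm, and a penalty term, which
  comes from the changes of \<open>1 / \<eta> t\<close>. For a suboptimal arm, the weighted AM-GM inequality bounds both
  terms by a multiple of \<open>1 / (t * \<Delta> i)\<close> plus a fraction of \<open>\<Delta> i * w t i\<close>. The best arm contributes a
  negligible penalty, and its stability term is a fraction of the regret of the round once \<open>\<eta> t\<close> is small compared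
  with \<open>\<Delta>min powr (2 * \<alpha>)\<close>; before that it costs the \<open>log\<^sup>4\<close> term. In total at most \<open>3/4 * R\<close> is left on the
  right-hand side and is absorbed, which multiplies the remaining terms by \<open>4\<close>.

  The stability term of a round involves the weights of the next one. To avoid a penalty for the round
  after the last, the regret of the last round is bounded by \<open>1\<close>, which gives the additive constant \<open>4\<close>.
\<close>

section \<open>Tsallis logarithm and entropy\<close>

text \<open>The choice \<open>\<xi> i = \<Delta> i powr (1 - 2 * \<alpha>)\<close> with a rate of
  order \<open>t powr (- \<alpha>)\<close> makes both terms of a suboptimal arm scale-free: up to
  logarithmic factors and shifts of \<open>t\<close> by one, they are
  \<open>z powr (1 - \<alpha>) / (t * \<Delta> i)\<close> and
  \<open>z powr \<alpha> / (t * \<Delta> i)\<close> with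
  \<open>z = t * (\<Delta> i)\<^sup>2 * w t i\<close>. Linearising the powers of \<open>z\<close>
  produces \<open>1 / (t * \<Delta> i)\<close> and \<open>\<Delta> i * w t i\<close>. The factor
  \<open>16 powr \<alpha>\<close> of the rate sets the trade-off. The regret budget is
  \<open>1/8\<close> for stability,
  \<open>\<alpha> * (\<alpha> + 1 / rate_log \<alpha> t) / 4\<close> for the penalty and, after the
  burn-in, \<open>1/2 - \<alpha> / 4\<close> for the best arm.

  Two obstacles shape the rest. The rate may increase at first, so penalty coefficients may be
  negative. The weights are given only as an arg max, possibly on the boundary for \<alpha> > 0, so
  their positivity, measurability and the integrability of the estimates must be derived from
  optimality.\<close>

definition qlog :: "real \<Rightarrow> real \<Rightarrow> real" where
  "qlog \<alpha> x = (if \<alpha> = 1 then ln x else (1 - x powr (\<alpha> - 1)) / (1 - \<alpha>))"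

text \<open>This is the deformed logarithm whose derivative is a pure power. The formula does not
  see the case \<open>\<alpha> = 1\<close>, so arguments by derivatives need no case split.
  \<open>qlog\<close> serves twice: as minus the slope of \<open>tent\<close> and as the logarithmic
  factor of the learning rate.\<close>

lemma qlog_has_derivative:
  assumes "x > 0"
  shows "(qlog \<alpha> has_real_derivative x powr (\<alpha> - 2)) (at x)"
proof (cases "\<alpha> = 1")
  case True
  then show ?thesis
    using assms by (auto simp: qlog_def[abs_def] powr_minus powr_one inverse_eq_divide
        intro!: derivative_eq_intros)
next
  case False
  have "((\<lambda>x. (1 - x powr (\<alpha> - 1)) / (1 - \<alpha>)) has_real_derivative
      (0 - (\<alpha> - 1) * x powr (\<alpha> - 1 - 1)) / (1 - \<alpha>)) (at x)"
    by (intro DERIV_cdivide DERIV_diff DERIV_const has_real_derivative_powr assms)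
  moreover have "(0 - (\<alpha> - 1) * x powr (\<alpha> - 1 - 1)) / (1 - \<alpha>) = x powr (\<alpha> - 2)"
    using False by (simp add: field_simps)
  ultimately show ?thesis
    using False by (simp add: qlog_def[abs_def])
qed

lemma qlog_mono:
  assumes "0 < x" "x \<le> y"
  shows "qlog \<alpha> x \<le> qlog \<alpha> y"
proof (rule DERIV_nonneg_imp_nondecreasing[OF assms(2)])
  fix z assume "x \<le> z" "z \<le> y"
  with assms show "\<exists>d. (qlog \<alpha> has_real_derivative d) (at z) \<and> 0 \<le> d"
    by (intro exI[of _ "z powr (\<alpha> - 2)"] conjI qlog_has_derivative) auto
qed

lemma qlog_1 [simp]: "qlog \<alpha> 1 = 0"
  by (simp add: qlog_def)

lemma qlog_nonpos: "0 < x \<Longrightarrow> x \<le> 1 \<Longrightarrow> qlog \<alpha> x \<le> 0"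
  using qlog_mono[of x 1 \<alpha>] by simp

lemma powr_ge_one_plus_ln:
  fixes x a :: real
  assumes "x > 0"
  shows "1 + a * ln x \<le> x powr a"
  using exp_ge_add_one_self[of "a * ln x"] assms by (simp add: powr_def)

lemma qlog_le_ln:
  assumes "\<alpha> \<le> 1" "x > 0"
  shows "qlog \<alpha> x \<le> ln x"
  using powr_ge_one_plus_ln[of x "\<alpha> - 1"] assms
  by (auto simp: qlog_def divide_simps algebra_simps)

lemma one_minus_times_qlog_le:
  assumes "x > 0" "\<alpha> \<le> 1"
  shows "(1 - \<alpha>) * qlog \<alpha> x \<le> 1"
  using assms by (auto simp: qlog_def)

lemma qlog_le_inverse:
  assumes "x > 0" "\<alpha> < 1"
  shows "qlog \<alpha> x \<le> 1 / (1 - \<alpha>)"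
  using assms by (auto simp: qlog_def divide_simps)

lemma powr_le_affine:
  fixes x a :: real
  assumes "0 \<le> a" "a \<le> 1" "0 < x"
  shows "x powr a \<le> 1 - a + a * x"
  using Youngs_inequality_0[of a "1 - a" x 1] assms by simp

text \<open>The left-hand side is \<open>qlog 0 x\<close>, the smallest value over all \<alpha>;
  Bernoulli's inequality for the exponent \<open>1 - \<alpha>\<close> gives the comparison.\<close>

lemma qlog_ge:
  assumes "0 \<le> \<alpha>" "\<alpha> \<le> 1" "x > 0"
  shows "1 - 1 / x \<le> qlog \<alpha> x"
proof (cases "\<alpha> = 1")
  case True
  then show ?thesis
    using ln_ge_iff[of "1/x"] ln_le_minus_one[of "1/x"] assms by (simp add: qlog_def ln_div)
next
  case False
  have "x powr (\<alpha> - 1) = (1 / x) powr (1 - \<alpha>)"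
    using assms by (simp add: powr_divide powr_diff)
  also have "\<dots> \<le> 1 - (1 - \<alpha>) + (1 - \<alpha>) * (1 / x)"
    using assms by (intro powr_le_affine) auto
  finally have "(1 - \<alpha>) * (1 - 1 / x) \<le> 1 - x powr (\<alpha> - 1)"
    by (simp add: algebra_simps)
  then show ?thesis
    using assms False by (simp add: qlog_def pos_le_divide_eq mult.commute)
qed

text \<open>It suffices to bound \<open>x powr (1 - \<alpha>)\<close> below by
  \<open>1 + (1 - \<alpha>) * ln x\<close>. After adding \<alpha> the right-hand side becomes
  \<open>1 + 1 / ln x\<close>, which is free of \<alpha>; \<open>rate_factor_le\<close> uses it in
  this form.\<close>

lemma inverse_qlog_le:
  assumes "0 \<le> \<alpha>" "\<alpha> \<le> 1" "x > 1"
  shows "1 / qlog \<alpha> x \<le> 1 - \<alpha> + 1 / ln x"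
proof (cases "\<alpha> = 1")
  case True
  then show ?thesis by (simp add: qlog_def)
next
  case False
  define b L where "b = 1 - \<alpha>" and "L = ln x"
  have b: "b > 0" and L: "L > 0"
    using assms False by (auto simp: b_def L_def)
  have "1 + b * L \<le> x powr b"
    using powr_ge_one_plus_ln[of x b] assms by (simp add: L_def)
  then have "x powr (- b) \<le> 1 / (1 + b * L)"
    using b L by (simp add: powr_minus inverse_eq_divide frac_le add_pos_pos)
  moreover have "1 - 1 / (1 + b * L) = b * L / (1 + b * L)"
    using b L by (simp add: field_simps add_pos_pos less_imp_neq[symmetric])
  ultimately have *: "b * L / (1 + b * L) \<le> 1 - x powr (- b)"
    by linarith
  have pos: "0 < b * L / (1 + b * L)"
    using b L by (auto intro!: divide_pos_pos mult_pos_pos add_pos_pos)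
  have "1 / qlog \<alpha> x = b / (1 - x powr (- b))"
    using False by (simp add: qlog_def b_def)
  also have "\<dots> \<le> b / (b * L / (1 + b * L))"
    using * pos b by (intro divide_left_mono mult_pos_pos) auto
  also have "\<dots> = b + 1 / L"
    using b L by (simp add: field_simps)
  finally show ?thesis by (simp add: b_def L_def)
qed

text \<open>The separable summand of \<open>- \<Psi>\<close>, normalised to have value and slope \<open>0\<close> at \<open>1\<close>.\<close>

definition tent :: "real \<Rightarrow> real \<Rightarrow> real" where
  "tent \<alpha> x =
     (if \<alpha> = 0 then ln x - x + 1
      else if \<alpha> = 1 then - (x * ln x - x + 1)
      else (x powr \<alpha> - \<alpha> * x - (1 - \<alpha>)) / (\<alpha> * (1 - \<alpha>)))"

lemma tent_1 [simp]: "tent \<alpha> 1 = 0"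
  by (simp add: tent_def)

lemma tent_has_derivative:
  assumes "x > 0"
  shows "(tent \<alpha> has_real_derivative - qlog \<alpha> x) (at x)"
proof -
  consider "\<alpha> = 0" | "\<alpha> = 1" | "\<alpha> \<noteq> 0" "\<alpha> \<noteq> 1" by blast
  then show ?thesis
  proof cases
    case 1
    have "((\<lambda>x. ln x - x + 1) has_real_derivative 1 / x - 1) (at x)"
      using assms by (auto intro!: derivative_eq_intros)
    moreover have "1 / x - 1 = - qlog \<alpha> x"
      using 1 assms by (simp add: qlog_def powr_minus inverse_eq_divide)
    ultimately show ?thesis
      using 1 by (simp add: tent_def[abs_def])
  next
    case 2
    have "((\<lambda>x. - (x * ln x - x + 1)) has_real_derivative - ln x) (at x)"
      using assms by (auto intro!: derivative_eq_intros)
    then show ?thesis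
      using 2 by (simp add: tent_def[abs_def] qlog_def)
  next
    case 3
    have "((\<lambda>x. (x powr \<alpha> - \<alpha> * x - (1 - \<alpha>)) / (\<alpha> * (1 - \<alpha>))) has_real_derivative
        (\<alpha> * x powr (\<alpha> - 1) - \<alpha> * 1 - 0) / (\<alpha> * (1 - \<alpha>))) (at x)"
      by (intro DERIV_cdivide DERIV_diff DERIV_const DERIV_cmult DERIV_ident
          has_real_derivative_powr assms)
    moreover have "(\<alpha> * x powr (\<alpha> - 1) - \<alpha> * 1 - 0) / (\<alpha> * (1 - \<alpha>)) = - qlog \<alpha> x"
      using 3 by (simp add: qlog_def field_simps)
    ultimately show ?thesis
      using 3 by (simp add: tent_def[abs_def])
  qed
qed

lemma tent_mono:
  assumes "0 < x" "x \<le> y" "y \<le> 1"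
  shows "tent \<alpha> x \<le> tent \<alpha> y"
proof (rule DERIV_nonneg_imp_nondecreasing[OF assms(2)])
  fix z assume z: "x \<le> z" "z \<le> y"
  have "qlog \<alpha> z \<le> 0"
    using qlog_nonpos[of z \<alpha>] z assms by linarith
  with z assms show "\<exists>d. (tent \<alpha> has_real_derivative d) (at z) \<and> 0 \<le> d"
    by (intro exI[of _ "- qlog \<alpha> z"] conjI tent_has_derivative) auto
qed

text \<open>The second derivative of \<open>- tent \<alpha>\<close> is
  \<open>x powr (\<alpha> - 2)\<close>, which decreases in \<open>x\<close>; on
  \<open>{0<..b}\<close> it is least at \<open>b\<close>, so a parabola with that curvature may be
  subtracted.\<close>

lemma tent_strongly_concave:
  assumes "\<alpha> \<le> 1" "0 < b"
  shows "convex_on {0<..b} (\<lambda>x. - tent \<alpha> x - 1/2 * b powr (\<alpha> - 2) * x\<^sup>2)"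
proof (rule f''_ge0_imp_convex)
  show "convex {0<..b}" by simp
next
  fix x assume x: "x \<in> {0<..b}"
  show "((\<lambda>x. - tent \<alpha> x - 1/2 * b powr (\<alpha> - 2) * x\<^sup>2) has_real_derivative
      qlog \<alpha> x - b powr (\<alpha> - 2) * x) (at x)"
    using x tent_has_derivative[of x \<alpha>] by (auto intro!: derivative_eq_intros)
  show "((\<lambda>x. qlog \<alpha> x - b powr (\<alpha> - 2) * x) has_real_derivative
      x powr (\<alpha> - 2) - b powr (\<alpha> - 2)) (at x)"
    using x qlog_has_derivative[of x \<alpha>] by (auto intro!: derivative_eq_intros)
  show "0 \<le> x powr (\<alpha> - 2) - b powr (\<alpha> - 2)"
    using x assms powr_mono2'[of "\<alpha> - 2" x b] by auto
qed

lemma tent_combination_ge: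
  assumes "\<alpha> \<le> 1" "0 < a" "0 < b" "0 \<le> r" "r \<le> 1"
  shows "tent \<alpha> (a + r * (b - a)) \<ge> (1 - r) * tent \<alpha> a + r * tent \<alpha> b
      + 1/2 * r * (1 - r) * max a b powr (\<alpha> - 2) * (b - a)\<^sup>2"
proof -
  define m where "m = max a b powr (\<alpha> - 2)"
  let ?h = "\<lambda>x. - tent \<alpha> x - 1/2 * m * x\<^sup>2"
  have "?h ((1 - r) *\<^sub>R a + r *\<^sub>R b) \<le> (1 - r) * ?h a + r * ?h b"
    unfolding m_def using assms
    by (intro convex_onD[OF tent_strongly_concave]) auto
  moreover have "(1 - r) *\<^sub>R a + r *\<^sub>R b = a + r * (b - a)"
    by (simp add: algebra_simps)
  ultimately have h: "?h (a + r * (b - a)) \<le> (1 - r) * ?h a + r * ?h b"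
    by simp
  have "- tent \<alpha> (a + r * (b - a)) \<le> - (1 - r) * tent \<alpha> a - r * tent \<alpha> b
      + 1/2 * m * ((a + r * (b - a))\<^sup>2 - (1 - r) * a\<^sup>2 - r * b\<^sup>2)"
  proof -
    have e: "(1 - r) * ?h a + r * ?h b = - (1 - r) * tent \<alpha> a - r * tent \<alpha> b
        - 1/2 * m * ((1 - r) * a\<^sup>2 + r * b\<^sup>2)"
      by (simp add: field_simps)
    show ?thesis
      using h unfolding e by (simp add: right_diff_distrib distrib_left)
  qed
  also have "(a + r * (b - a))\<^sup>2 - (1 - r) * a\<^sup>2 - r * b\<^sup>2 = - (r * (1 - r) * (b - a)\<^sup>2)"
    by (simp add: power2_eq_square algebra_simps)
  also have "1/2 * m * - (r * (1 - r) * (b - a)\<^sup>2) = - (1/2 * r * (1 - r) * m * (b - a)\<^sup>2)"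
    by simp
  finally show ?thesis
    unfolding m_def by linarith
qed

lemma tent_tangent:
  assumes "\<alpha> \<le> 1" "0 < x" "0 < y"
  shows "tent \<alpha> y \<le> tent \<alpha> x - qlog \<alpha> x * (y - x)"
proof -
  have "convex_on {0<..} (\<lambda>x. - tent \<alpha> x)"
  proof (rule f''_ge0_imp_convex)
    show "convex {(0::real)<..}" by simp
    fix x :: real assume x: "x \<in> {0<..}"
    show "((\<lambda>x. - tent \<alpha> x) has_real_derivative qlog \<alpha> x) (at x)"
      using x tent_has_derivative[of x \<alpha>] by (auto intro!: derivative_eq_intros)
    show "(qlog \<alpha> has_real_derivative x powr (\<alpha> - 2)) (at x)"
      using x qlog_has_derivative by auto
  qed auto
  moreover have "((\<lambda>x. - tent \<alpha> x) has_real_derivative qlog \<alpha> x) (at x)"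
    using assms tent_has_derivative[of x \<alpha>] by (auto intro!: derivative_eq_intros)
  then have "((\<lambda>x. - tent \<alpha> x) has_real_derivative qlog \<alpha> x) (at x within {0<..})"
    by (rule has_field_derivative_at_within)
  ultimately have "- tent \<alpha> y - (- tent \<alpha> x) \<ge> qlog \<alpha> x * (y - x)"
    using assms by (intro convex_on_imp_above_tangent[where A = "{0<..}"]) (auto simp: interior_open)
  then show ?thesis by simp
qed

text \<open>For positive \<open>a\<close> this is the tangent at the right end. The point
  \<open>a = 0\<close> must be covered for \<alpha> > 0, because minimisers are not yet known to be
  interior when this is applied.\<close>

lemma tent_increment_ge:
  assumes "0 \<le> \<alpha>" "\<alpha> \<le> 1" "0 < \<alpha> \<or> 0 < a" "0 \<le> a" "0 < e"
  shows "tent \<alpha> (a + e) - tent \<alpha> a \<ge> - qlog \<alpha> (a + e) * e"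
proof (cases "a = 0")
  case False
  then show ?thesis
    using tent_tangent[of \<alpha> "a + e" a] assms by simp
next
  case True
  with assms have "\<alpha> > 0" by auto
  show ?thesis
  proof (cases "\<alpha> = 1")
    case True
    then show ?thesis
      using \<open>a = 0\<close> assms by (simp add: tent_def qlog_def)
  next
    case False
    define p where "p = e powr \<alpha>"
    have "e powr (\<alpha> - 1) = p / e"
      using assms by (simp add: p_def powr_diff)
    then have q: "qlog \<alpha> e * e = (e - p) / (1 - \<alpha>)"
      using False assms by (simp add: qlog_def field_simps)
    have "tent \<alpha> e - tent \<alpha> 0 = (p - \<alpha> * e) / (\<alpha> * (1 - \<alpha>))"
      using \<open>\<alpha> > 0\<close> False by (simp add: tent_def p_def flip: diff_divide_distrib)
    also have "\<dots> = p / \<alpha> - (e - p) / (1 - \<alpha>)"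
      using \<open>\<alpha> > 0\<close> False by (simp add: divide_simps) (simp add: algebra_simps)
    finally have "tent \<alpha> e - tent \<alpha> 0 + qlog \<alpha> e * e = p / \<alpha>"
      using q by simp
    moreover have "0 \<le> p / \<alpha>"
      using \<open>\<alpha> > 0\<close> by (simp add: p_def)
    ultimately show ?thesis
      using \<open>a = 0\<close> by simp
  qed
qed

text \<open>The right-hand side is \<open>- tent 0 u\<close>: all tents agree at \<open>1\<close>,
  and \<open>qlog_ge\<close> orders their slopes, so the logarithmic barrier is the worst
  case.\<close>

lemma tent_ge_ln:
  assumes "0 \<le> \<alpha>" "\<alpha> \<le> 1" "0 < u" "u \<le> 1"
  shows "- tent \<alpha> u \<le> ln (1 / u) - (1 - u)"
proof -
  let ?k = "\<lambda>u. tent \<alpha> u - (ln u + 1 - u)"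
  have "?k 1 \<le> ?k u"
  proof (rule DERIV_nonpos_imp_nonincreasing[OF assms(4)])
    fix z assume z: "u \<le> z" "z \<le> 1"
    have "1 - 1 / z \<le> qlog \<alpha> z"
      using z assms by (intro qlog_ge) auto
    then show "\<exists>d. (?k has_real_derivative d) (at z) \<and> d \<le> 0"
      using z assms tent_has_derivative[of z \<alpha>]
      by (intro exI[of _ "- qlog \<alpha> z - (1 / z - 1)"])
         (auto intro!: derivative_eq_intros)
  qed
  then show ?thesis
    using assms by (simp add: ln_div)
qed

lemma tent_ge_square:
  assumes "0 \<le> \<alpha>" "\<alpha> \<le> 1" "1/2 \<le> u" "u \<le> 1"
  shows "- tent \<alpha> u \<le> 2 * (1 - u)\<^sup>2"
proof -
  have "- tent \<alpha> u \<le> ln (1 / u) - (1 - u)"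
    using assms by (intro tent_ge_ln) auto
  also have "\<dots> \<le> (1 / u - 1) - (1 - u)"
    using assms ln_le_minus_one[of "1 / u"] by auto
  also have "\<dots> = (1 - u)\<^sup>2 / u"
    using assms by (simp add: field_simps power2_eq_square)
  also have "\<dots> \<le> (1 - u)\<^sup>2 / (1/2)"
    using assms by (intro divide_left_mono) auto
  finally show ?thesis by simp
qed

text \<open>The factor \<alpha> compensates the \<open>1 / \<alpha>\<close> in \<open>tent\<close>;
  in the penalty it is supplied by the increment of \<open>t powr \<alpha>\<close>. For \<alpha>
  strictly between \<open>0\<close> and \<open>1\<close> the right-hand side is
  \<open>(v powr \<alpha> - \<alpha> * v) / (1 - \<alpha>)\<close>, and the analogous subtracted
  term in \<open>u\<close> is dropped, being nonnegative.\<close>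

lemma tent_diff_le:
  assumes "0 \<le> \<alpha>" "\<alpha> \<le> 1" "0 < u" "u \<le> 1" "0 < v" "v \<le> 1"
  shows "\<alpha> * (tent \<alpha> v - tent \<alpha> u) \<le> v powr \<alpha> * (1 + \<alpha> * qlog \<alpha> (1 / v))"
proof -
  consider "\<alpha> = 0" | "\<alpha> = 1" | "0 < \<alpha>" "\<alpha> < 1" using assms by linarith
  then show ?thesis
  proof cases
    case 1
    then show ?thesis by simp
  next
    case 2
    have "0 \<le> u - u * ln u"
      using assms ln_le_zero_iff[of u] mult_nonneg_nonpos[of u "ln u"] by linarith
    then show ?thesis
      using 2 assms by (simp add: tent_def qlog_def ln_div algebra_simps del: mult_le_cancel_left1)
  next
    case 3
    have "u powr 1 \<le> u powr \<alpha>"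
      using assms 3 by (intro powr_mono') auto
    also have "u powr 1 = u"
      using assms by simp
    finally have "u \<le> u powr \<alpha>" .
    moreover have "\<alpha> * u \<le> u"
      using assms mult_right_mono[of \<alpha> 1 u] by linarith
    ultimately have *: "0 \<le> u powr \<alpha> - \<alpha> * u"
      by linarith
    have "(1 / v) powr (\<alpha> - 1) = v powr (1 - \<alpha>)"
      using assms by (simp add: powr_divide powr_diff)
    moreover have "v powr (1 - \<alpha>) * v powr \<alpha> = v"
      using assms by (simp flip: powr_add)
    ultimately have "v powr \<alpha> * (1 + \<alpha> * qlog \<alpha> (1 / v)) * (1 - \<alpha>) = v powr \<alpha> - \<alpha> * v"
      using 3 by (simp add: qlog_def field_simps)
    moreover have "\<alpha> * (tent \<alpha> v - tent \<alpha> u) * (1 - \<alpha>) = v powr \<alpha> - \<alpha> * v - (u powr \<alpha> - \<alpha> * u)"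
      using 3 by (simp add: tent_def flip: diff_divide_distrib)
    ultimately have "\<alpha> * (tent \<alpha> v - tent \<alpha> u) * (1 - \<alpha>)
        \<le> v powr \<alpha> * (1 + \<alpha> * qlog \<alpha> (1 / v)) * (1 - \<alpha>)"
      using * by linarith
    then show ?thesis
      using 3 by (simp add: mult_right_le_imp_le)
  qed
qed

section \<open>Follow the regularised leader\<close>

definition ftrl_obj :: "real \<Rightarrow> ('k::finite \<Rightarrow> real) \<Rightarrow> ('k \<Rightarrow> real) \<Rightarrow> ('k \<Rightarrow> real) \<Rightarrow> real" where
  "ftrl_obj \<alpha> e L v = (\<Sum>i\<in>UNIV. v i * L i) - (\<Sum>i\<in>UNIV. tent \<alpha> (v i) / e i)"

definition ftrl_domain :: "real \<Rightarrow> ('k::finite \<Rightarrow> real) set" where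
  "ftrl_domain \<alpha> = {v \<in> prob_simplex. 0 < \<alpha> \<or> (\<forall>i. 0 < v i)}"

text \<open>Competitors are restricted to the interior, where \<open>tent\<close> is differentiable
  for every \<alpha>; all points compared later, including the comparator, lie there.\<close>

definition ftrl_min :: "real \<Rightarrow> ('k::finite \<Rightarrow> real) \<Rightarrow> ('k \<Rightarrow> real) \<Rightarrow> ('k \<Rightarrow> real) \<Rightarrow> bool" where
  "ftrl_min \<alpha> e L w \<longleftrightarrow> w \<in> prob_simplex \<and> (\<forall>i. 0 < w i) \<and>
     (\<forall>v\<in>prob_simplex. (\<forall>i. 0 < v i) \<longrightarrow> ftrl_obj \<alpha> e L w \<le> ftrl_obj \<alpha> e L v)"

lemma prob_simplex_le_one:
  assumes "v \<in> prob_simplex"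
  shows "v i \<le> 1"
  using assms member_le_sum[of i UNIV v] by (auto simp: prob_simplex_def)

text \<open>Normalising \<open>tent\<close> shifts every summand by an amount independent of
  \<open>v\<close>, and such a \<open>C\<close> does not move the maximiser. On the boundary the
  formula would fail for \<open>\<alpha> = 0\<close>, where the regulariser is infinite but
  \<open>ln 0 = 0\<close>.\<close>

lemma tsallis_reg_tent:
  obtains C where "\<And>v :: 'k::finite \<Rightarrow> real. v \<in> ftrl_domain \<alpha> \<Longrightarrow>
    tsallis_reg \<alpha> \<xi> v = ereal (C - (\<Sum>i\<in>UNIV. tent \<alpha> (v i) / \<xi> i))"
proof -
  consider "\<alpha> = 0" | "\<alpha> = 1" | "\<alpha> \<noteq> 0" "\<alpha> \<noteq> 1" by blast
  then show ?thesis
  proof cases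
    case 1
    show ?thesis
      by (rule that[of 0]) (use 1 in \<open>auto simp: tsallis_reg_def tent_def ftrl_domain_def\<close>)
  next
    case 2
    have "tent \<alpha> x / y = - ((x * ln x - x + 1) / y)" for x y
      unfolding tent_def using 2 by (simp only: minus_divide_left) simp
    then have "tsallis_reg \<alpha> \<xi> v = ereal (0 - (\<Sum>i\<in>UNIV. tent \<alpha> (v i) / \<xi> i))" for v :: "'k \<Rightarrow> real"
      using 2 by (simp only: tsallis_reg_def sum_negf) simp
    then show ?thesis by (rule that)
  next
    case 3
    have "tent \<alpha> x / y = (x powr \<alpha> - \<alpha> * x) / (\<alpha> * (1 - \<alpha>) * y) - 1 / (\<alpha> * y)" for x y
    proof (cases "y = 0")
      case False
      with 3 show ?thesis by (simp add: tent_def divide_simps)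
    qed simp
    then have "tsallis_reg \<alpha> \<xi> v =
        ereal (- (\<Sum>i\<in>UNIV. 1 / (\<alpha> * \<xi> i)) - (\<Sum>i\<in>UNIV. tent \<alpha> (v i) / \<xi> i))" for v :: "'k \<Rightarrow> real"
      using 3 by (simp add: tsallis_reg_def sum_subtractf)
    then show ?thesis by (rule that)
  qed
qed

lemma uniform_in_ftrl_domain: "(\<lambda>i. 1 / real CARD('k)) \<in> (ftrl_domain \<alpha> :: ('k::finite \<Rightarrow> real) set)"
  by (simp add: ftrl_domain_def prob_simplex_def)

lemma arg_max_ftrl_obj:
  fixes w :: "'k::finite \<Rightarrow> real"
  assumes "0 \<le> \<alpha>" "0 < h" "\<And>i. 0 < \<xi> i"
    and w: "is_arg_max (\<lambda>v. ereal (\<Sum>i\<in>UNIV. v i * (- L i)) - tsallis_reg \<alpha> \<xi> v / ereal h)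
      (\<lambda>v. v \<in> prob_simplex) w"
  shows "w \<in> ftrl_domain \<alpha>"
    and "v \<in> ftrl_domain \<alpha> \<Longrightarrow> ftrl_obj \<alpha> (\<lambda>i. h * \<xi> i) L w \<le> ftrl_obj \<alpha> (\<lambda>i. h * \<xi> i) L v"
proof -
  let ?G = "\<lambda>v. ereal (\<Sum>i\<in>UNIV. v i * (- L i)) - tsallis_reg \<alpha> \<xi> v / ereal h"
  obtain C where C: "\<And>v :: 'k \<Rightarrow> real. v \<in> ftrl_domain \<alpha> \<Longrightarrow>
      tsallis_reg \<alpha> \<xi> v = ereal (C - (\<Sum>i\<in>UNIV. tent \<alpha> (v i) / \<xi> i))"
    using tsallis_reg_tent[of \<alpha> \<xi>] by blast
  have G: "?G v = ereal (- ftrl_obj \<alpha> (\<lambda>i. h * \<xi> i) L v - C / h)" if "v \<in> ftrl_domain \<alpha>" for v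
    using C[OF that] \<open>0 < h\<close>
    by (simp add: ftrl_obj_def sum_negf diff_divide_distrib sum_divide_distrib mult.commute)
  have max: "?G v \<le> ?G w" if "v \<in> prob_simplex" for v
    using w that by (simp add: is_arg_max_def not_less[symmetric])
  show dom: "w \<in> ftrl_domain \<alpha>"
  proof (rule ccontr)
    \<comment> \<open>This can only be \<open>\<alpha> = 0\<close> with a vanishing coordinate: the
      objective is then minus infinity, while it is finite at the uniform distribution.\<close>
    assume "w \<notin> ftrl_domain \<alpha>"
    with w \<open>0 \<le> \<alpha>\<close> have "tsallis_reg \<alpha> \<xi> w = \<infinity>"
      by (auto simp: is_arg_max_def ftrl_domain_def tsallis_reg_def)
    then have "?G w = - \<infinity>"
      using \<open>0 < h\<close> by simp
    moreover have "?G (\<lambda>i. 1 / real CARD('k)) \<le> ?G w"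
      using uniform_in_ftrl_domain[of \<alpha>] by (intro max) (simp add: ftrl_domain_def)
    ultimately show False
      using G[OF uniform_in_ftrl_domain] by simp
  qed
  assume v: "v \<in> ftrl_domain \<alpha>"
  then have "?G v \<le> ?G w"
    by (intro max) (simp add: ftrl_domain_def)
  then show "ftrl_obj \<alpha> (\<lambda>i. h * \<xi> i) L w \<le> ftrl_obj \<alpha> (\<lambda>i. h * \<xi> i) L v"
    unfolding G[OF v] G[OF dom] by simp
qed

lemma sum_two_updates:
  fixes f g :: "'k::finite \<Rightarrow> real"
  assumes "i \<noteq> j" "\<And>k. k \<noteq> i \<Longrightarrow> k \<noteq> j \<Longrightarrow> f k = g k"
  shows "sum f UNIV - sum g UNIV = (f i - g i) + (f j - g j)"
proof -
  have "sum f UNIV - sum g UNIV = (\<Sum>k\<in>UNIV. f k - g k)"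
    by (simp add: sum_subtractf)
  also have "\<dots> = (\<Sum>k\<in>{i, j}. f k - g k)"
    using assms by (intro sum.mono_neutral_right) auto
  finally show ?thesis
    using assms by simp
qed

text \<open>Moving mass from a heavy coordinate to a light one pays off, since the slope of
  \<^const>\<open>tent\<close> is infinite at \<open>0\<close>.\<close>

lemma ftrl_minimizer_ge:
  fixes w e :: "'k::finite \<Rightarrow> real"
  assumes \<alpha>: "0 \<le> \<alpha>" "\<alpha> \<le> 1" and e: "\<And>i. 0 < e i"
    and L: "\<And>i. 0 \<le> L i" "\<And>i. L i \<le> B"
    and dom: "w \<in> ftrl_domain \<alpha>"
    and opt: "\<And>v. v \<in> ftrl_domain \<alpha> \<Longrightarrow> ftrl_obj \<alpha> e L w \<le> ftrl_obj \<alpha> e L v"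
  defines "q \<equiv> - qlog \<alpha> (1 / (2 * real CARD('k)))"
  shows "w i \<ge> min (1 / real CARD('k)) (exp (- (sum e UNIV * (B + q * (\<Sum>j\<in>UNIV. 1 / e j)))))"
proof -
  define K where "K = real CARD('k)"
  have K: "K \<ge> 1"
    by (simp add: K_def Suc_leI)
  have w0: "\<And>i. 0 \<le> w i" and w1: "(\<Sum>i\<in>UNIV. w i) = 1"
    using dom by (auto simp: ftrl_domain_def prob_simplex_def)
  obtain j where j: "1 / K \<le> w j"
  proof (rule ccontr)
    assume "\<not> thesis"
    with that have "\<And>j. w j < 1 / K" by (meson not_less)
    then have "(\<Sum>i\<in>UNIV. w i) < (\<Sum>i\<in>(UNIV::'k set). 1 / K)"
      by (intro sum_strict_mono) auto
    with w1 show False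
      by (simp add: K_def)
  qed
  define c where "c = sum e UNIV * (B + q * (\<Sum>j\<in>UNIV. 1 / e j))"
  have q0: "0 \<le> q"
  proof -
    have "1 / (2 * K) \<le> 1" "0 < 1 / (2 * K)"
      using K by auto
    then show ?thesis
      using qlog_nonpos[of "1 / (2 * K)" \<alpha>] by (simp add: q_def K_def)
  qed
  show ?thesis
  proof (cases "i = j")
    case True
    with j show ?thesis by (simp add: K_def min_le_iff_disj)
  next
    case False
    have "exp (- c) \<le> w i"
    proof (rule field_le_epsilon)
      fix d0 :: real
      assume "0 < d0"
      \<comment> \<open>The cap leaves the donor \<open>j\<close> at least half of
        \<open>1 / K\<close>, so its slope is controlled by \<open>q\<close>. The shift
        \<open>d\<close> stays positive because \<open>w i\<close> may still be \<open>0\<close>,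
        where the slope does not exist.\<close>
      define d where "d = min d0 (1 / (2 * K))"
      have d: "0 < d" "d \<le> d0" "d \<le> 1 / (2 * K)"
        using \<open>0 < d0\<close> K by (auto simp: d_def)
      have wj: "1 / (2 * K) \<le> w j - d"
        using j d by (simp add: field_simps)
      have wjpos: "0 < w j - d"
        using wj K by (smt (verit) divide_pos_pos)
      define v where "v = w(i := w i + d, j := w j - d)"
      have "sum v UNIV - sum w UNIV = (v i - w i) + (v j - w j)"
        using False by (intro sum_two_updates) (auto simp: v_def)
      also have "\<dots> = 0"
        using False by (simp add: v_def)
      finally have "sum v UNIV = 1"
        using w1 by simp
      then have "v \<in> ftrl_domain \<alpha>"
        using dom d(1) wjpos w0 by (auto simp: ftrl_domain_def prob_simplex_def v_def add_pos_nonneg)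
      then have "0 \<le> ftrl_obj \<alpha> e L v - ftrl_obj \<alpha> e L w"
        using opt by simp
      also have "\<dots> = ((\<Sum>i\<in>UNIV. v i * L i) - (\<Sum>i\<in>UNIV. w i * L i))
          - ((\<Sum>i\<in>UNIV. tent \<alpha> (v i) / e i) - (\<Sum>i\<in>UNIV. tent \<alpha> (w i) / e i))"
        by (simp add: ftrl_obj_def)
      also have "(\<Sum>i\<in>UNIV. v i * L i) - (\<Sum>i\<in>UNIV. w i * L i)
          = (v i * L i - w i * L i) + (v j * L j - w j * L j)"
        using False by (intro sum_two_updates) (auto simp: v_def)
      also have "\<dots> = d * (L i - L j)"
        using False by (simp add: v_def algebra_simps)
      also have "(\<Sum>i\<in>UNIV. tent \<alpha> (v i) / e i) - (\<Sum>i\<in>UNIV. tent \<alpha> (w i) / e i)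
          = (tent \<alpha> (v i) / e i - tent \<alpha> (w i) / e i) + (tent \<alpha> (v j) / e j - tent \<alpha> (w j) / e j)"
        using False by (intro sum_two_updates) (auto simp: v_def)
      also have "\<dots> = (tent \<alpha> (w i + d) - tent \<alpha> (w i)) / e i
          - (tent \<alpha> (w j) - tent \<alpha> (w j - d)) / e j"
        using False by (simp add: v_def diff_divide_distrib)
      finally have gain: "(tent \<alpha> (w i + d) - tent \<alpha> (w i)) / e i
          - (tent \<alpha> (w j) - tent \<alpha> (w j - d)) / e j \<le> d * (L i - L j)"
        by simp
      have "- qlog \<alpha> (w i + d) * d \<le> tent \<alpha> (w i + d) - tent \<alpha> (w i)"
        using \<alpha> d dom w0 by (intro tent_increment_ge) (auto simp: ftrl_domain_def)
      then have 1: "- qlog \<alpha> (w i + d) * d / e i \<le> (tent \<alpha> (w i + d) - tent \<alpha> (w i)) / e i"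
        using e[of i] by (intro divide_right_mono) auto
      have "tent \<alpha> (w j) - tent \<alpha> (w j - d) \<le> - qlog \<alpha> (w j - d) * d"
        using tent_tangent[of \<alpha> "w j - d" "w j"] \<alpha> wjpos d(1) by simp
      also have "\<dots> \<le> q * d"
        using qlog_mono[of "1 / (2 * K)" "w j - d" \<alpha>] wj K d(1) by (simp add: q_def K_def)
      finally have 2: "(tent \<alpha> (w j) - tent \<alpha> (w j - d)) / e j \<le> q * d / e j"
        using e[of j] by (intro divide_right_mono) auto
      have 3: "d * (L i - L j) \<le> d * B"
        using L(1)[of j] L(2)[of i] d(1) by (intro mult_left_mono) auto
      have "- qlog \<alpha> (w i + d) / e i * d \<le> (B + q / e j) * d"
        using gain 1 2 3 by (simp add: algebra_simps)
      then have "- qlog \<alpha> (w i + d) / e i \<le> B + q / e j"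
        using d(1) by (rule mult_right_le_imp_le)
      also have "q / e j \<le> q * (\<Sum>j\<in>UNIV. 1 / e j)"
        using q0 e member_le_sum[of j UNIV "\<lambda>j. 1 / e j"] less_imp_le[OF e]
          mult_left_mono[of "1 / e j" "\<Sum>j\<in>UNIV. 1 / e j" q] by simp
      finally have "- qlog \<alpha> (w i + d) \<le> e i * (B + q * (\<Sum>j\<in>UNIV. 1 / e j))"
        using e[of i] by (simp only: pos_divide_le_eq mult.commute)
      also have "\<dots> \<le> c"
        unfolding c_def
      proof (rule mult_right_mono)
        show "e i \<le> sum e UNIV"
          using e by (intro member_le_sum) (auto intro: less_imp_le)
        show "0 \<le> B + q * (\<Sum>j\<in>UNIV. 1 / e j)"
          using q0 e L(1)[of i] L(2)[of i]
          by (intro add_nonneg_nonneg mult_nonneg_nonneg sum_nonneg) (auto intro: less_imp_le)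
      qed
      finally have "- c \<le> qlog \<alpha> (w i + d)"
        by simp
      \<comment> \<open>Passing to \<open>ln\<close> makes the lower bound exponential for every
        \<alpha> at once.\<close>
      also have "\<dots> \<le> ln (w i + d)"
        using \<alpha> d(1) w0[of i] by (intro qlog_le_ln) auto
      finally have "exp (- c) \<le> w i + d"
        using d(1) w0[of i] by (simp add: ln_ge_iff add_nonneg_pos)
      with d(2) show "exp (- c) \<le> w i + d0" by simp
    qed
    then show ?thesis
      by (simp add: c_def min_le_iff_disj)
  qed
qed

lemma ftrl_min_pos: "ftrl_min \<alpha> e L w \<Longrightarrow> 0 < w i"
  by (simp add: ftrl_min_def)

lemma ftrl_min_simplex: "ftrl_min \<alpha> e L w \<Longrightarrow> w \<in> prob_simplex"
  by (simp add: ftrl_min_def)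

text \<open>Comparing the minimiser with nearby points of the segment towards \<open>v\<close> gives the
  quadratic growth without any first-order condition.\<close>

lemma ftrl_min_growth:
  fixes w v e :: "'k::finite \<Rightarrow> real"
  assumes \<alpha>: "\<alpha> \<le> 1" and e: "\<And>i. 0 < e i"
    and w: "ftrl_min \<alpha> e L w" and v: "v \<in> prob_simplex" "\<And>i. 0 < v i"
  shows "ftrl_obj \<alpha> e L w + (\<Sum>i\<in>UNIV. 1/2 * max (w i) (v i) powr (\<alpha> - 2) * (v i - w i)\<^sup>2 / e i)
    \<le> ftrl_obj \<alpha> e L v"
proof -
  define Q where "Q = (\<Sum>i\<in>UNIV. 1/2 * max (w i) (v i) powr (\<alpha> - 2) * (v i - w i)\<^sup>2 / e i)"
  define D where "D = ftrl_obj \<alpha> e L v - ftrl_obj \<alpha> e L w"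
  have wp: "\<And>i. 0 < w i" "w \<in> prob_simplex"
    using w by (auto simp: ftrl_min_def)
  have Q0: "0 \<le> Q"
    unfolding Q_def using e by (intro sum_nonneg divide_nonneg_pos mult_nonneg_nonneg) auto
  \<comment> \<open>Moving by the fraction \<open>r\<close> changes the objective by at most
    \<open>r * D - r * (1 - r) * Q\<close>, which minimality makes nonnegative. After division by
    \<open>r\<close>, the limit at \<open>0\<close> gives \<open>Q \<le> D\<close>.\<close>
  have key: "(1 - r) * Q \<le> D" if r: "0 < r" "r < 1" for r
  proof -
    define z where "z i = w i + r * (v i - w i)" for i
    have zeq: "z i = (1 - r) * w i + r * v i" for i
      by (simp add: z_def algebra_simps)
    have zpos: "0 < z i" for i
      unfolding zeq using r wp v by (simp add: add_pos_pos)
    have "sum z UNIV = (1 - r) * sum w UNIV + r * sum v UNIV"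
      by (simp add: zeq sum.distrib sum_distrib_left)
    also have "\<dots> = 1"
      using wp v by (simp add: prob_simplex_def)
    finally have "z \<in> prob_simplex"
      using zpos by (auto simp: prob_simplex_def intro: less_imp_le)
    then have "ftrl_obj \<alpha> e L w \<le> ftrl_obj \<alpha> e L z"
      using w zpos by (simp add: ftrl_min_def)
    also have "\<dots> \<le> (\<Sum>i\<in>UNIV. ((1 - r) * (w i * L i) + r * (v i * L i))
        - ((1 - r) * (tent \<alpha> (w i) / e i) + r * (tent \<alpha> (v i) / e i)
           + r * (1 - r) * (1/2 * max (w i) (v i) powr (\<alpha> - 2) * (v i - w i)\<^sup>2 / e i)))"
      unfolding ftrl_obj_def sum_subtractf[symmetric]
    proof (intro sum_mono diff_mono)
      fix i
      show "z i * L i \<le> (1 - r) * (w i * L i) + r * (v i * L i)"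
        by (simp add: zeq algebra_simps)
      have "(1 - r) * tent \<alpha> (w i) + r * tent \<alpha> (v i)
          + 1/2 * r * (1 - r) * max (w i) (v i) powr (\<alpha> - 2) * (v i - w i)\<^sup>2 \<le> tent \<alpha> (z i)"
        unfolding z_def using \<alpha> wp v r by (intro tent_combination_ge) auto
      then have "((1 - r) * tent \<alpha> (w i) + r * tent \<alpha> (v i)
          + 1/2 * r * (1 - r) * max (w i) (v i) powr (\<alpha> - 2) * (v i - w i)\<^sup>2) / e i
          \<le> tent \<alpha> (z i) / e i"
        using e[of i] by (intro divide_right_mono) auto
      then show "(1 - r) * (tent \<alpha> (w i) / e i) + r * (tent \<alpha> (v i) / e i)
           + r * (1 - r) * (1/2 * max (w i) (v i) powr (\<alpha> - 2) * (v i - w i)\<^sup>2 / e i)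
          \<le> tent \<alpha> (z i) / e i"
        by (simp add: add_divide_distrib mult_ac)
    qed
    also have "\<dots> = (1 - r) * ftrl_obj \<alpha> e L w + r * ftrl_obj \<alpha> e L v - r * (1 - r) * Q"
      by (simp add: ftrl_obj_def Q_def sum_subtractf sum.distrib sum_distrib_left right_diff_distrib)
    finally have "r * ((1 - r) * Q) \<le> r * D"
      by (simp add: D_def algebra_simps)
    then show ?thesis
      using r(1) by (rule mult_left_le_imp_le)
  qed
  have "((\<lambda>r. (1 - r) * Q) \<longlongrightarrow> (1 - 0) * Q) (at_right 0)"
    by (intro tendsto_intros)
  moreover have "\<forall>\<^sub>F r in at_right 0. (1 - r) * Q \<le> D"
    using key eventually_at_right[of 0 1] by (auto intro!: exI[of _ 1] simp: eventually_at_right_field)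
  ultimately have "(1 - 0) * Q \<le> D"
    by (rule tendsto_upperbound) simp
  then show ?thesis
    by (simp add: D_def Q_def)
qed

text \<open>Adding the growth inequalities of the two minimisers cancels the regularisers and leaves
  a linear form in \<open>L - L'\<close>; the curvature is at least \<open>1\<close> since weights
  are at most \<open>1\<close>. This continuity in the loss vector is the source of measurability of
  the weights.\<close>

lemma ftrl_min_Hoelder:
  fixes w v e :: "'k::finite \<Rightarrow> real"
  assumes \<alpha>: "\<alpha> \<le> 1" and e: "\<And>i. 0 < e i"
    and w: "ftrl_min \<alpha> e L w" and v: "ftrl_min \<alpha> e L' v"
  shows "(w i - v i)\<^sup>2 \<le> sum e UNIV * (\<Sum>j\<in>UNIV. \<bar>L j - L' j\<bar>)"
proof -
  let ?q = "\<lambda>i. 1/2 * max (w i) (v i) powr (\<alpha> - 2) * (v i - w i)\<^sup>2 / e i"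
  let ?q' = "\<lambda>i. 1/2 * max (v i) (w i) powr (\<alpha> - 2) * (w i - v i)\<^sup>2 / e i"
  note pos = ftrl_min_pos[OF w] ftrl_min_pos[OF v]
  note simplex = ftrl_min_simplex[OF w] ftrl_min_simplex[OF v]
  have sym: "?q' i = ?q i" for i
    by (simp add: max.commute power2_commute)
  have "ftrl_obj \<alpha> e L w + sum ?q UNIV \<le> ftrl_obj \<alpha> e L v"
    using \<alpha> e w simplex(2) pos(2) by (rule ftrl_min_growth)
  moreover have "ftrl_obj \<alpha> e L' v + sum ?q' UNIV \<le> ftrl_obj \<alpha> e L' w"
    using \<alpha> e v simplex(1) pos(1) by (rule ftrl_min_growth)
  ultimately have "2 * sum ?q UNIV \<le> (\<Sum>j\<in>UNIV. v j * L j) - (\<Sum>j\<in>UNIV. w j * L j)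
      - ((\<Sum>j\<in>UNIV. v j * L' j) - (\<Sum>j\<in>UNIV. w j * L' j))"
    unfolding sym by (simp add: ftrl_obj_def)
  also have "\<dots> = (\<Sum>j\<in>UNIV. (v j - w j) * (L j - L' j))"
    by (simp add: sum_subtractf left_diff_distrib right_diff_distrib)
  also have "\<dots> \<le> (\<Sum>j\<in>UNIV. \<bar>L j - L' j\<bar>)"
  proof (rule sum_mono)
    fix j
    have "\<bar>v j - w j\<bar> \<le> 1"
      using pos(1)[of j] pos(2)[of j] prob_simplex_le_one[OF simplex(1), of j]
        prob_simplex_le_one[OF simplex(2), of j] by linarith
    then have "\<bar>v j - w j\<bar> * \<bar>L j - L' j\<bar> \<le> 1 * \<bar>L j - L' j\<bar>"
      by (intro mult_right_mono) auto
    then show "(v j - w j) * (L j - L' j) \<le> \<bar>L j - L' j\<bar>"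
      by (simp flip: abs_mult)
  qed
  finally have *: "2 * sum ?q UNIV \<le> (\<Sum>j\<in>UNIV. \<bar>L j - L' j\<bar>)" .
  define m where "m = max (w i) (v i)"
  have m: "0 < m" "m \<le> 1"
    using pos(1)[of i] prob_simplex_le_one[OF simplex(1), of i]
      prob_simplex_le_one[OF simplex(2), of i] by (auto simp: m_def)
  have "1 \<le> m powr (\<alpha> - 2)"
    using powr_mono'[of "\<alpha> - 2" 0 m] m \<alpha> by simp
  then have "(v i - w i)\<^sup>2 \<le> m powr (\<alpha> - 2) * (v i - w i)\<^sup>2"
    using mult_right_mono[of 1 "m powr (\<alpha> - 2)" "(v i - w i)\<^sup>2"] by simp
  also have "\<dots> = e i * (2 * ?q i)"
    using e[of i] by (simp add: m_def)
  also have "\<dots> \<le> e i * (2 * sum ?q UNIV)"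
    using less_imp_le[OF e] by (intro mult_left_mono member_le_sum divide_nonneg_nonneg) auto
  also have "\<dots> \<le> e i * (\<Sum>j\<in>UNIV. \<bar>L j - L' j\<bar>)"
    using * e[of i] by (intro mult_left_mono) auto
  also have "\<dots> \<le> sum e UNIV * (\<Sum>j\<in>UNIV. \<bar>L j - L' j\<bar>)"
    using e by (intro mult_right_mono member_le_sum sum_nonneg) (auto intro: less_imp_le)
  finally show ?thesis
    by (simp add: power2_commute)
qed

section \<open>Decomposition of the regret into stability and penalty\<close>

definition stability :: "real \<Rightarrow> ('k::finite \<Rightarrow> real) \<Rightarrow> ('k \<Rightarrow> real) \<Rightarrow> ('k \<Rightarrow> real) \<Rightarrow> ('k \<Rightarrow> real) \<Rightarrow> real" where
  "stability \<alpha> e x w v = (\<Sum>i\<in>UNIV. (w i - v i) * x i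
      - 1/2 * max (w i) (v i) powr (\<alpha> - 2) * (v i - w i)\<^sup>2 / e i)"

text \<open>By the convention that \<open>1 / \<eta> 0\<close> is \<open>0\<close>, the first round
  pays the full inverse rate. The value may be negative, as the rate need not decrease.\<close>

definition inv_rate_step :: "(nat \<Rightarrow> real) \<Rightarrow> nat \<Rightarrow> real" where
  "inv_rate_step \<eta> t = 1 / \<eta> t - (if t \<le> 1 then 0 else 1 / \<eta> (t - 1))"

lemma sum_inv_rate_step:
  assumes "T \<ge> 1"
  shows "(\<Sum>t=1..T. inv_rate_step \<eta> t) = 1 / \<eta> T"
  using assms by (induction T rule: nat_induct_at_least) (auto simp: inv_rate_step_def)

text \<open>A potential argument along \<open>F t (w t)\<close>: quadratic growth at
  \<open>w t\<close> towards the next weights replaces a Bregman divergence, and no sign of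
  \<open>inv_rate_step\<close> is assumed. Losses stop at \<open>T - 1\<close> while penalties run
  to \<open>T\<close>, because each round is closed by comparison with the weights of the
  next.\<close>

lemma ftrl_regret:
  fixes w x :: "nat \<Rightarrow> 'k::finite \<Rightarrow> real"
  assumes \<alpha>: "\<alpha> \<le> 1" and \<xi>: "\<And>i. 0 < \<xi> i" and \<eta>: "\<And>t. t \<ge> 1 \<Longrightarrow> 0 < \<eta> t"
    and w: "\<And>t. t \<ge> 1 \<Longrightarrow> ftrl_min \<alpha> (\<lambda>i. \<eta> t * \<xi> i) (\<lambda>i. \<Sum>s=1..t-1. x s i) (w t)"
    and u: "u \<in> prob_simplex" "\<And>i. 0 < u i" and T: "T \<ge> 1"
  shows "(\<Sum>t\<in>{1..<T}. \<Sum>i\<in>UNIV. (w t i - u i) * x t i)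
    \<le> (\<Sum>t\<in>{1..<T}. stability \<alpha> (\<lambda>i. \<eta> t * \<xi> i) (x t) (w t) (w (Suc t)))
      + (\<Sum>t=1..T. inv_rate_step \<eta> t * (\<Sum>i\<in>UNIV. (tent \<alpha> (w t i) - tent \<alpha> (u i)) / \<xi> i))"
proof -
  define F where "F t = ftrl_obj \<alpha> (\<lambda>i. \<eta> t * \<xi> i) (\<lambda>i. \<Sum>s=1..t-1. x s i)" for t
  define P where "P v = (\<Sum>i\<in>UNIV. tent \<alpha> (v i) / \<xi> i)" for v
  have F: "F t v = (\<Sum>i\<in>UNIV. v i * (\<Sum>s=1..t-1. x s i)) - P v / \<eta> t" for t v
    by (simp add: F_def ftrl_obj_def P_def sum_divide_distrib mult.commute)
  have *: "(\<Sum>t\<in>{1..<T}. \<Sum>i\<in>UNIV. w t i * x t i)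
    \<le> (\<Sum>t\<in>{1..<T}. stability \<alpha> (\<lambda>i. \<eta> t * \<xi> i) (x t) (w t) (w (Suc t)))
      + F T (w T) + (\<Sum>t=1..T. inv_rate_step \<eta> t * P (w t))"
    using T
  proof (induction T rule: nat_induct_at_least)
    case base
    then show ?case
      using \<eta>[of 1] by (simp add: F inv_rate_step_def)
  next
    case (Suc T)
    let ?v = "w (Suc T)"
    have "F T (w T) + (\<Sum>i\<in>UNIV. 1/2 * max (w T i) (?v i) powr (\<alpha> - 2) * (?v i - w T i)\<^sup>2 / (\<eta> T * \<xi> i))
        \<le> F T ?v"
      unfolding F_def using \<alpha> \<xi> \<eta> Suc w[of T] w[of "Suc T"] ftrl_min_pos[OF w[of "Suc T"]]
      by (intro ftrl_min_growth) (auto simp: ftrl_min_def)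
    then have "(\<Sum>i\<in>UNIV. w T i * x T i) \<le> stability \<alpha> (\<lambda>i. \<eta> T * \<xi> i) (x T) (w T) ?v
        + F T ?v - F T (w T) + (\<Sum>i\<in>UNIV. ?v i * x T i)"
      by (simp add: stability_def sum_subtractf left_diff_distrib)
    moreover have "F (Suc T) ?v = F T ?v + (\<Sum>i\<in>UNIV. ?v i * x T i) - inv_rate_step \<eta> (Suc T) * P ?v"
    proof -
      have "(\<Sum>s=1..Suc T - 1. x s i) = (\<Sum>s=1..T-1. x s i) + x T i" for i
        using Suc.hyps by (cases T) auto
      then show ?thesis
        using Suc.hyps unfolding F
        by (simp add: inv_rate_step_def sum.distrib distrib_left algebra_simps)
    qed
    ultimately show ?case
      using Suc by simp
  qed
  have "F T (w T) \<le> F T u"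
    using w[OF T] u by (simp add: ftrl_min_def F_def)
  also have "F T u = (\<Sum>i\<in>UNIV. u i * (\<Sum>s\<in>{1..<T}. x s i)) - (\<Sum>t=1..T. inv_rate_step \<eta> t * P u)"
  proof -
    have "{1..T-1} = {1..<T}" using T by auto
    then show ?thesis
      unfolding F using sum_inv_rate_step[OF T, of \<eta>] by (simp flip: sum_distrib_right)
  qed
  finally have "F T (w T) \<le> \<dots>" .
  moreover have "(\<Sum>i\<in>UNIV. u i * (\<Sum>s\<in>{1..<T}. x s i)) = (\<Sum>t\<in>{1..<T}. \<Sum>i\<in>UNIV. u i * x t i)"
    unfolding sum_distrib_left by (rule sum.swap)
  ultimately show ?thesis
    using * by (simp add: left_diff_distrib sum_subtractf diff_divide_distrib P_def right_diff_distrib)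
qed

lemma quadratic_max:
  fixes z y c :: real
  assumes "c > 0"
  shows "z * y - c * z\<^sup>2 \<le> y\<^sup>2 / (4 * c)"
proof -
  have "y\<^sup>2 / (4 * c) - (z * y - c * z\<^sup>2) = (y - 2 * c * z)\<^sup>2 / (4 * c)"
    using assms by (simp add: field_simps power2_eq_square)
  also have "\<dots> \<ge> 0"
    using assms by simp
  finally show ?thesis by simp
qed

lemma stability_decrease:
  fixes w v y e :: real
  assumes "\<alpha> \<le> 1" "0 < w" "0 < v" "0 < e" "0 \<le> y"
  shows "(w - v) * y - 1/2 * max w v powr (\<alpha> - 2) * (v - w)\<^sup>2 / e \<le> 1/2 * e * y\<^sup>2 * w powr (2 - \<alpha>)"
proof (cases "w \<le> v")
  case True
  then have "(w - v) * y \<le> 0"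
    using assms by (intro mult_nonpos_nonneg) auto
  moreover have "0 \<le> 1/2 * max w v powr (\<alpha> - 2) * (v - w)\<^sup>2 / e" "0 \<le> 1/2 * e * y\<^sup>2 * w powr (2 - \<alpha>)"
    using assms by auto
  ultimately show ?thesis by linarith
next
  case False
  define c where "c = 1/2 * w powr (\<alpha> - 2) / e"
  have c: "c > 0"
    using assms by (simp add: c_def)
  have "(w - v) * y - c * (w - v)\<^sup>2 \<le> y\<^sup>2 / (4 * c)"
    using c by (rule quadratic_max)
  also have "y\<^sup>2 / (4 * c) = 1/2 * e * y\<^sup>2 * w powr (2 - \<alpha>)"
    using assms by (simp add: c_def field_simps flip: powr_add)
  finally show ?thesis
    using False by (simp add: c_def power2_commute max_def)
qed

text \<open>Now the curvature is taken at \<open>v\<close>, where it is weaker than at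
  \<open>w\<close>. Up to \<open>v = \<kappa> * w\<close> this loses at most a factor
  \<open>\<kappa>\<^sup>2\<close>. Beyond that, \<open>small\<close> makes the quadratic term
  outweigh the linear one, so the left-hand side is nonpositive.\<close>

lemma stability_increase:
  fixes w v y e \<kappa> :: real
  assumes "0 \<le> \<alpha>" "\<alpha> \<le> 1" "0 < w" "0 < v" "v \<le> 1" "0 < e" "0 \<le> y" "1 \<le> \<kappa>"
    and small: "2 * e * y \<le> 1 - 1 / \<kappa>"
  shows "(v - w) * y - 1/2 * max w v powr (\<alpha> - 2) * (v - w)\<^sup>2 / e
    \<le> \<kappa>\<^sup>2 / 2 * e * y\<^sup>2 * w powr (2 - \<alpha>)"
proof -
  have rhs: "0 \<le> \<kappa>\<^sup>2 / 2 * e * y\<^sup>2 * w powr (2 - \<alpha>)"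
    using assms by auto
  consider "v \<le> w" | "w < v" "v \<le> \<kappa> * w" | "w < v" "\<kappa> * w < v" by linarith
  then show ?thesis
  proof cases
    case 1
    then have "(v - w) * y \<le> 0"
      using assms by (intro mult_nonpos_nonneg) auto
    moreover have "0 \<le> 1/2 * max w v powr (\<alpha> - 2) * (v - w)\<^sup>2 / e"
      using assms by auto
    ultimately show ?thesis using rhs by linarith
  next
    case 2
    define c where "c = 1/2 * w powr (\<alpha> - 2) / (\<kappa>\<^sup>2 * e)"
    have c: "c > 0"
      using assms by (simp add: c_def)
    have "\<kappa> powr (- 2) * w powr (\<alpha> - 2) \<le> \<kappa> powr (\<alpha> - 2) * w powr (\<alpha> - 2)"
      using assms by (intro mult_right_mono powr_mono) auto
    also have "\<dots> = (\<kappa> * w) powr (\<alpha> - 2)"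
      using assms by (simp add: powr_mult)
    also have "\<dots> \<le> v powr (\<alpha> - 2)"
      using assms 2 by (intro powr_mono2') auto
    finally have "w powr (\<alpha> - 2) / \<kappa>\<^sup>2 \<le> v powr (\<alpha> - 2)"
      using assms by (simp add: powr_minus divide_inverse mult.commute)
    then have "1/2 * (w powr (\<alpha> - 2) / \<kappa>\<^sup>2) * (v - w)\<^sup>2 / e \<le> 1/2 * v powr (\<alpha> - 2) * (v - w)\<^sup>2 / e"
      using assms by (intro divide_right_mono mult_right_mono mult_left_mono) auto
    then have "c * (v - w)\<^sup>2 \<le> 1/2 * v powr (\<alpha> - 2) * (v - w)\<^sup>2 / e"
      using assms by (simp add: c_def)
    moreover have "(v - w) * y - c * (v - w)\<^sup>2 \<le> y\<^sup>2 / (4 * c)"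
      using c by (rule quadratic_max)
    moreover have "y\<^sup>2 / (4 * c) = \<kappa>\<^sup>2 / 2 * e * y\<^sup>2 * w powr (2 - \<alpha>)"
      using assms by (simp add: c_def field_simps flip: powr_add)
    ultimately show ?thesis
      using 2 by (simp add: max_def)
  next
    case 3
    have "w / v \<le> 1 / \<kappa>"
      using 3 assms by (simp add: field_simps)
    with small have "2 * e * y \<le> 1 - w / v"
      by linarith
    then have "y \<le> (1 - w / v) / (2 * e)"
      using assms by (simp add: pos_le_divide_eq mult.commute)
    then have "(v - w) * y \<le> (v - w) * ((1 - w / v) / (2 * e))"
      using 3 by (intro mult_left_mono) auto
    also have "\<dots> = 1/2 * v powr (- 1) * (v - w)\<^sup>2 / e"
    proof -
      have "1 - w / v = (v - w) / v"
        using assms by (simp add: diff_divide_distrib)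
      then show ?thesis
        using assms(4) by (simp add: powr_minus inverse_eq_divide power2_eq_square)
    qed
    also have "\<dots> \<le> 1/2 * v powr (\<alpha> - 2) * (v - w)\<^sup>2 / e"
    proof -
      have "v powr (- 1) \<le> v powr (\<alpha> - 2)"
        using assms(2,4,5) by (intro powr_mono') auto
      then show ?thesis
        using assms(6) by (intro divide_right_mono mult_right_mono) auto
    qed
    finally show ?thesis
      using 3 rhs by (simp add: max_def)
  qed
qed

lemma stability_le:
  fixes w v e :: "'k::finite \<Rightarrow> real"
  assumes \<alpha>: "\<alpha> \<le> 1" and e: "\<And>i. 0 < e i" and w: "\<And>i. 0 < w i" and v: "\<And>i. 0 < v i"
    and a: "0 \<le> a" "a \<le> 1"
  shows "stability \<alpha> e (\<lambda>i. of_bool (j = i) * a / w i) w v \<le> 1/2 * e j * w j powr (- \<alpha>)"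
proof -
  have "stability \<alpha> e (\<lambda>i. of_bool (j = i) * a / w i) w v
      \<le> (\<Sum>i\<in>UNIV. if i = j then 1/2 * e i * (a / w i)\<^sup>2 * w i powr (2 - \<alpha>) else 0)"
    unfolding stability_def
  proof (rule sum_mono)
    fix i
    show "(w i - v i) * (of_bool (j = i) * a / w i)
        - 1/2 * max (w i) (v i) powr (\<alpha> - 2) * (v i - w i)\<^sup>2 / e i
        \<le> (if i = j then 1/2 * e i * (a / w i)\<^sup>2 * w i powr (2 - \<alpha>) else 0)"
      using stability_decrease[OF \<alpha> w v e, of "a / w i" i i i] a w[of i] e[of i] by auto
  qed
  also have "\<dots> = 1/2 * e j * a\<^sup>2 * w j powr (- \<alpha>)"
  proof -
    have "w j powr (2 - \<alpha>) = (w j)\<^sup>2 * w j powr (- \<alpha>)"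
      using w[of j] powr_add[of "w j" 2 "- \<alpha>"] by simp
    then show ?thesis
      using w[of j] by (simp add: power_divide)
  qed
  also have "\<dots> \<le> 1/2 * e j * 1 * w j powr (- \<alpha>)"
    using e[of j] a by (intro mult_right_mono mult_left_mono) (auto simp: power_le_one)
  finally show ?thesis by simp
qed

text \<open>The mass leaving the heavy arm arrives at the others, which is where it is cheap.\<close>

lemma stability_heavy_le:
  fixes w v e :: "'k::finite \<Rightarrow> real"
  assumes \<alpha>: "0 \<le> \<alpha>" "\<alpha> \<le> 1" and e: "\<And>i. 0 < e i"
    and w: "w \<in> prob_simplex" "\<And>i. 0 < w i" and v: "v \<in> prob_simplex" "\<And>i. 0 < v i"
    and a: "0 \<le> a" "a \<le> 1" and heavy: "3/4 \<le> w j" and \<kappa>: "1 \<le> \<kappa>"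
    and small: "\<And>i. i \<noteq> j \<Longrightarrow> 8/3 * e i \<le> 1 - 1 / \<kappa>"
  shows "stability \<alpha> e (\<lambda>i. of_bool (j = i) * a / w i) w v
    \<le> (\<Sum>i\<in>UNIV - {j}. \<kappa>\<^sup>2 / 2 * e i * w i powr (2 - \<alpha>)) / (w j)\<^sup>2"
proof -
  let ?q = "\<lambda>i. 1/2 * max (w i) (v i) powr (\<alpha> - 2) * (v i - w i)\<^sup>2 / e i"
  define y where "y = a / w j"
  have y: "0 \<le> y" "y \<le> 1 / w j" "y \<le> 4/3"
    using a heavy w(2)[of j] by (auto simp: y_def divide_right_mono field_simps)
  have y2: "y\<^sup>2 \<le> 1 / (w j)\<^sup>2"
    using power_mono[OF y(2) y(1), of 2] by (simp add: power_divide)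
  have "sum w UNIV = sum v UNIV"
    using w v by (simp add: prob_simplex_def)
  then have mass: "w j - v j = (\<Sum>i\<in>UNIV - {j}. v i - w i)"
    by (simp add: sum.remove[of UNIV j] sum_subtractf)
  have "stability \<alpha> e (\<lambda>i. of_bool (j = i) * a / w i) w v
      = (\<Sum>i\<in>UNIV. (w i - v i) * (of_bool (j = i) * a / w i)) - sum ?q UNIV"
    by (simp add: stability_def sum_subtractf)
  also have "(\<Sum>i\<in>UNIV. (w i - v i) * (of_bool (j = i) * a / w i)) = (w j - v j) * y"
    by (subst sum.remove[of UNIV j]) (auto simp: y_def)
  also have "\<dots> = (\<Sum>i\<in>UNIV - {j}. (v i - w i) * y)"
    by (simp add: mass sum_distrib_right)
  also have "\<dots> - sum ?q UNIV \<le> \<dots> - sum ?q (UNIV - {j})"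
    using e by (intro diff_left_mono sum_mono2) (auto intro!: divide_nonneg_pos mult_nonneg_nonneg)
  also have "\<dots> = (\<Sum>i\<in>UNIV - {j}. (v i - w i) * y - ?q i)"
    by (simp add: sum_subtractf)
  also have "\<dots> \<le> (\<Sum>i\<in>UNIV - {j}. \<kappa>\<^sup>2 / 2 * e i * w i powr (2 - \<alpha>) / (w j)\<^sup>2)"
  proof (rule sum_mono)
    fix i assume i: "i \<in> UNIV - {j}"
    \<comment> \<open>Heaviness of arm \<open>j\<close> gives \<open>y \<le> 4/3\<close>, which
      explains the \<open>8/3\<close> in \<open>small\<close>.\<close>
    have "2 * e i * y \<le> 2 * e i * (4/3)"
      using y e[of i] by (intro mult_left_mono) auto
    also have "\<dots> \<le> 1 - 1 / \<kappa>"
      using small[of i] i by simp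
    finally have "2 * e i * y \<le> 1 - 1 / \<kappa>" .
    then have "(v i - w i) * y - ?q i \<le> \<kappa>\<^sup>2 / 2 * e i * y\<^sup>2 * w i powr (2 - \<alpha>)"
      using \<alpha> w v e y \<kappa> prob_simplex_le_one[OF v(1)] by (intro stability_increase) auto
    also have "\<dots> \<le> \<kappa>\<^sup>2 / 2 * e i * (1 / (w j)\<^sup>2) * w i powr (2 - \<alpha>)"
      using e[of i] y2 by (intro mult_right_mono mult_left_mono) auto
    finally show "(v i - w i) * y - ?q i \<le> \<kappa>\<^sup>2 / 2 * e i * w i powr (2 - \<alpha>) / (w j)\<^sup>2"
      by simp
  qed
  also have "\<dots> = (\<Sum>i\<in>UNIV - {j}. \<kappa>\<^sup>2 / 2 * e i * w i powr (2 - \<alpha>)) / (w j)\<^sup>2"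
    by (simp add: sum_divide_distrib)
  finally show ?thesis .
qed

section \<open>The learning rate\<close>

lemma sum_inverse_le_ln:
  assumes "n \<ge> 1"
  shows "(\<Sum>t=2..n. 1 / real t) \<le> ln (real n)"
  using assms
proof (induction n rule: nat_induct_at_least)
  case (Suc n)
  have "ln (real n / real (Suc n)) \<le> real n / real (Suc n) - 1"
    using Suc by (intro ln_le_minus_one) auto
  then have "1 / real (Suc n) \<le> ln (real (Suc n)) - ln (real n)"
    using Suc by (simp add: ln_div field_simps)
  with Suc show ?case by simp
qed simp

lemma sum_inverse_le_one_plus_ln:
  assumes "n \<ge> 1"
  shows "(\<Sum>t=1..n. 1 / real t) \<le> 1 + ln (real n)"
  using sum_inverse_le_ln[OF assms] assms by (simp add: sum.atLeast_Suc_atMost numeral_2_eq_2)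

lemma powr_Young:
  fixes a x :: real
  assumes "0 \<le> \<alpha>" "\<alpha> \<le> 1" "0 < a" "0 < x"
  shows "a powr \<alpha> * x powr (1 - \<alpha>) \<le> \<alpha> * a + (1 - \<alpha>) * x"
  using assms by (intro Youngs_inequality_0) auto

definition rate_log :: "real \<Rightarrow> nat \<Rightarrow> real" where
  "rate_log \<alpha> t = qlog \<alpha> (max (exp 1) (real t))"

lemma learning_rate_eq:
  assumes "t \<ge> 1"
  shows "learning_rate \<alpha> t = 16 powr \<alpha> / 4 * rate_log \<alpha> t / real t powr \<alpha>"
proof (cases "\<alpha> = 1")
  case True
  then show ?thesis
    using assms by (simp add: learning_rate_def rate_log_def qlog_def Let_def)
next
  case False
  have "- 1 + \<alpha> = \<alpha> - 1" by simp
  with False show ?thesis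
    unfolding learning_rate_def rate_log_def qlog_def Let_def
    by (simp add: divide_divide_eq_left)
qed

context
  fixes \<alpha> :: real
  assumes \<alpha>: "0 \<le> \<alpha>" "\<alpha> \<le> 1"
begin

text \<open>Clamping the argument at \<open>exp 1\<close> keeps the factor away from zero uniformly
  in \<alpha>: \<open>qlog_ge\<close> with \<open>exp 1 \<ge> 8/3\<close> gives
  \<open>1 - 3/8\<close>.\<close>

lemma rate_log_ge: "5/8 \<le> rate_log \<alpha> t"
proof -
  let ?x = "max (exp 1) (real t)"
  have e: "8/3 \<le> exp (1::real)"
  proof -
    have "(41/32) ^ 4 \<le> exp (1/4 :: real) ^ 4"
      using exp_lower_Taylor_quadratic[of "1/4"] by (intro power_mono) (auto simp: power2_eq_square)
    also have "\<dots> = exp 1"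
      by (simp flip: exp_of_nat_mult)
    finally show ?thesis by (simp add: power_divide)
  qed
  then have "1 / ?x \<le> 1 / (8/3)"
    by (intro divide_left_mono) auto
  moreover have "1 - 1 / ?x \<le> rate_log \<alpha> t"
    unfolding rate_log_def using \<alpha> by (intro qlog_ge) (auto simp: less_max_iff_disj)
  ultimately show ?thesis by simp
qed

lemma rate_log_pos: "0 < rate_log \<alpha> t"
  using rate_log_ge[of t] by simp

lemma inverse_rate_log_le: "1 / rate_log \<alpha> t \<le> 8/5"
proof -
  have "1 / rate_log \<alpha> t \<le> 1 / (5/8)"
    using rate_log_ge rate_log_pos by (intro divide_left_mono) auto
  then show ?thesis by simp
qed

lemma rate_log_mono: "s \<le> t \<Longrightarrow> rate_log \<alpha> s \<le> rate_log \<alpha> t"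
  unfolding rate_log_def by (intro qlog_mono max.mono) (auto simp: less_max_iff_disj)

lemma rate_log_le_ln: "rate_log \<alpha> t \<le> ln (max (exp 1) (real t))"
  unfolding rate_log_def using \<alpha> by (intro qlog_le_ln) (auto simp: less_max_iff_disj)

lemma learning_rate_pos: "t \<ge> 1 \<Longrightarrow> 0 < learning_rate \<alpha> t"
  using rate_log_pos[of t] by (simp add: learning_rate_eq)

lemma inverse_learning_rate:
  "t \<ge> 1 \<Longrightarrow> 1 / learning_rate \<alpha> t = 4 / 16 powr \<alpha> * (real t powr \<alpha> / rate_log \<alpha> t)"
  by (simp add: learning_rate_eq)

text \<open>In the penalty of a suboptimal arm \<open>f\<close> appears as
  \<open>(1 + \<alpha> * c) / c\<close>, with \<open>c\<close> the logarithmic factor of the rate.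
  The bound \<open>\<alpha> + 8/5\<close> controls the additive constants, the other one the share
  of the regret.\<close>

lemma rate_factor_le:
  fixes t :: nat
  defines "f \<equiv> \<alpha> + 1 / rate_log \<alpha> t"
  shows "0 \<le> f" "f \<le> \<alpha> + 8/5" "f \<le> 1 + 1 / ln (max (exp 1) (real t))"
proof -
  show "0 \<le> f"
    using \<alpha> rate_log_pos[of t] by (simp add: f_def)
  show "f \<le> \<alpha> + 8/5"
    using inverse_rate_log_le[of t] by (simp add: f_def)
  have "1 < max (exp 1) (real t)"
    by (simp add: less_max_iff_disj)
  then show "f \<le> 1 + 1 / ln (max (exp 1) (real t))"
    using inverse_qlog_le[of \<alpha> "max (exp 1) (real t)"] \<alpha> by (simp add: f_def rate_log_def)
qed

text \<open>Since \<open>rate_log\<close> is nondecreasing, using its value at \<open>t\<close> for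
  both terms only lowers what is subtracted. At \<open>t = 1\<close> the claim covers
  \<open>\<alpha> = 0\<close> as well because \<open>0 powr 0 = 0\<close>, so the increment of the
  power is \<open>1\<close> there.\<close>

lemma inv_rate_step_le:
  assumes "t \<ge> 1"
  shows "inv_rate_step (learning_rate \<alpha>) t
    \<le> 4 / 16 powr \<alpha> / rate_log \<alpha> t * (real t powr \<alpha> - real (t - 1) powr \<alpha>)"
proof (cases "t = 1")
  case True
  then show ?thesis
    by (simp add: inv_rate_step_def inverse_learning_rate)
next
  case False
  have "real (t - 1) powr \<alpha> / rate_log \<alpha> t \<le> real (t - 1) powr \<alpha> / rate_log \<alpha> (t - 1)"
    using rate_log_pos rate_log_mono[of "t - 1" t] by (intro divide_left_mono mult_pos_pos) auto
  then have "4 / 16 powr \<alpha> * (real (t - 1) powr \<alpha> / rate_log \<alpha> t)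
      \<le> 4 / 16 powr \<alpha> * (real (t - 1) powr \<alpha> / rate_log \<alpha> (t - 1))"
    by (intro mult_left_mono) auto
  moreover have "4 / 16 powr \<alpha> / rate_log \<alpha> t * (real t powr \<alpha> - real (t - 1) powr \<alpha>)
      = 4 / 16 powr \<alpha> * (real t powr \<alpha> / rate_log \<alpha> t)
      - 4 / 16 powr \<alpha> * (real (t - 1) powr \<alpha> / rate_log \<alpha> t)"
    by (simp add: right_diff_distrib)
  ultimately show ?thesis
    using False assms by (simp add: inv_rate_step_def inverse_learning_rate)
qed

lemma powr_increment_le:
  assumes "t \<ge> 2"
  shows "real t powr \<alpha> - real (t - 1) powr \<alpha> \<le> \<alpha> * real (t - 1) powr (\<alpha> - 1)"
proof -
  define s where "s = real (t - 1)"
  have s: "s > 0" "real t = s + 1"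
    using assms by (auto simp: s_def)
  have "(real t / s) powr \<alpha> \<le> 1 - \<alpha> + \<alpha> * (real t / s)"
    using \<alpha> s by (intro powr_le_affine) auto
  also have "\<dots> = 1 + \<alpha> / s"
    using s by (simp add: field_simps)
  finally have "(real t / s) powr \<alpha> * s powr \<alpha> \<le> (1 + \<alpha> / s) * s powr \<alpha>"
    by (intro mult_right_mono) auto
  also have "(real t / s) powr \<alpha> * s powr \<alpha> = real t powr \<alpha>"
    using s(1) by (simp flip: powr_mult)
  also have "(1 + \<alpha> / s) * s powr \<alpha> = s powr \<alpha> + \<alpha> * (s powr \<alpha> / s)"
    by (simp add: distrib_right)
  finally have "real t powr \<alpha> \<le> s powr \<alpha> + \<alpha> * (s powr \<alpha> / s)" .
  moreover have "s powr (\<alpha> - 1) = s powr \<alpha> / s"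
    using s by (simp add: powr_diff)
  ultimately show ?thesis
    unfolding s_def[symmetric] by simp
qed

text \<open>For small \<open>\<alpha>\<close> the learning rate increases at first, but only by summable amounts.\<close>

lemma learning_rate_ratio_le:
  assumes t: "t \<ge> 2"
  shows "learning_rate \<alpha> t / learning_rate \<alpha> (t - 1) - 1 \<le> 32/5 / (real (t - 1))\<^sup>2"
proof -
  define s where "s = real (t - 1)"
  have s: "s \<ge> 1" "real t = s + 1"
    using t by (auto simp: s_def)
  define c where "c = rate_log \<alpha> (t - 1)"
  have c: "0 < c" "1 / c \<le> 8/5"
    using rate_log_pos inverse_rate_log_le by (auto simp: c_def)
  have ratio: "learning_rate \<alpha> t / learning_rate \<alpha> (t - 1) = (s / real t) powr \<alpha> * (rate_log \<alpha> t / c)"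
  proof -
    have "learning_rate \<alpha> t = 16 powr \<alpha> / 4 * rate_log \<alpha> t / real t powr \<alpha>"
      "learning_rate \<alpha> (t - 1) = 16 powr \<alpha> / 4 * c / s powr \<alpha>"
      using t by (auto simp: learning_rate_eq c_def s_def)
    then show ?thesis
      using s c by (simp add: powr_divide)
  qed
  have le1: "(s / real t) powr \<alpha> \<le> 1"
    using s \<alpha> powr_mono2[of \<alpha> "s / real t" 1] by simp
  consider "t = 2" | "t = 3" | "t \<ge> 4" using t by linarith
  then show ?thesis
  proof cases
    case 1
    \<comment> \<open>Rounds \<open>1\<close> and \<open>2\<close> both lie below
      \<open>exp 1\<close>, so the logarithmic factor does not change.\<close>
    have "(1::real) \<le> exp 1" "(2::real) \<le> exp 1"
      using exp_ge_add_one_self[of "1::real"] by auto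
    then have "rate_log \<alpha> t = c"
      using 1 by (simp add: c_def rate_log_def max_def)
    then show ?thesis
      using ratio le1 c by simp (smt (verit) zero_le_power2 divide_nonneg_nonneg)
  next
    case 2
    \<comment> \<open>Only between rounds \<open>2\<close> and \<open>3\<close> is the clamp at
      \<open>exp 1\<close> left. Crude numerics give a ratio of at most \<open>12/5\<close>, and
      \<open>12/5 - 1\<close> is below \<open>32/5 / 2\<^sup>2\<close>.\<close>
    have "exp (1::real) \<le> 3" "(3::real) \<le> exp (3/2)"
      using exp_le exp_lower_Taylor_quadratic[of "3/2"] by (auto simp: power2_eq_square)
    moreover have "ln (3::real) \<le> ln (exp (3/2))"
      using \<open>3 \<le> exp (3/2)\<close> by (subst ln_le_cancel_iff) auto
    ultimately have "ln (max (exp 1) (real t)) \<le> 3/2"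
      using 2 by (simp add: max_absorb2)
    then have "rate_log \<alpha> t \<le> 3/2"
      using rate_log_le_ln[of t] by linarith
    then have "rate_log \<alpha> t / c \<le> (3/2) / c"
      using c by (intro divide_right_mono) auto
    also have "\<dots> \<le> 12/5"
      using c by simp
    finally have "(s / real t) powr \<alpha> * (rate_log \<alpha> t / c) \<le> 1 * (12/5)"
      using le1 c rate_log_pos[of t] by (intro mult_mono) auto
    moreover have "s = 2"
      using 2 by (simp add: s_def)
    ultimately show ?thesis
      unfolding ratio s_def[symmetric] by simp
  next
    case 3
    show ?thesis
    proof (cases "\<alpha> = 1")
      case True
      have "1 + 1 / s = real t / s"
        using s by (simp add: field_simps)
      then have "ln (real t) - ln s = ln (1 + 1 / s)"
        using s by (simp add: ln_div)
      also have "\<dots> \<le> 1 / s"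
        using s by (intro ln_add_one_self_le_self) auto
      finally have lnle: "ln (real t) \<le> ln s + 1 / s" by simp
      have "exp (1::real) \<le> s"
        using exp_le 3 by (simp add: s_def)
      then have ln1: "1 \<le> ln s"
        using s by (simp add: ln_ge_iff)
      have c_eq: "c = ln s" "rate_log \<alpha> t = ln (real t)"
        unfolding c_def rate_log_def qlog_def s_def[symmetric]
        using True \<open>exp 1 \<le> s\<close> s(2) by (simp_all add: max_absorb2)
      have "s * ln (real t) \<le> s * (ln s + 1 / s)"
        using s(1) lnle by (intro mult_left_mono) auto
      also have "\<dots> = s * ln s + 1"
        using s(1) by (simp add: distrib_left)
      also have "\<dots> \<le> real t * ln s"
        using s(2) ln1 by (simp add: distrib_right)
      finally have "s * ln (real t) / (real t * ln s) \<le> 1"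
      proof (subst pos_divide_le_eq)
        show "0 < real t * ln s"
          using s ln1 by (intro mult_pos_pos) linarith+
      qed simp
      then have "s / real t * (ln (real t) / ln s) \<le> 1"
        by simp
      then have "(s / real t) powr \<alpha> * (rate_log \<alpha> t / c) \<le> 1"
        using True s c_eq by simp
      then show ?thesis
        using ratio by (smt (verit) zero_le_power2 divide_nonneg_nonneg)
    next
      case False
      define b p where "b = 1 - \<alpha>" and "p = s powr (\<alpha> - 1)"
      have b: "0 < b" "b \<le> 1"
        using \<alpha> False by (auto simp: b_def)
      have exp_s: "exp (1::real) \<le> s"
        using exp_le 3 by (simp add: s_def)
      have c_eq: "c = (1 - p) / b" "rate_log \<alpha> t = (1 - real t powr (\<alpha> - 1)) / b"
        unfolding c_def rate_log_def qlog_def s_def[symmetric] b_def p_def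
        using False exp_s s(2) by (simp_all add: max_absorb2)
      have p1: "0 < 1 - p"
        using c c_eq b by (simp add: zero_less_divide_iff)
      \<comment> \<open>With both factors \<open>1 / b\<close> cleared, Bernoulli's inequality is
        applied to \<open>(s / real t) powr \<alpha>\<close> and to \<open>p\<close>. The two terms
        \<open>\<alpha> / real t\<close> cancel, and dividing the remainder by
        \<open>1 - p = b * c\<close> removes \<open>b\<close>.\<close>
      have "(s / real t) powr \<alpha> * (1 - real t powr (\<alpha> - 1)) - (1 - p)
          = ((s / real t) powr \<alpha> - 1) + p / real t"
      proof -
        have "(s / real t) powr \<alpha> * real t powr (\<alpha> - 1) = s powr \<alpha> / real t"
          using s by (simp add: powr_divide powr_diff)
        moreover have "p = s powr \<alpha> / s"
          using s by (simp add: p_def powr_diff)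
        moreover have "s powr \<alpha> / s - s powr \<alpha> / s / real t = s powr \<alpha> / real t"
        proof -
          have "s powr \<alpha> / s - s powr \<alpha> / s / real t = s powr \<alpha> / s * (1 - 1 / real t)"
            by (simp add: right_diff_distrib)
          also have "1 - 1 / real t = s / real t"
            using s by (simp add: field_simps)
          finally show ?thesis
            using s(1) by simp
        qed
        ultimately show ?thesis
          by (simp add: right_diff_distrib)
      qed
      also have "(s / real t) powr \<alpha> - 1 \<le> - \<alpha> + \<alpha> * (s / real t)"
        using powr_le_affine[of \<alpha> "s / real t"] \<alpha> s by simp
      also have "- \<alpha> + \<alpha> * (s / real t) = - \<alpha> / real t"
        using s by (simp add: field_simps)
      also have "- \<alpha> / real t + p / real t = (p - \<alpha>) / real t"
        by (simp add: diff_divide_distrib)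
      also have "\<dots> \<le> (b / s) / real t"
      proof (rule divide_right_mono)
        have "p = (1 / s) powr b"
          using s by (simp add: p_def b_def powr_divide powr_diff)
        also have "\<dots> \<le> 1 - b + b * (1 / s)"
          using b s by (intro powr_le_affine) auto
        finally show "p - \<alpha> \<le> b / s"
          by (simp add: b_def)
      qed (use s in simp)
      finally have "(s / real t) powr \<alpha> * (1 - real t powr (\<alpha> - 1)) - (1 - p) \<le> (b / s) / real t"
        by simp
      then have "((s / real t) powr \<alpha> * (1 - real t powr (\<alpha> - 1)) - (1 - p)) / (1 - p)
          \<le> (b / s) / real t / (1 - p)"
        using p1 by (intro divide_right_mono) auto
      moreover have "(s / real t) powr \<alpha> * (rate_log \<alpha> t / c) - 1
          = ((s / real t) powr \<alpha> * (1 - real t powr (\<alpha> - 1)) - (1 - p)) / (1 - p)"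
        unfolding c_eq diff_divide_distrib[of _ "1 - p" "1 - p"] using b p1 by simp
      moreover have "(b / s) / real t / (1 - p) = 1 / c * (1 / (s * real t))"
        unfolding c_eq using b p1 s by (simp add: field_simps)
      moreover have "1 / c * (1 / (s * real t)) \<le> 32/5 * (1 / (s * s))"
        using c s by (intro mult_mono divide_left_mono mult_left_mono) auto
      ultimately show ?thesis
        unfolding ratio s_def[symmetric] by (simp add: power2_eq_square)
    qed
  qed
qed

end

section \<open>Stability\<close>

lemma ln2_ge: "17/25 \<le> ln (2::real)"
  using ln_approx_bounds[of 2 2, simplified, simplified eval_nat_numeral, simplified] by simp

lemma exp_1_bounds: "2 < exp (1::real)" "exp (1::real) \<le> 2.7183"
proof -
  have "inverse (2 ^ 32 :: real) \<le> 1 / 1000000"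
    by simp
  with e_approx_32 have "2 < exp (1::real)" "exp (1::real) \<le> 27183 / 10000"
    by linarith+
  then show "2 < exp (1::real)" "exp (1::real) \<le> 2.7183"
    by simp_all
qed

section \<open>Gap-dependent constants and the burn-in threshold\<close>

locale asym_gaps =
  fixes \<alpha> :: real and \<Delta> :: "'k::finite \<Rightarrow> real" and istar :: 'k
  assumes \<alpha>: "0 \<le> \<alpha>" "\<alpha> \<le> 1"
    and two_arms: "CARD('k) \<ge> 2"
    and gap_istar: "\<Delta> istar = 0"
    and gap_pos: "\<And>i. i \<noteq> istar \<Longrightarrow> 0 < \<Delta> i"
    and gap_le_one: "\<And>i. \<Delta> i \<le> 1"
begin

definition "\<delta> = min_gap \<Delta> istar"
definition "\<xi> = asym_param \<alpha> \<Delta> istar"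
definition "\<eta> = learning_rate \<alpha>"
definition "X = 16 / \<delta>\<^sup>2"
definition "L = ln (X * (ln X)\<^sup>2)"
text \<open>Tuned so that \<open>sqrt (X / T1) = 1 / L\<^sup>2\<close> while
  \<open>ln T1 \<le> L\<^sup>2 / 2\<close>; from \<open>T1\<close> on,
  \<open>sqrt (X / t) * ln t\<close> is then at most \<open>1/2\<close>.\<close>

definition "T1 = X * L ^ 4"

text \<open>The effective size of the learning rate at the best arm, cf. \<open>rate_times_param_istar\<close>.\<close>
definition "\<theta> t = (X / real t) powr \<alpha> * rate_log \<alpha> t"

abbreviation "c \<equiv> rate_log \<alpha>"
abbreviation "others \<equiv> UNIV - {istar}"

lemmas c_pos = rate_log_pos[OF \<alpha>] and inverse_c_le = inverse_rate_log_le[OF \<alpha>]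

lemma card_others: "real (card others) = real CARD('k) - 1" "card others \<ge> 1"
  using two_arms by (simp_all add: card_Diff_singleton)

lemma others_nonempty: "others \<noteq> {}"
proof
  assume "others = {}"
  then have "card others = 0" by (simp only: card.empty)
  with card_others(2) show False by simp
qed

lemma min_gap_bounds: "0 < \<delta>" "\<delta> \<le> 1" "i \<noteq> istar \<Longrightarrow> \<delta> \<le> \<Delta> i"
proof -
  have "\<delta> \<in> \<Delta> ` others"
    unfolding \<delta>_def min_gap_def using others_nonempty by (intro Min_in) auto
  then obtain j where "j \<noteq> istar" "\<delta> = \<Delta> j"
    by blast
  then show "0 < \<delta>" "\<delta> \<le> 1"
    using gap_pos gap_le_one by auto
  show "\<delta> \<le> \<Delta> i" if "i \<noteq> istar"
    unfolding \<delta>_def min_gap_def using that by (intro Min_le) auto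
qed

lemma param_eq: "\<xi> istar = \<delta> powr (1 - 2 * \<alpha>)" "i \<noteq> istar \<Longrightarrow> \<xi> i = \<Delta> i powr (1 - 2 * \<alpha>)"
  by (auto simp: \<xi>_def asym_param_def \<delta>_def)

lemma param_pos: "0 < \<xi> i"
  using gap_pos[of i] min_gap_bounds by (cases "i = istar") (auto simp: param_eq)

lemma rate_pos: "t \<ge> 1 \<Longrightarrow> 0 < \<eta> t"
  unfolding \<eta>_def by (rule learning_rate_pos[OF \<alpha>])

lemma rate_eq: "t \<ge> 1 \<Longrightarrow> \<eta> t = 16 powr \<alpha> / 4 * c t / real t powr \<alpha>"
  unfolding \<eta>_def by (rule learning_rate_eq)

lemma rate_times_param:
  assumes "t \<ge> 1"
  shows "\<eta> t * \<delta> powr (- 2 * \<alpha>) = \<theta> t / 4"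
proof -
  have "\<delta> powr (- 2 * \<alpha>) = (1 / \<delta>\<^sup>2) powr \<alpha>"
  proof -
    have "\<delta> powr (2 * \<alpha>) = (\<delta>\<^sup>2) powr \<alpha>"
      using min_gap_bounds(1) powr_powr[of \<delta> 2 \<alpha>] by simp
    then show ?thesis
      by (simp add: powr_divide powr_minus_divide)
  qed
  then have *: "(X / real t) powr \<alpha> = 16 powr \<alpha> / real t powr \<alpha> * \<delta> powr (- 2 * \<alpha>)"
    using min_gap_bounds(1) by (simp add: X_def powr_divide powr_mult)
  show ?thesis
    using assms unfolding \<theta>_def * by (simp add: rate_eq mult_ac)
qed

lemma rate_times_param_istar:
  assumes "t \<ge> 1"
  shows "\<eta> t * \<xi> istar = \<theta> t / 4 * \<delta>"
proof -
  have "\<delta> powr (1 - 2 * \<alpha>) = \<delta> powr (- 2 * \<alpha>) * \<delta>"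
    using min_gap_bounds(1) powr_add[of \<delta> "- 2 * \<alpha>" 1] by simp
  then show ?thesis
    using rate_times_param[OF assms] by (simp add: param_eq)
qed

lemma rate_times_param_le:
  assumes "t \<ge> 1" "i \<noteq> istar"
  shows "\<eta> t * \<xi> i \<le> \<theta> t / 4 * \<Delta> i"
proof -
  have "\<xi> i = \<Delta> i powr (- 2 * \<alpha>) * \<Delta> i"
    using gap_pos[OF assms(2)] powr_add[of "\<Delta> i" "- 2 * \<alpha>" 1] assms(2) by (simp add: param_eq)
  also have "\<dots> \<le> \<delta> powr (- 2 * \<alpha>) * \<Delta> i"
    using \<alpha> min_gap_bounds(1) min_gap_bounds(3)[OF assms(2)] gap_pos[OF assms(2)]
    by (intro mult_right_mono powr_mono2') auto
  finally have "\<eta> t * \<xi> i \<le> \<eta> t * (\<delta> powr (- 2 * \<alpha>) * \<Delta> i)"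
    using rate_pos[OF assms(1)] by (intro mult_left_mono) auto
  then show ?thesis
    by (simp only: rate_times_param[OF assms(1)] mult.assoc[symmetric])
qed

lemma theta_nonneg: "0 \<le> \<theta> t"
  using c_pos[of t] by (simp add: \<theta>_def)

text \<open>In terms of \<open>z\<close> the left-hand side is
  \<open>c t / (8 * t * \<Delta> i)\<close> times
  \<open>16 powr \<alpha> * z powr (1 - \<alpha>)\<close>, to which weighted AM-GM applies. The
  logarithm survives only in the constant term, since \<open>(1 - \<alpha>) * c t \<le> 1\<close>
  removes it from the regret share.\<close>

lemma arm_stability_le:
  assumes t: "t \<ge> 1" and i: "i \<noteq> istar" and w: "0 < w"
  shows "1/2 * (\<eta> t * \<xi> i) * w powr (1 - \<alpha>) \<le> 2 * \<alpha> * c t / (real t * \<Delta> i) + 1/8 * (\<Delta> i * w)"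
proof -
  let ?D = "\<Delta> i"
  define z where "z = real t * ?D\<^sup>2 * w"
  have D: "0 < ?D" and tpos: "0 < real t"
    using gap_pos[OF i] t by auto
  have z: "0 < z"
    using D tpos w by (simp add: z_def)
  have zp: "z powr (1 - \<alpha>) = real t * (1 / real t powr \<alpha>) * (?D * ?D powr (1 - 2 * \<alpha>)) * w powr (1 - \<alpha>)"
  proof -
    have "z powr (1 - \<alpha>) = real t powr (1 - \<alpha>) * (?D\<^sup>2) powr (1 - \<alpha>) * w powr (1 - \<alpha>)"
      using D tpos w by (simp add: z_def powr_mult)
    moreover have "(?D\<^sup>2) powr (1 - \<alpha>) = ?D powr (2 * (1 - \<alpha>))"
      using D powr_powr[of ?D 2 "1 - \<alpha>"] by simp
    moreover have "?D powr (2 * (1 - \<alpha>)) = ?D * ?D powr (1 - 2 * \<alpha>)"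
      using D powr_add[of ?D 1 "1 - 2 * \<alpha>"] by (simp add: algebra_simps)
    moreover have "real t powr (1 - \<alpha>) = real t * (1 / real t powr \<alpha>)"
      using tpos by (simp add: powr_diff)
    ultimately show ?thesis by simp
  qed
  have "1/2 * (\<eta> t * \<xi> i) * w powr (1 - \<alpha>)
      = c t / (8 * real t * ?D) * (16 powr \<alpha> * z powr (1 - \<alpha>))"
    unfolding zp rate_eq[OF t] param_eq(2)[OF i] using D tpos by simp
  also have "\<dots> \<le> c t / (8 * real t * ?D) * (\<alpha> * 16 + (1 - \<alpha>) * z)"
    using \<alpha> z c_pos[of t] D tpos by (intro mult_left_mono powr_Young) auto
  also have "\<dots> = 2 * \<alpha> * c t / (real t * ?D) + ((1 - \<alpha>) * c t) / 8 * (?D * w)"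
    using D tpos by (simp add: z_def field_simps power2_eq_square)
  also have "\<dots> \<le> 2 * \<alpha> * c t / (real t * ?D) + 1 / 8 * (?D * w)"
    using one_minus_times_qlog_le[of "max (exp 1) (real t)" \<alpha>] \<alpha> D w
    by (intro add_left_mono mult_right_mono divide_right_mono) (auto simp: rate_log_def less_max_iff_disj)
  finally show ?thesis .
qed

text \<open>The bound \<open>exp 1 \<le> ln X\<close> makes \<open>ln (ln X)\<close> at least
  \<open>1\<close>, on which \<open>4 \<le> L\<close> rests.\<close>

lemma ln_X_bounds: "16 \<le> X" "exp 1 \<le> ln X"
proof -
  have "\<delta>\<^sup>2 \<le> 1"
    using min_gap_bounds by (simp add: power_le_one)
  then show X: "16 \<le> X"
    using min_gap_bounds(1) by (simp add: X_def le_divide_eq)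
  note exp_1_bounds(2)
  also have "(2.7183::real) \<le> 4 * ln 2"
    using ln2_ge by simp
  also have "\<dots> = ln 16"
    using ln_realpow[of 2 4] by simp
  also have "\<dots> \<le> ln X"
    using X by simp
  finally show "exp 1 \<le> ln X" .
qed

lemma L_eq: "L = ln X + 2 * ln (ln X)"
proof -
  have "0 < ln X"
    using ln_X_bounds(2) exp_gt_zero[of 1] by linarith
  then show ?thesis
    using ln_X_bounds(1) by (simp add: L_def ln_mult ln_realpow)
qed

lemma L_bounds: "ln X \<le> L - 2" "4 \<le> L"
proof -
  have "1 \<le> ln (ln X)"
    using ln_X_bounds(2) exp_1_bounds by (subst ln_ge_iff) linarith+
  then show "ln X \<le> L - 2" "4 \<le> L"
    using ln_X_bounds(2) exp_1_bounds(1) by (auto simp: L_eq)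
qed

lemma T1_pos: "0 < T1"
  using ln_X_bounds(1) L_bounds(2) by (simp add: T1_def)

lemma ln_T1_bounds: "2 \<le> ln T1" "ln T1 \<le> L\<^sup>2 / 2"
proof -
  have eq: "ln T1 = ln X + 4 * ln L"
    using ln_X_bounds(1) L_bounds(2) by (simp add: T1_def ln_mult ln_realpow)
  have "0 \<le> ln L"
    using L_bounds(2) by simp
  then show "2 \<le> ln T1"
    using ln_X_bounds(2) exp_1_bounds(1) by (simp add: eq)
  have "ln (L / 4) \<le> L / 4 - 1"
    using L_bounds(2) by (intro ln_le_minus_one) auto
  moreover have "ln (4::real) \<le> 7/5"
    using ln_realpow[of 2 2] ln2_le_25_over_36 by simp
  ultimately have "ln L \<le> L / 4 + 2/5"
    using L_bounds(2) by (simp add: ln_div)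
  then have "ln T1 \<le> 2 * L"
    using L_bounds(1) by (simp add: eq)
  also have "\<dots> \<le> L\<^sup>2 / 2"
    using L_bounds(2) mult_right_mono[of 4 L L] by (simp add: power2_eq_square)
  finally show "ln T1 \<le> L\<^sup>2 / 2" .
qed

text \<open>Two mechanisms keep \<open>\<theta> t\<close> small. For \<alpha> up to
  \<open>1/2\<close> the power of \<open>t\<close> may decay arbitrarily slowly, but
  \<open>c t \<le> 1 / (1 - \<alpha>)\<close>, and it suffices that \<open>X / t\<close> is below a
  fixed constant. For larger \<alpha> the power is at most \<open>sqrt (X / t)\<close> and beats the
  logarithm \<open>c t \<le> ln t\<close>.\<close>

lemma after_burn_in:
  assumes t: "T1 \<le> real t"
  shows "2 \<le> ln (real t)"
    and "\<alpha> \<le> 1/2 \<Longrightarrow> 4 powr \<alpha> * \<theta> t \<le> 1 - \<alpha>"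
    and "1/2 \<le> \<alpha> \<Longrightarrow> \<theta> t \<le> 1/2"
proof -
  have tpos: "0 < real t"
    using T1_pos t by linarith
  have X: "0 < X"
    using ln_X_bounds(1) by linarith
  show ln2: "2 \<le> ln (real t)"
    using ln_T1_bounds(1) T1_pos t ln_le_cancel_iff[of T1 "real t"] tpos by linarith
  have "exp 1 \<le> real t"
  proof -
    have "exp 2 \<le> real t"
      using ln2 tpos by (simp add: ln_ge_iff)
    then show ?thesis
      using exp_le_cancel_iff[of 1 "2::real"] by linarith
  qed
  then have max_t: "max (exp 1) (real t) = real t"
    by simp
  have L4: "256 \<le> L ^ 4"
    using power_mono[OF L_bounds(2), of 4] by simp
  have "X * 256 \<le> X * L ^ 4"
    using L4 X by (intro mult_left_mono) auto
  with t have "X \<le> 1 / 256 * real t"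
    by (simp add: T1_def)
  then have "X / real t \<le> 1 / 256"
    using tpos by (subst pos_divide_le_eq)
  then have Xt: "4 * (X / real t) \<le> 1 / 64"
    by linarith
  show "4 powr \<alpha> * \<theta> t \<le> 1 - \<alpha>" if half: "\<alpha> \<le> 1/2"
  proof -
    \<comment> \<open>As \<open>64 = 8 * 8\<close>, the power supplies two factors
      \<open>1 / 8 powr \<alpha> \<le> 1 - \<alpha>\<close>: one is spent on \<open>c t\<close>, the
      other is the bound claimed.\<close>
    have "1 + \<alpha> * 2 \<le> 1 + \<alpha> * ln 8"
    proof -
      have "2 \<le> ln (8::real)"
        using ln_realpow[of 2 3] ln2_ge by simp
      then show ?thesis
        using \<alpha> by (intro add_left_mono mult_left_mono) auto
    qed
    also have "\<dots> \<le> 8 powr \<alpha>"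
      by (intro powr_ge_one_plus_ln) auto
    finally have "1 / 8 powr \<alpha> \<le> 1 / (1 + \<alpha> * 2)"
      using \<alpha> by (intro divide_left_mono mult_pos_pos) (auto intro: add_pos_nonneg)
    also have "\<dots> \<le> 1 - \<alpha>"
    proof -
      have "0 \<le> \<alpha> * (1 - 2 * \<alpha>)"
        using \<alpha> half by (intro mult_nonneg_nonneg) auto
      then show ?thesis
        using \<alpha> by (subst pos_divide_le_eq) (auto simp: algebra_simps intro: add_pos_nonneg)
    qed
    finally have eight: "1 / 8 powr \<alpha> \<le> 1 - \<alpha>" .
    have "4 powr \<alpha> * (X / real t) powr \<alpha> = (4 * (X / real t)) powr \<alpha>"
      by (rule powr_mult[symmetric])
    also have "\<dots> \<le> (1 / 64) powr \<alpha>"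
      using \<alpha> Xt X tpos by (intro powr_mono2) auto
    also have "\<dots> = (1 / 8 powr \<alpha>) * (1 / 8 powr \<alpha>)"
      by (simp add: powr_divide flip: powr_mult)
    also have "\<dots> \<le> (1 - \<alpha>) * (1 - \<alpha>)"
      using eight \<alpha> by (intro mult_mono) auto
    finally have "4 powr \<alpha> * (X / real t) powr \<alpha> * c t \<le> (1 - \<alpha>) * (1 - \<alpha>) * c t"
      using c_pos[of t] by (intro mult_right_mono) auto
    also have "\<dots> = (1 - \<alpha>) * ((1 - \<alpha>) * c t)" by simp
    also have "\<dots> \<le> (1 - \<alpha>) * 1"
      using \<alpha> one_minus_times_qlog_le[of "max (exp 1) (real t)" \<alpha>]
      by (intro mult_left_mono) (auto simp: rate_log_def less_max_iff_disj)
    finally show ?thesis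
      by (simp add: \<theta>_def mult.assoc)
  qed
  show "\<theta> t \<le> 1/2" if half: "1/2 \<le> \<alpha>"
  proof -
    \<comment> \<open>Beyond \<open>T1\<close> the logarithm grows no faster than the square root:
      \<open>ln r \<le> r - 1\<close> and \<open>2 \<le> ln T1\<close> give
      \<open>ln t \<le> ln T1 * r\<close>.\<close>
    define r where "r = sqrt (real t / T1)"
    have r: "1 \<le> r"
      using t T1_pos by (simp add: r_def)
    have "ln (real t) = ln T1 + 2 * ln r"
      using T1_pos tpos by (simp add: r_def ln_sqrt ln_div diff_divide_distrib)
    also have "\<dots> \<le> ln T1 + 2 * (r - 1)"
      using r by (intro add_left_mono mult_left_mono ln_le_minus_one) auto
    also have "\<dots> \<le> ln T1 + ln T1 * (r - 1)"
      using r ln_T1_bounds(1) by (intro add_left_mono mult_right_mono) auto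
    finally have ln_le: "ln (real t) \<le> ln T1 * r"
      by (simp add: algebra_simps)
    have "(X / real t) powr \<alpha> \<le> (X / real t) powr (1/2)"
      using half X tpos \<open>X / real t \<le> 1 / 256\<close> by (intro powr_mono') auto
    also have "\<dots> = sqrt (X / real t)"
      using X tpos by (simp add: powr_half_sqrt)
    finally have le_sqrt: "(X / real t) powr \<alpha> \<le> sqrt (X / real t)" .
    have "X / real t = (1 / L\<^sup>2)\<^sup>2 / (real t / T1)"
      using X L_bounds(2) by (simp add: T1_def power_divide flip: power_mult)
    then have "sqrt (X / real t) = sqrt ((1 / L\<^sup>2)\<^sup>2 / (real t / T1))"
      by (rule arg_cong)
    also have "\<dots> = 1 / L\<^sup>2 / r"
      unfolding r_def real_sqrt_divide[of "(1 / L\<^sup>2)\<^sup>2"] by (subst real_sqrt_abs) simp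
    finally have "(X / real t) powr \<alpha> \<le> 1 / L\<^sup>2 / r"
      using le_sqrt by simp
    then have "\<theta> t \<le> (1 / L\<^sup>2 / r) * (ln T1 * r)"
      unfolding \<theta>_def using rate_log_le_ln[OF \<alpha>, of t] ln_le max_t c_pos[of t] r
      by (intro mult_mono) auto
    also have "\<dots> = ln T1 / L\<^sup>2"
      using r by simp
    also have "\<dots> \<le> 1/2"
      using ln_T1_bounds(2) L_bounds(2) by (simp add: divide_le_eq)
    finally show ?thesis .
  qed
qed

section \<open>Stability of the best arm against the regret of the round\<close>

lemma gap_sum_ge:
  assumes "w \<in> prob_simplex"
  shows "\<delta> * (1 - w istar) \<le> (\<Sum>i\<in>others. \<Delta> i * w i)"
proof -
  have "1 - w istar = sum w others"
    using assms by (simp add: prob_simplex_def sum.remove[of UNIV istar])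
  then have "\<delta> * (1 - w istar) = (\<Sum>i\<in>others. \<delta> * w i)"
    by (simp add: sum_distrib_left)
  also have "\<dots> \<le> (\<Sum>i\<in>others. \<Delta> i * w i)"
    using assms min_gap_bounds(3) by (intro sum_mono mult_right_mono) (auto simp: prob_simplex_def)
  finally show ?thesis .
qed

text \<open>The least ratios that the bounds on \<open>\<theta> t\<close> allow in
  \<open>kappa_small\<close>: with \<open>\<theta> t\<close> at most \<open>1\<close> or
  \<open>1/2\<close>, \<open>8/3 * (\<theta> t / 4)\<close> is at most \<open>2/3 = 1 - 1/3\<close>
  or \<open>1/3 = 1 - 2/3\<close>.\<close>

definition "\<kappa> = (if \<alpha> \<le> 1/2 then 3 else 3/2 :: real)"

text \<open>Bounds the stability term of round \<open>t\<close> when arm \<open>j\<close> is played with weights \<open>w\<close>.\<close>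
definition stab_bound :: "nat \<Rightarrow> 'k \<Rightarrow> ('k \<Rightarrow> real) \<Rightarrow> real" where
  "stab_bound t j w =
     (if j = istar \<and> 3/4 \<le> w istar \<and> T1 \<le> real t
      then (\<Sum>i\<in>others. \<kappa>\<^sup>2 / 2 * (\<eta> t * \<xi> i) * w i powr (2 - \<alpha>)) / (w istar)\<^sup>2
      else 1/2 * (\<eta> t * \<xi> j) * w j powr (- \<alpha>))"

lemma kappa_small:
  assumes "t \<ge> 1" "T1 \<le> real t" "i \<noteq> istar"
  shows "8/3 * (\<eta> t * \<xi> i) \<le> 1 - 1 / \<kappa>"
proof -
  have "\<theta> t \<le> 1" if "\<alpha> \<le> 1/2"
  proof -
    have "1 * \<theta> t \<le> 4 powr \<alpha> * \<theta> t"
      using \<alpha> theta_nonneg by (intro mult_right_mono ge_one_powr_ge_zero) auto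
    with after_burn_in(2)[OF assms(2) that] \<alpha> show ?thesis by linarith
  qed
  with after_burn_in(3)[OF assms(2)] have th: "\<theta> t \<le> (if \<alpha> \<le> 1/2 then 1 else 1/2)"
    by auto
  have "\<eta> t * \<xi> i \<le> \<theta> t / 4 * \<Delta> i"
    using assms by (intro rate_times_param_le) auto
  also have "\<dots> \<le> \<theta> t / 4 * 1"
    using theta_nonneg gap_le_one by (intro mult_left_mono) auto
  finally show ?thesis
    using th by (auto simp: \<kappa>_def split: if_splits)
qed

lemma stability_le_stab_bound:
  assumes t: "t \<ge> 1" and w: "w \<in> prob_simplex" "\<And>i. 0 < w i" and v: "v \<in> prob_simplex" "\<And>i. 0 < v i"
    and a: "0 \<le> a" "a \<le> 1"
  shows "stability \<alpha> (\<lambda>i. \<eta> t * \<xi> i) (\<lambda>i. of_bool (j = i) * a / w i) w v \<le> stab_bound t j w"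
proof -
  have e: "0 < \<eta> t * \<xi> i" for i
    using rate_pos[OF t] param_pos by simp
  show ?thesis
  proof (cases "j = istar \<and> 3/4 \<le> w istar \<and> T1 \<le> real t")
    case True
    then have "stab_bound t j w
        = (\<Sum>i\<in>UNIV - {j}. \<kappa>\<^sup>2 / 2 * (\<eta> t * \<xi> i) * w i powr (2 - \<alpha>)) / (w j)\<^sup>2"
      by (simp add: stab_bound_def)
    moreover have "1 \<le> \<kappa>"
      by (simp add: \<kappa>_def)
    ultimately show ?thesis
      using True \<alpha> e w v a kappa_small[OF t] by (simp only:) (intro stability_heavy_le, auto)
  next
    case False
    then have "stab_bound t j w = 1/2 * (\<eta> t * \<xi> j) * w j powr (- \<alpha>)"
      by (simp only: stab_bound_def if_False)
    then show ?thesis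
      using \<alpha> e w v a by (simp only:) (intro stability_le, auto)
  qed
qed

lemma weighted_basic_bound:
  assumes "0 < x"
  shows "x * (1/2 * (\<eta> t * \<xi> j) * x powr (- \<alpha>)) = 1/2 * (\<eta> t * \<xi> j) * x powr (1 - \<alpha>)"
  using assms powr_add[of x 1 "- \<alpha>"] by simp

text \<open>If the best arm has weight below \<open>3/4\<close>, the regret of the round is at least
  \<open>\<delta> / 4\<close> and dominates \<open>\<theta> t * \<delta> / 8\<close>. Otherwise the
  bound sits on the other arms, and their weights are at most \<open>1/4\<close>. The share
  \<open>1/2 - \<alpha> / 4\<close> shrinks with \<alpha> to make room for the penalty, whose share
  grows.\<close>

lemma weighted_stab_bound_istar_le:
  assumes t: "t \<ge> 1" "T1 \<le> real t" and w: "w \<in> prob_simplex" "\<And>i. 0 < w i"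
  shows "w istar * stab_bound t istar w \<le> (1/2 - \<alpha> / 4) * (\<Sum>i\<in>others. \<Delta> i * w i)"
proof -
  let ?S = "\<Sum>i\<in>others. \<Delta> i * w i"
  have S0: "0 \<le> ?S"
    using w(2) gap_pos by (intro sum_nonneg mult_nonneg_nonneg) (auto intro: less_imp_le)
  have four: "1 \<le> 4 powr \<alpha>"
    using \<alpha> by (intro ge_one_powr_ge_zero) auto
  have th: "\<theta> t / 2 \<le> 1/2 - \<alpha> / 4"
  proof (cases "\<alpha> \<le> 1/2")
    case True
    have "1 * \<theta> t \<le> 4 powr \<alpha> * \<theta> t"
      using four theta_nonneg by (intro mult_right_mono) auto
    with after_burn_in(2)[OF t(2) True] \<alpha> show ?thesis by linarith
  next
    case False
    with after_burn_in(3)[OF t(2)] \<alpha> show ?thesis by linarith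
  qed
  show ?thesis
  proof (cases "3/4 \<le> w istar")
    case False
    have "w istar * stab_bound t istar w = 1/2 * (\<eta> t * \<xi> istar) * w istar powr (1 - \<alpha>)"
      unfolding weighted_basic_bound[OF w(2), symmetric] using False by (simp add: stab_bound_def)
    also have "\<dots> \<le> 1/2 * (\<eta> t * \<xi> istar) * 1"
      using rate_pos[OF t(1)] param_pos w(2)[of istar] \<alpha> prob_simplex_le_one[OF w(1), of istar]
      by (intro mult_left_mono powr_le1) (auto intro: less_imp_le)
    also have "\<dots> = \<theta> t / 2 * (\<delta> * (1/4))"
      by (simp add: rate_times_param_istar[OF t(1)])
    also have "\<dots> \<le> \<theta> t / 2 * (\<delta> * (1 - w istar))"
      using False theta_nonneg min_gap_bounds(1) by (intro mult_left_mono) auto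
    also have "\<dots> \<le> \<theta> t / 2 * ?S"
      using gap_sum_ge[OF w(1)] theta_nonneg by (intro mult_left_mono) auto
    also have "\<dots> \<le> (1/2 - \<alpha> / 4) * ?S"
      using th S0 by (intro mult_right_mono) auto
    finally show ?thesis .
  next
    case True
    let ?N = "\<Sum>i\<in>others. \<kappa>\<^sup>2 / 2 * (\<eta> t * \<xi> i) * w i powr (2 - \<alpha>)"
    have N0: "0 \<le> ?N"
      using rate_pos[OF t(1)] param_pos by (intro sum_nonneg mult_nonneg_nonneg) (auto intro: less_imp_le)
    have "w istar * stab_bound t istar w = ?N / w istar"
      using True t(2) w(2)[of istar] by (simp add: stab_bound_def power2_eq_square)
    also have "\<dots> \<le> ?N / (3/4)"
      using N0 True by (intro divide_left_mono) auto
    also have "\<dots> = (\<Sum>i\<in>others. 4/3 * (\<kappa>\<^sup>2 / 2 * (\<eta> t * \<xi> i) * w i powr (2 - \<alpha>)))"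
      unfolding sum_distrib_left[symmetric] by simp
    also have "\<dots> \<le> (\<Sum>i\<in>others. (1/2 - \<alpha> / 4) * (\<Delta> i * w i))"
    proof (rule sum_mono)
      fix i assume i: "i \<in> others"
      have "w i + w istar \<le> sum w UNIV"
        using i w(2) sum_mono2[of UNIV "{i, istar}" w] by (auto intro: less_imp_le)
      then have wi: "w i \<le> 1/4"
        using True w(1) by (simp add: prob_simplex_def)
      have key: "2/3 * \<kappa>\<^sup>2 * (\<theta> t / 4) * w i powr (1 - \<alpha>) \<le> 1/2 - \<alpha> / 4"
      proof (cases "\<alpha> \<le> 1/2")
        case True
        have "w i powr (1 - \<alpha>) \<le> (1/4) powr (1 - \<alpha>)"
          using wi w(2)[of i] \<alpha> by (intro powr_mono2) auto
        \<comment> \<open>This is why \<open>after_burn_in\<close> bounds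
          \<open>4 powr \<alpha> * \<theta> t\<close> and not only
          \<open>\<theta> t\<close>.\<close>
        also have "\<dots> = 4 powr \<alpha> / 4"
          by (simp add: powr_diff powr_divide)
        finally have "3/2 * \<theta> t * w i powr (1 - \<alpha>) \<le> 3/2 * \<theta> t * (4 powr \<alpha> / 4)"
          using theta_nonneg by (intro mult_left_mono) auto
        also have "\<dots> = 3/8 * (4 powr \<alpha> * \<theta> t)" by simp
        also have "\<dots> \<le> 3/8 * (1 - \<alpha>)"
          using after_burn_in(2)[OF t(2) True] by (intro mult_left_mono) auto
        finally show ?thesis
          using True \<alpha> by (simp add: \<kappa>_def power2_eq_square)
      next
        case False
        have "w i powr (1 - \<alpha>) \<le> 1"
          using wi w(2)[of i] \<alpha> by (intro powr_le1) auto
        then have "3/8 * \<theta> t * w i powr (1 - \<alpha>) \<le> 3/8 * \<theta> t * 1"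
          using theta_nonneg by (intro mult_left_mono) auto
        also have "\<dots> \<le> 3/16"
          using after_burn_in(3)[OF t(2)] False by simp
        finally show ?thesis
          using False \<alpha> by (simp add: \<kappa>_def power2_eq_square)
      qed
      have "4/3 * (\<kappa>\<^sup>2 / 2 * (\<eta> t * \<xi> i) * w i powr (2 - \<alpha>))
          = 2/3 * \<kappa>\<^sup>2 * w i powr (1 - \<alpha>) * w i * (\<eta> t * \<xi> i)"
        using w(2)[of i] powr_add[of "w i" "1 - \<alpha>" 1] by simp
      also have "\<dots> \<le> 2/3 * \<kappa>\<^sup>2 * w i powr (1 - \<alpha>) * w i * (\<theta> t / 4 * \<Delta> i)"
        using i w(2)[of i] t(1) by (intro mult_left_mono rate_times_param_le) auto
      also have "\<dots> = 2/3 * \<kappa>\<^sup>2 * (\<theta> t / 4) * w i powr (1 - \<alpha>) * (\<Delta> i * w i)" by simp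
      also have "\<dots> \<le> (1/2 - \<alpha> / 4) * (\<Delta> i * w i)"
        using key i w(2)[of i] gap_pos[of i] by (intro mult_right_mono) auto
      finally show "4/3 * (\<kappa>\<^sup>2 / 2 * (\<eta> t * \<xi> i) * w i powr (2 - \<alpha>)) \<le> (1/2 - \<alpha> / 4) * (\<Delta> i * w i)" .
    qed
    finally show ?thesis
      by (simp add: sum_distrib_left)
  qed
qed

text \<open>The left-hand side is the mean over the played arm given the past; the weight
  \<open>w j\<close> cancels one power of the importance weighting. Before \<open>T1\<close> the
  best arm is charged a deterministic amount, afterwards a share of the regret.\<close>

lemma weighted_stab_bound_le:
  assumes t: "t \<ge> 1" and w: "w \<in> prob_simplex" "\<And>i. 0 < w i"
  shows "(\<Sum>j\<in>UNIV. w j * stab_bound t j w)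
    \<le> (\<Sum>i\<in>others. 2 * \<alpha> * c t / (real t * \<Delta> i)) + (if real t < T1 then \<theta> t * \<delta> / 8 else 0)
      + (1/8 + (if real t < T1 then 0 else 1/2 - \<alpha> / 4)) * (\<Sum>i\<in>others. \<Delta> i * w i)"
proof -
  have "(\<Sum>j\<in>others. w j * stab_bound t j w)
      \<le> (\<Sum>i\<in>others. 2 * \<alpha> * c t / (real t * \<Delta> i) + 1/8 * (\<Delta> i * w i))"
  proof (rule sum_mono)
    fix i assume i: "i \<in> others"
    then have "w i * stab_bound t i w = 1/2 * (\<eta> t * \<xi> i) * w i powr (1 - \<alpha>)"
      unfolding weighted_basic_bound[OF w(2), symmetric] by (simp add: stab_bound_def)
    also have "\<dots> \<le> 2 * \<alpha> * c t / (real t * \<Delta> i) + 1/8 * (\<Delta> i * w i)"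
      using i t w(2) by (intro arm_stability_le) auto
    finally show "w i * stab_bound t i w \<le> 2 * \<alpha> * c t / (real t * \<Delta> i) + 1/8 * (\<Delta> i * w i)" .
  qed
  also have "\<dots> = (\<Sum>i\<in>others. 2 * \<alpha> * c t / (real t * \<Delta> i)) + 1/8 * (\<Sum>i\<in>others. \<Delta> i * w i)"
    by (simp add: sum.distrib sum_distrib_left)
  finally have 1: "(\<Sum>j\<in>others. w j * stab_bound t j w) \<le> \<dots>" .
  have 2: "w istar * stab_bound t istar w \<le> \<theta> t * \<delta> / 8" if "real t < T1"
  proof -
    have "w istar * stab_bound t istar w = 1/2 * (\<eta> t * \<xi> istar) * w istar powr (1 - \<alpha>)"
      unfolding weighted_basic_bound[OF w(2), symmetric] using that by (simp add: stab_bound_def)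
    also have "\<dots> \<le> 1/2 * (\<eta> t * \<xi> istar) * 1"
      using rate_pos[OF t] param_pos w(2)[of istar] \<alpha> prob_simplex_le_one[OF w(1), of istar]
      by (intro mult_left_mono powr_le1) (auto intro: less_imp_le)
    finally show ?thesis
      by (simp add: rate_times_param_istar[OF t])
  qed
  have "(\<Sum>j\<in>UNIV. w j * stab_bound t j w)
      = w istar * stab_bound t istar w + (\<Sum>j\<in>others. w j * stab_bound t j w)"
    by (simp add: sum.remove[of UNIV istar])
  with 1 2 weighted_stab_bound_istar_le[OF t _ w] show ?thesis
    by (auto simp: distrib_right)
qed

section \<open>Penalty and burn-in\<close>

definition "Kr = real (card others)"

lemma Kr_ge: "1 \<le> Kr"
  using card_others(2) by (simp add: Kr_def)

lemma Kr_le_sum_inverse: "Kr \<le> (\<Sum>i\<in>others. 1 / \<Delta> i)"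
proof -
  have "Kr = (\<Sum>i\<in>others. 1)"
    by (simp add: Kr_def)
  also have "\<dots> \<le> (\<Sum>i\<in>others. 1 / \<Delta> i)"
    using gap_pos gap_le_one by (intro sum_mono) (auto simp: le_divide_eq)
  finally show ?thesis .
qed

text \<open>The comparator stays inside the simplex, where the regulariser is finite for \<open>\<alpha> = 0\<close> too.\<close>

definition comparator :: "nat \<Rightarrow> 'k \<Rightarrow> real" where
  "comparator T i = (if i = istar then 1 - Kr / real T else 1 / real T)"

lemma comparator_props:
  assumes "2 * Kr \<le> real T"
  shows "comparator T \<in> prob_simplex" "0 < comparator T i" "1/2 \<le> comparator T istar"
proof -
  have T: "0 < real T"
    using assms Kr_ge by linarith
  show half: "1/2 \<le> comparator T istar"
    using assms T by (simp add: comparator_def field_simps)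
  show pos: "0 < comparator T i" for i
    using half T by (cases "i = istar") (auto simp: comparator_def)
  have "(\<Sum>i\<in>UNIV. comparator T i) = comparator T istar + (\<Sum>i\<in>others. comparator T i)"
    by (simp add: sum.remove[of UNIV istar])
  also have "(\<Sum>i\<in>others. comparator T i) = Kr / real T"
    by (simp add: comparator_def Kr_def)
  also have "comparator T istar + Kr / real T = 1"
    by (simp add: comparator_def)
  finally show "comparator T \<in> prob_simplex"
    using pos by (auto simp: prob_simplex_def intro: less_imp_le)
qed

definition penalty :: "nat \<Rightarrow> nat \<Rightarrow> ('k \<Rightarrow> real) \<Rightarrow> real" where
  "penalty T t w = inv_rate_step \<eta> t * (\<Sum>i\<in>UNIV. (tent \<alpha> (w i) - tent \<alpha> (comparator T i)) / \<xi> i)"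

text \<open>The comparator weight of the best arm misses \<open>1\<close> by
  \<open>Kr / real T\<close>, so its entropy is of squared order. The constant is
  \<open>4 * (8/5)\<close> from the inverse rate times the \<open>2\<close> of
  \<open>tent_ge_square\<close>.\<close>

definition star_penalty :: "nat \<Rightarrow> nat \<Rightarrow> real" where
  "star_penalty T t = 64/5 * (Kr / real T)\<^sup>2 / \<xi> istar * (real t powr \<alpha> - real (t - 1) powr \<alpha>)"

text \<open>The counterpart of \<open>arm_stability_le\<close>: here the inverse rate brings
  \<open>1 / 16 powr \<alpha>\<close>, and \<open>(z / 16) powr \<alpha>\<close> is linearised. From
  \<open>t = 2\<close> on, the increment of the power is bounded by its derivative at
  \<open>t - 1\<close>.\<close>

lemma penalty_arm_le:
  assumes t: "2 \<le> t" "t \<le> T" and i: "i \<noteq> istar" and w: "0 < w" "w \<le> 1"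
    and step: "0 \<le> inv_rate_step \<eta> t"
  shows "inv_rate_step \<eta> t * ((tent \<alpha> w - tent \<alpha> (1 / real T)) / \<xi> i)
    \<le> 32/5 / (real (t - 1) * \<Delta> i) + \<alpha> * (\<alpha> + 1 / c t) / 4 * (\<Delta> i * w)"
proof -
  let ?D = "\<Delta> i"
  define s where "s = real (t - 1)"
  define f where "f = \<alpha> + 1 / c t"
  \<comment> \<open>Raising \<open>w\<close> to at least \<open>1 / t\<close> only increases the
    term. It ensures \<open>qlog \<alpha> (1 / v) \<le> c t\<close>, and a nonnegative difference to
    \<open>tent \<alpha> (1 / real T)\<close>, so that the upper bound on
    \<open>inv_rate_step\<close> may be inserted. The price is the \<open>1 / real t\<close> in the
    bound on \<open>v\<close>.\<close>
  define v where "v = max w (1 / real t)"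
  define z where "z = s * ?D\<^sup>2 * v"
  have s: "1 \<le> s" "real t = s + 1"
    using t by (auto simp: s_def)
  have D: "0 < ?D" "?D \<le> 1"
    using gap_pos[OF i] gap_le_one by auto
  have xi: "0 < \<xi> i"
    by (rule param_pos)
  have tT: "1 / real T \<le> 1 / real t" "0 < 1 / real T" "1 / real T \<le> 1"
    using t by (auto intro!: divide_left_mono)
  have v: "0 < v" "v \<le> 1" "w \<le> v" "1 / real t \<le> v" "v \<le> w + 1 / real t"
    using w s by (auto simp: v_def)
  have z: "0 < z"
    using s v D by (simp add: z_def)
  have f: "0 \<le> f" "f \<le> \<alpha> + 8/5"
    unfolding f_def using rate_factor_le[OF \<alpha>, of t] by auto
  have diff: "0 \<le> tent \<alpha> v - tent \<alpha> (1 / real T)"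
    using tent_mono[of "1 / real T" v \<alpha>] tT v by simp
  have "tent \<alpha> w \<le> tent \<alpha> v"
    using w v by (intro tent_mono) auto
  then have "inv_rate_step \<eta> t * ((tent \<alpha> w - tent \<alpha> (1 / real T)) / \<xi> i)
      \<le> inv_rate_step \<eta> t * ((tent \<alpha> v - tent \<alpha> (1 / real T)) / \<xi> i)"
    using step xi by (intro mult_left_mono divide_right_mono) auto
  also have "\<dots> \<le> 4 / 16 powr \<alpha> / c t * (\<alpha> * s powr (\<alpha> - 1)) * ((tent \<alpha> v - tent \<alpha> (1 / real T)) / \<xi> i)"
  proof (rule mult_right_mono)
    have "inv_rate_step \<eta> t \<le> 4 / 16 powr \<alpha> / c t * (real t powr \<alpha> - real (t - 1) powr \<alpha>)"
      unfolding \<eta>_def using t by (intro inv_rate_step_le[OF \<alpha>]) auto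
    also have "\<dots> \<le> 4 / 16 powr \<alpha> / c t * (\<alpha> * s powr (\<alpha> - 1))"
      unfolding s_def using powr_increment_le[OF \<alpha> t(1)] c_pos[of t] by (intro mult_left_mono) auto
    finally show "inv_rate_step \<eta> t \<le> \<dots>" .
  qed (use diff xi in simp)
  also have "\<dots> = 4 / 16 powr \<alpha> / c t * s powr (\<alpha> - 1) / \<xi> i * (\<alpha> * (tent \<alpha> v - tent \<alpha> (1 / real T)))"
    by simp
  also have "\<dots> \<le> 4 / 16 powr \<alpha> / c t * s powr (\<alpha> - 1) / \<xi> i * (v powr \<alpha> * (1 + \<alpha> * c t))"
  proof (rule mult_left_mono)
    have "\<alpha> * (tent \<alpha> v - tent \<alpha> (1 / real T)) \<le> v powr \<alpha> * (1 + \<alpha> * qlog \<alpha> (1 / v))"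
      using \<alpha> tT v by (intro tent_diff_le) auto
    also have "\<dots> \<le> v powr \<alpha> * (1 + \<alpha> * c t)"
    proof -
      have "1 / v \<le> real t"
        using v s by (simp add: field_simps)
      then have "qlog \<alpha> (1 / v) \<le> c t"
        unfolding rate_log_def using v by (intro qlog_mono) auto
      then show ?thesis
        using \<alpha> by (intro mult_left_mono add_left_mono) auto
    qed
    finally show "\<alpha> * (tent \<alpha> v - tent \<alpha> (1 / real T)) \<le> \<dots>" .
  qed (use xi c_pos[of t] in simp)
  also have "\<dots> = 4 * f / (s * ?D) * ((z / 16) powr \<alpha>)"
  proof -
    have zp: "(z / 16) powr \<alpha> = s powr \<alpha> * ?D powr (2 * \<alpha>) * v powr \<alpha> / 16 powr \<alpha>"
      using s v D powr_powr[of ?D 2 \<alpha>] by (simp add: z_def powr_divide powr_mult)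
    have "1 / \<xi> i = ?D powr (2 * \<alpha>) / ?D"
      using D i by (simp add: param_eq powr_diff)
    moreover have "s powr (\<alpha> - 1) = s powr \<alpha> / s"
      using s by (simp add: powr_diff)
    moreover have "(1 + \<alpha> * c t) / c t = f"
      using c_pos[of t] by (simp add: f_def add_divide_distrib)
    moreover have "4 / 16 powr \<alpha> / c t * s powr (\<alpha> - 1) / \<xi> i * (v powr \<alpha> * (1 + \<alpha> * c t))
        = 4 / 16 powr \<alpha> * s powr (\<alpha> - 1) * (1 / \<xi> i) * v powr \<alpha> * ((1 + \<alpha> * c t) / c t)"
      by (simp add: mult_ac)
    ultimately show ?thesis
      unfolding zp by (simp add: mult_ac)
  qed
  also have "\<dots> \<le> 4 * f / (s * ?D) * (1 - \<alpha> + \<alpha> * (z / 16))"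
    using \<alpha> f z s D by (intro mult_left_mono powr_le_affine) auto
  also have "\<dots> = 4 * f * (1 - \<alpha>) / (s * ?D) + \<alpha> * f / 4 * (?D * v)"
    using s D by (simp add: z_def field_simps power2_eq_square)
  also have "\<dots> \<le> 4 * f * (1 - \<alpha>) / (s * ?D) + \<alpha> * f / 4 * (?D * (w + 1 / real t))"
    using v f \<alpha> D by (intro add_left_mono mult_left_mono) auto
  also have "\<dots> = 4 * f * (1 - \<alpha>) / (s * ?D) + \<alpha> * f / 4 * (?D / real t) + \<alpha> * f / 4 * (?D * w)"
    by (simp add: distrib_left)
  also have "\<alpha> * f / 4 * (?D / real t) \<le> \<alpha> * f / 4 * (1 / (s * ?D))"
  proof (rule mult_left_mono)
    have "?D * (s * ?D) \<le> 1 * (real t * 1)"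
      using D s by (intro mult_mono) auto
    then show "?D / real t \<le> 1 / (s * ?D)"
      using s D by (simp add: field_simps)
  qed (use f \<alpha> in simp)
  also have "4 * f * (1 - \<alpha>) / (s * ?D) + \<alpha> * f / 4 * (1 / (s * ?D))
      = f * (4 - 15/4 * \<alpha>) * (1 / (s * ?D))"
  proof -
    have "4 * f * (1 - \<alpha>) + \<alpha> * f / 4 = f * (4 - 15/4 * \<alpha>)"
      by (simp add: field_simps)
    then show ?thesis
      by (metis distrib_right mult.right_neutral times_divide_eq_right)
  qed
  also have "\<dots> \<le> 32/5 * (1 / (s * ?D))"
  proof (rule mult_right_mono)
    \<comment> \<open>The maximum over \<alpha> is attained at \<open>\<alpha> = 0\<close>, where it
      is \<open>4 * (8/5)\<close>.\<close>
    have "f * (4 - 15/4 * \<alpha>) \<le> (\<alpha> + 8/5) * (4 - 15/4 * \<alpha>)"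
      using f \<alpha> by (intro mult_right_mono) auto
    also have "\<dots> = 32/5 - 2 * \<alpha> - 15/4 * (\<alpha> * \<alpha>)"
      by (simp add: field_simps)
    also have "\<dots> \<le> 32/5"
      using \<alpha> mult_nonneg_nonneg[of \<alpha> \<alpha>] by linarith
    finally show "f * (4 - 15/4 * \<alpha>) \<le> 32/5" .
  qed (use s D in simp)
  finally show ?thesis
    by (simp add: s_def f_def)
qed

text \<open>Round \<open>1\<close> carries the whole initial inverse rate. The entropy at the
  comparator weight \<open>1 / real T\<close> costs at most \<open>ln (real T)\<close>, by
  comparison with the logarithmic barrier, and this is paid once.\<close>

lemma penalty_first_arm_le:
  assumes T: "1 \<le> T" and i: "i \<noteq> istar" and w: "0 < w" "w \<le> 1"
  shows "inv_rate_step \<eta> 1 * ((tent \<alpha> w - tent \<alpha> (1 / real T)) / \<xi> i) \<le> 32/5 * ln (real T) / \<Delta> i"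
proof -
  have D: "0 < \<Delta> i" "\<Delta> i \<le> 1"
    using gap_pos[OF i] gap_le_one by auto
  have "inv_rate_step \<eta> 1 \<le> 4 / 16 powr \<alpha> / c 1 * (real 1 powr \<alpha> - real (1 - 1) powr \<alpha>)"
    unfolding \<eta>_def by (rule inv_rate_step_le[OF \<alpha>]) simp
  also have "\<dots> = 4 / 16 powr \<alpha> * (1 / c 1)"
    by simp
  also have "\<dots> \<le> 4 * (8/5)"
  proof (rule mult_mono)
    have "1 \<le> 16 powr \<alpha>"
      using \<alpha> by (intro ge_one_powr_ge_zero) auto
    then show "4 / 16 powr \<alpha> \<le> 4"
      by (simp add: divide_le_eq)
  qed (use inverse_c_le[of 1] c_pos[of 1] in auto)
  finally have step: "inv_rate_step \<eta> 1 \<le> 32/5" by simp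
  have step0: "0 \<le> inv_rate_step \<eta> 1"
    using rate_pos[of 1] by (simp add: inv_rate_step_def)
  have "tent \<alpha> w \<le> 0"
    using tent_mono[of w 1 \<alpha>] w by simp
  moreover have "- tent \<alpha> (1 / real T) \<le> ln (real T)"
  proof -
    have "- tent \<alpha> (1 / real T) \<le> ln (1 / (1 / real T)) - (1 - 1 / real T)"
      using \<alpha> T by (intro tent_ge_ln) auto
    moreover have "1 / real T \<le> 1"
      using T by simp
    ultimately show ?thesis by simp
  qed
  ultimately have "(tent \<alpha> w - tent \<alpha> (1 / real T)) / \<xi> i \<le> ln (real T) / \<xi> i"
    using param_pos[of i] by (intro divide_right_mono) auto
  also have "\<dots> = ln (real T) * (\<Delta> i powr (2 * \<alpha>) / \<Delta> i)"
    using D i by (simp add: param_eq powr_diff)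
  also have "\<dots> \<le> ln (real T) * (1 / \<Delta> i)"
    using T D \<alpha> by (intro mult_left_mono divide_right_mono powr_le1) auto
  finally have "(tent \<alpha> w - tent \<alpha> (1 / real T)) / \<xi> i \<le> ln (real T) / \<Delta> i" by simp
  then have "inv_rate_step \<eta> 1 * ((tent \<alpha> w - tent \<alpha> (1 / real T)) / \<xi> i)
      \<le> inv_rate_step \<eta> 1 * (ln (real T) / \<Delta> i)"
    using step0 by (rule mult_left_mono)
  also have "\<dots> \<le> 32/5 * (ln (real T) / \<Delta> i)"
    using step T D by (intro mult_right_mono) auto
  finally show ?thesis by simp
qed

lemma penalty_istar_le:
  assumes t: "1 \<le> t" and T: "2 * Kr \<le> real T" and w: "0 < w" "w \<le> 1"
    and step: "0 \<le> inv_rate_step \<eta> t"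
  shows "inv_rate_step \<eta> t * ((tent \<alpha> w - tent \<alpha> (comparator T istar)) / \<xi> istar) \<le> star_penalty T t"
proof -
  let ?u = "comparator T istar" and ?d = "real t powr \<alpha> - real (t - 1) powr \<alpha>"
  have u: "1/2 \<le> ?u" "?u \<le> 1"
    using comparator_props(3)[OF T] prob_simplex_le_one[OF comparator_props(1)[OF T]] by auto
  have "tent \<alpha> w \<le> 0"
    using tent_mono[of w 1 \<alpha>] w by simp
  moreover have "- tent \<alpha> ?u \<le> 2 * (1 - ?u)\<^sup>2"
    using \<alpha> u by (intro tent_ge_square) auto
  moreover have "1 - ?u = Kr / real T"
    by (simp add: comparator_def)
  ultimately have "tent \<alpha> w - tent \<alpha> ?u \<le> 2 * (Kr / real T)\<^sup>2"
    by simp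
  then have 1: "(tent \<alpha> w - tent \<alpha> ?u) / \<xi> istar \<le> 2 * (Kr / real T)\<^sup>2 / \<xi> istar"
    using param_pos[of istar] by (intro divide_right_mono) auto
  have d0: "0 \<le> ?d"
    using \<alpha> by (auto intro: powr_mono2)
  have "inv_rate_step \<eta> t \<le> 4 / 16 powr \<alpha> / c t * ?d"
    unfolding \<eta>_def using t by (rule inv_rate_step_le[OF \<alpha>])
  also have "4 / 16 powr \<alpha> / c t * ?d = 4 / 16 powr \<alpha> * (1 / c t) * ?d"
    by simp
  also have "\<dots> \<le> 4 * (8/5) * ?d"
  proof (intro mult_right_mono mult_mono)
    have "1 \<le> 16 powr \<alpha>"
      using \<alpha> by (intro ge_one_powr_ge_zero) auto
    then show "4 / 16 powr \<alpha> \<le> 4"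
      by (simp add: divide_le_eq)
  qed (use inverse_c_le[of t] c_pos[of t] d0 in auto)
  finally have 2: "inv_rate_step \<eta> t \<le> 32/5 * ?d" by simp
  have "inv_rate_step \<eta> t * ((tent \<alpha> w - tent \<alpha> ?u) / \<xi> istar)
      \<le> inv_rate_step \<eta> t * (2 * (Kr / real T)\<^sup>2 / \<xi> istar)"
    using 1 step by (rule mult_left_mono)
  also have "\<dots> \<le> 32/5 * ?d * (2 * (Kr / real T)\<^sup>2 / \<xi> istar)"
    using 2 param_pos[of istar] by (intro mult_right_mono) auto
  also have "\<dots> = star_penalty T t"
    by (simp add: star_penalty_def)
  finally show ?thesis .
qed

lemma star_penalty_nonneg: "0 \<le> star_penalty T t"
  unfolding star_penalty_def using param_pos[of istar] \<alpha>
  by (intro mult_nonneg_nonneg divide_nonneg_pos) (auto intro: powr_mono2)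

text \<open>The increments telescope to \<open>real T powr \<alpha>\<close>, using
  \<open>0 powr \<alpha> = 0\<close>. It remains to see
  \<open>real T powr \<alpha> \<le> real T * \<xi> istar\<close>: for \<alpha> above
  \<open>1/2\<close> the parameter is at least \<open>1\<close>, and otherwise
  \<open>1 / \<delta> \<le> real T\<close> bounds it below by
  \<open>real T powr (2 * \<alpha> - 1)\<close>.\<close>

lemma sum_star_penalty_le:
  assumes T: "1 \<le> T" "1 \<le> real T * \<delta>"
  shows "(\<Sum>t=1..T. star_penalty T t) \<le> 64/5 * Kr\<^sup>2 / real T"
proof -
  have "(\<Sum>t=1..n. real t powr \<alpha> - real (t - 1) powr \<alpha>) = real n powr \<alpha>" if "n \<ge> 1" for n
    using that by (induction n rule: nat_induct_at_least) auto
  then have "(\<Sum>t=1..T. star_penalty T t) = 64/5 * (Kr / real T)\<^sup>2 / \<xi> istar * real T powr \<alpha>"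
    unfolding star_penalty_def sum_distrib_left[symmetric] using T(1) by (simp only:)
  also have "\<dots> = 64/5 * (Kr / real T)\<^sup>2 * (real T powr \<alpha> / \<xi> istar)"
    by simp
  also have "\<dots> \<le> 64/5 * (Kr / real T)\<^sup>2 * real T"
  proof (intro mult_left_mono)
    have d: "0 < \<delta>" "\<delta> \<le> 1"
      by (rule min_gap_bounds)+
    show "real T powr \<alpha> / \<xi> istar \<le> real T"
    proof (cases "\<alpha> \<le> 1/2")
      case True
      have "real T powr \<alpha> = real T * real T powr (\<alpha> - 1)"
        using T by (simp add: powr_diff)
      also have "\<dots> \<le> real T * real T powr (2 * \<alpha> - 1)"
        using T \<alpha> by (intro mult_left_mono powr_mono) auto
      also have "real T powr (2 * \<alpha> - 1) \<le> (1 / \<delta>) powr (2 * \<alpha> - 1)"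
        using True T d by (intro powr_mono2') (auto simp: field_simps)
      also have "(1 / \<delta>) powr (2 * \<alpha> - 1) = \<xi> istar"
        using d powr_minus[of \<delta> "2 * \<alpha> - 1"] by (simp add: param_eq powr_divide inverse_eq_divide)
      finally have "real T powr \<alpha> \<le> real T * \<xi> istar"
        using T by simp
      then show ?thesis
        using param_pos[of istar] by (simp add: divide_le_eq)
    next
      case False
      have "1 \<le> \<xi> istar"
        using False d powr_mono'[of "1 - 2 * \<alpha>" 0 \<delta>] by (simp add: param_eq)
      moreover have "real T powr \<alpha> \<le> real T powr 1"
        using T \<alpha> by (intro powr_mono) auto
      moreover have "real T * 1 \<le> real T * \<xi> istar"
        using \<open>1 \<le> \<xi> istar\<close> by (intro mult_left_mono) auto
      ultimately show ?thesis
        using param_pos[of istar] by (subst pos_divide_le_eq) auto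
    qed
  qed auto
  also have "\<dots> = 64/5 * Kr\<^sup>2 / real T"
    using T by (simp add: power2_eq_square)
  finally show ?thesis .
qed

lemma penalty_split:
  "penalty T t w = inv_rate_step \<eta> t * ((tent \<alpha> (w istar) - tent \<alpha> (comparator T istar)) / \<xi> istar)
    + (\<Sum>i\<in>others. inv_rate_step \<eta> t * ((tent \<alpha> (w i) - tent \<alpha> (1 / real T)) / \<xi> i))"
proof -
  have "(\<Sum>i\<in>others. (tent \<alpha> (w i) - tent \<alpha> (comparator T i)) / \<xi> i)
      = (\<Sum>i\<in>others. (tent \<alpha> (w i) - tent \<alpha> (1 / real T)) / \<xi> i)"
    by (intro sum.cong) (auto simp: comparator_def)
  then show ?thesis
    by (simp add: penalty_def sum.remove[of UNIV istar] distrib_left sum_distrib_left)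
qed

lemma penalty_first_le:
  assumes T: "1 \<le> T" "2 * Kr \<le> real T" and w: "w \<in> prob_simplex" "\<And>i. 0 < w i"
  shows "penalty T 1 w \<le> (\<Sum>i\<in>others. 32/5 * ln (real T) / \<Delta> i) + star_penalty T 1"
proof -
  have "0 \<le> inv_rate_step \<eta> 1"
    using rate_pos[of 1] by (simp add: inv_rate_step_def)
  then have "inv_rate_step \<eta> 1 * ((tent \<alpha> (w istar) - tent \<alpha> (comparator T istar)) / \<xi> istar)
      \<le> star_penalty T 1"
    using T w prob_simplex_le_one[OF w(1)] by (intro penalty_istar_le) auto
  moreover have "(\<Sum>i\<in>others. inv_rate_step \<eta> 1 * ((tent \<alpha> (w i) - tent \<alpha> (1 / real T)) / \<xi> i))
      \<le> (\<Sum>i\<in>others. 32/5 * ln (real T) / \<Delta> i)"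
    using T w prob_simplex_le_one[OF w(1)] by (intro sum_mono penalty_first_arm_le) auto
  ultimately show ?thesis
    unfolding penalty_split by linarith
qed

lemma penalty_le:
  assumes t: "2 \<le> t" "t \<le> T" and T: "2 * Kr \<le> real T" and w: "w \<in> prob_simplex" "\<And>i. 0 < w i"
    and step: "0 \<le> inv_rate_step \<eta> t"
  shows "penalty T t w \<le> (\<Sum>i\<in>others. 32/5 / (real (t - 1) * \<Delta> i))
    + \<alpha> * (\<alpha> + 1 / c t) / 4 * (\<Sum>i\<in>others. \<Delta> i * w i) + star_penalty T t"
proof -
  have "inv_rate_step \<eta> t * ((tent \<alpha> (w istar) - tent \<alpha> (comparator T istar)) / \<xi> istar)
      \<le> star_penalty T t"
    using t T step w prob_simplex_le_one[OF w(1)] by (intro penalty_istar_le) auto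
  moreover have "(\<Sum>i\<in>others. inv_rate_step \<eta> t * ((tent \<alpha> (w i) - tent \<alpha> (1 / real T)) / \<xi> i))
      \<le> (\<Sum>i\<in>others. 32/5 / (real (t - 1) * \<Delta> i) + \<alpha> * (\<alpha> + 1 / c t) / 4 * (\<Delta> i * w i))"
    using t step w prob_simplex_le_one[OF w(1)] by (intro sum_mono penalty_arm_le) auto
  ultimately show ?thesis
    unfolding penalty_split by (simp add: sum.distrib sum_distrib_left)
qed

text \<open>When the learning rate increases, optimality of \<open>w\<close> bounds its regulariser by the
  estimated loss of the comparator.\<close>

lemma penalty_le_of_decreasing:
  assumes t: "2 \<le> t" and T: "2 * Kr \<le> real T"
    and w: "ftrl_min \<alpha> (\<lambda>i. \<eta> t * \<xi> i) Lh w" and Lh: "\<And>i. 0 \<le> Lh i"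
    and step: "inv_rate_step \<eta> t < 0"
  shows "penalty T t w \<le> 32/5 / (real (t - 1))\<^sup>2 * (\<Sum>i\<in>UNIV. comparator T i * Lh i)"
proof -
  let ?u = "comparator T"
  define G where "G = (\<Sum>i\<in>UNIV. (tent \<alpha> (w i) - tent \<alpha> (?u i)) / \<xi> i)"
  define U where "U = (\<Sum>i\<in>UNIV. ?u i * Lh i)"
  have h: "0 < \<eta> t" "0 < \<eta> (t - 1)"
    using t by (auto intro: rate_pos)
  have U: "0 \<le> U"
    unfolding U_def using Lh comparator_props(2)[OF T]
    by (intro sum_nonneg mult_nonneg_nonneg) (auto intro: less_imp_le)
  have W: "0 \<le> (\<Sum>i\<in>UNIV. w i * Lh i)"
    using Lh ftrl_min_pos[OF w] by (intro sum_nonneg mult_nonneg_nonneg) (auto intro: less_imp_le)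
  have "ftrl_obj \<alpha> (\<lambda>i. \<eta> t * \<xi> i) Lh w \<le> ftrl_obj \<alpha> (\<lambda>i. \<eta> t * \<xi> i) Lh ?u"
    using w comparator_props[OF T] by (simp add: ftrl_min_def)
  moreover have "(\<Sum>i\<in>UNIV. tent \<alpha> (w i) / (\<eta> t * \<xi> i)) - (\<Sum>i\<in>UNIV. tent \<alpha> (?u i) / (\<eta> t * \<xi> i)) = G / \<eta> t"
    by (simp add: G_def sum_divide_distrib sum_subtractf diff_divide_distrib mult.commute)
  ultimately have "- G / \<eta> t \<le> U"
    using W by (simp add: ftrl_obj_def U_def)
  then have "- G / \<eta> t * \<eta> t \<le> U * \<eta> t"
    using h by (intro mult_right_mono) auto
  then have G: "- G \<le> \<eta> t * U"
    using h by (simp add: mult.commute)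
  have "penalty T t w = (- inv_rate_step \<eta> t) * (- G)"
    by (simp add: penalty_def G_def)
  also have "\<dots> \<le> (- inv_rate_step \<eta> t) * (\<eta> t * U)"
    using G step by (intro mult_left_mono) auto
  also have "\<dots> = (\<eta> t / \<eta> (t - 1) - 1) * U"
    using h t by (simp add: inv_rate_step_def field_simps)
  also have "\<dots> \<le> 32/5 / (real (t - 1))\<^sup>2 * U"
    using learning_rate_ratio_le[OF \<alpha> t] U by (intro mult_right_mono) (auto simp: \<eta>_def)
  finally show ?thesis by (simp add: U_def)
qed

text \<open>Before \<open>T1\<close> the factor \<open>\<alpha> + 1 / c t\<close> is at most
  \<open>2\<close>, giving \<open>1/8 + 1/2\<close>. From \<open>T1\<close> on,
  \<open>ln t \<ge> 2\<close> sharpens it to \<open>3/2\<close>, and the total is at most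
  \<open>5/8 + \<alpha> / 8\<close>.\<close>

lemma regret_share_le:
  "1/8 + (if real t < T1 then 0 else 1/2 - \<alpha> / 4) + \<alpha> * (\<alpha> + 1 / c t) / 4 \<le> 3/4"
proof -
  define f where "f = \<alpha> + 1 / c t"
  have f: "0 \<le> f" "f \<le> 1 + 1 / ln (max (exp 1) (real t))"
    unfolding f_def using rate_factor_le[OF \<alpha>, of t] by auto
  show ?thesis
  proof (cases "real t < T1")
    case True
    have "1 \<le> ln (max (exp 1) (real t))"
      by (subst ln_ge_iff) (auto simp: less_max_iff_disj)
    then have "f \<le> 2"
      using f(2) by (smt (verit) divide_le_eq_1)
    then have "\<alpha> * f \<le> 1 * 2"
      using \<alpha> f by (intro mult_mono) auto
    then show ?thesis
      using True by (simp add: f_def)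
  next
    case False
    then have "2 \<le> ln (real t)"
      using after_burn_in(1) by simp
    moreover have "0 < real t"
      using False T1_pos by linarith
    ultimately have "2 \<le> ln (max (exp 1) (real t))"
      by (smt (verit) ln_le_cancel_iff max.cobounded2 exp_gt_zero)
    then have "1 / ln (max (exp 1) (real t)) \<le> 1 / 2"
      by (intro divide_left_mono) auto
    then have "\<alpha> * f \<le> \<alpha> * (3/2)"
      using \<alpha> f by (intro mult_left_mono) auto
    then show ?thesis
      unfolding f_def[symmetric] using False \<alpha> by simp
  qed
qed

text \<open>Linearising the power gives \<open>\<theta> t \<le> X * ln T1 / t + 1\<close>. The
  harmonic part sums to order \<open>X * (ln T1)\<^sup>2\<close>, the rest to \<open>T1\<close>;
  both are of order \<open>X * L ^ 4\<close>, and \<open>X * \<delta> / 8 = 2 / \<delta>\<close>.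
  Absorption turns the \<open>4\<close> here into the \<open>16\<close> of the final bound.\<close>

lemma burn_in_sum_le:
  "(\<Sum>t\<in>{1..<T}. if real t < T1 then \<theta> t * \<delta> / 8 else 0) \<le> 4 * L ^ 4 / \<delta>"
proof -
  define N where "N = nat \<lfloor>T1\<rfloor>"
  have X: "16 \<le> X" by (rule ln_X_bounds)
  have "1 \<le> L ^ 4"
    using L_bounds(2) by (intro one_le_power) auto
  then have T1: "16 * 1 \<le> T1"
    unfolding T1_def using X by (intro mult_mono) auto
  have N: "1 \<le> N" "real N \<le> T1"
    using T1 by (auto simp: N_def le_nat_iff le_floor_iff)
  let ?l = "ln T1"
  have l: "2 \<le> ?l" "?l \<le> L\<^sup>2 / 2"
    by (rule ln_T1_bounds)+
  have th: "\<theta> t \<le> X * ?l * (1 / real t) + 1" if t: "1 \<le> t" "real t \<le> T1" for t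
  proof -
    have "(X / real t) powr \<alpha> \<le> 1 - \<alpha> + \<alpha> * (X / real t)"
      using \<alpha> X t by (intro powr_le_affine) auto
    then have "\<theta> t \<le> (1 - \<alpha> + \<alpha> * (X / real t)) * c t"
      unfolding \<theta>_def using c_pos[of t] by (intro mult_right_mono) auto
    also have "\<dots> = (1 - \<alpha>) * c t + (X / real t) * (\<alpha> * c t)"
      by (simp add: algebra_simps)
    also have "(1 - \<alpha>) * c t \<le> 1"
      using \<alpha> one_minus_times_qlog_le[of "max (exp 1) (real t)" \<alpha>] by (simp add: rate_log_def less_max_iff_disj)
    also have "(X / real t) * (\<alpha> * c t) \<le> (X / real t) * ?l"
    proof (rule mult_left_mono)
      have "\<alpha> * c t \<le> 1 * c t"
        using \<alpha> c_pos[of t] by (intro mult_right_mono) auto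
      also have "1 * c t \<le> ln (max (exp 1) (real t))"
        using rate_log_le_ln[OF \<alpha>] by simp
      also have "\<dots> \<le> ?l"
      proof (subst ln_le_cancel_iff)
        show "max (exp 1) (real t) \<le> T1"
          using exp_1_bounds(2) T1 t by simp
      qed (use T1 in \<open>auto simp: less_max_iff_disj\<close>)
      finally show "\<alpha> * c t \<le> ?l" .
    qed (use X in simp)
    finally show ?thesis by simp
  qed
  have "(\<Sum>t\<in>{1..<T}. if real t < T1 then \<theta> t * \<delta> / 8 else 0)
      = (\<Sum>t\<in>{t\<in>{1..<T}. real t < T1}. \<theta> t * \<delta> / 8)"
    by (simp add: sum.If_cases Int_def)
  also have "\<dots> \<le> (\<Sum>t=1..N. \<theta> t * \<delta> / 8)"
    using theta_nonneg min_gap_bounds(1)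
    by (intro sum_mono2) (auto simp: N_def le_nat_iff le_floor_iff)
  also have "\<dots> \<le> (\<Sum>t=1..N. (X * ?l * (1 / real t) + 1) * \<delta> / 8)"
    using N min_gap_bounds(1) by (intro sum_mono divide_right_mono mult_right_mono th) auto
  also have "\<dots> = (X * ?l * (\<Sum>t=1..N. 1 / real t) + real N) * \<delta> / 8"
    by (simp add: sum.distrib sum_distrib_left sum_distrib_right sum_divide_distrib
        add_divide_distrib distrib_right)
  also have "\<dots> \<le> (X * ?l * (1 + ?l) + T1) * \<delta> / 8"
  proof (intro divide_right_mono mult_right_mono add_mono mult_left_mono)
    have "(\<Sum>t=1..N. 1 / real t) \<le> 1 + ln (real N)"
      using N(1) by (rule sum_inverse_le_one_plus_ln)
    also have "ln (real N) \<le> ?l"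
      using N by simp
    finally show "(\<Sum>t=1..N. 1 / real t) \<le> 1 + ?l" by simp
  qed (use N X l min_gap_bounds(1) in auto)
  also have "\<dots> = 2 / \<delta> * (?l * (1 + ?l) + L ^ 4)"
    using min_gap_bounds(1) by (simp add: T1_def X_def field_simps power2_eq_square)
  also have "\<dots> \<le> 2 / \<delta> * (2 * L ^ 4)"
  proof (intro mult_left_mono)
    have "1 + ?l \<le> L\<^sup>2"
      using l by linarith
    then have "?l * (1 + ?l) \<le> (L\<^sup>2 / 2) * L\<^sup>2"
      using l by (intro mult_mono) auto
    also have "\<dots> \<le> L ^ 4"
      using L_bounds(2) by (simp add: power2_eq_square power4_eq_xxxx)
    finally show "?l * (1 + ?l) + L ^ 4 \<le> 2 * L ^ 4" by simp
  qed (use min_gap_bounds(1) in auto)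
  finally show ?thesis by simp
qed

text \<open>The first round is split off with \<open>c 1 \<le> 1\<close>: the other rounds then sum
  to at most \<open>ln (real T)\<close> with no additive \<open>1\<close>, so
  \<open>min_inv_log\<close> never occurs without a logarithm beside it.\<close>

lemma stability_sum_le:
  assumes T: "exp 1 \<le> real T" and i: "i \<noteq> istar"
  shows "(\<Sum>t\<in>{1..<T}. 2 * \<alpha> * c t / (real t * \<Delta> i)) \<le> (2 + 2 * min_inv_log \<alpha> T * ln (real T)) / \<Delta> i"
proof -
  let ?m = "min_inv_log \<alpha> T"
  have T1: "1 \<le> T" "1 \<le> ln (real T)"
    using T exp_1_bounds(1) by (auto simp: ln_ge_iff)
  have m: "\<alpha> * c t \<le> ?m" if "t \<le> T" for t
  proof -
    have "\<alpha> * c t \<le> 1 * c t"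
      using \<alpha> c_pos[of t] by (intro mult_right_mono) auto
    moreover have "c t \<le> ln (real T)"
    proof -
      have "c t \<le> ln (max (exp 1) (real t))"
        by (rule rate_log_le_ln[OF \<alpha>])
      also have "\<dots> \<le> ln (real T)"
        using T that T1 by (subst ln_le_cancel_iff) (auto simp: less_max_iff_disj)
      finally show ?thesis .
    qed
    moreover have "c t \<le> 1 / (1 - \<alpha>)" if "\<alpha> \<noteq> 1"
      unfolding rate_log_def using \<alpha> that by (intro qlog_le_inverse) (auto simp: less_max_iff_disj)
    ultimately show ?thesis
      by (auto simp: min_inv_log_def)
  qed
  have c1: "\<alpha> * c 1 \<le> 1"
  proof -
    have "c 1 \<le> 1"
      using rate_log_le_ln[OF \<alpha>, of 1] by (simp add: max_absorb1)
    then show ?thesis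
      using \<alpha> c_pos[of 1] mult_mono[of \<alpha> 1 "c 1" 1] by simp
  qed
  have D: "0 < \<Delta> i"
    using i by (rule gap_pos)
  have "(\<Sum>t\<in>{1..<T}. 2 * \<alpha> * c t / (real t * \<Delta> i)) \<le> (\<Sum>t=1..T. 2 * \<alpha> * c t / (real t * \<Delta> i))"
    using \<alpha> D c_pos by (intro sum_mono2) (auto intro!: divide_nonneg_nonneg mult_nonneg_nonneg less_imp_le[OF c_pos])
  also have "\<dots> = 2 * (\<alpha> * c 1) / \<Delta> i + (\<Sum>t=2..T. 2 * (\<alpha> * c t) / \<Delta> i * (1 / real t))"
    using T1 by (simp add: sum.atLeast_Suc_atMost numeral_2_eq_2 mult_ac)
  also have "\<dots> \<le> 2 * 1 / \<Delta> i + (\<Sum>t=2..T. 2 * ?m / \<Delta> i * (1 / real t))"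
    using c1 m D by (intro add_mono sum_mono mult_right_mono divide_right_mono mult_left_mono) auto
  also have "\<dots> = 2 / \<Delta> i + 2 * ?m / \<Delta> i * (\<Sum>t=2..T. 1 / real t)"
    unfolding sum_distrib_left[symmetric] by simp
  also have "\<dots> \<le> 2 / \<Delta> i + 2 * ?m / \<Delta> i * ln (real T)"
  proof (intro add_left_mono mult_left_mono sum_inverse_le_ln T1)
    have "0 \<le> ?m"
      using T1 \<alpha> by (auto simp: min_inv_log_def)
    then show "0 \<le> 2 * ?m / \<Delta> i"
      using D by simp
  qed
  finally show ?thesis
    by (simp add: add_divide_distrib)
qed

end

section \<open>Expectations\<close>

text \<open>Each superlevel set of \<open>f\<close> is the preimage of a union of balls under the
  vector of the \<open>Y i\<close>, with radii small enough that \<open>f\<close> stays above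
  \<open>a\<close>. An arbitrary union of balls is open, so no factorisation of \<open>f\<close>
  through that vector has to be constructed.\<close>

lemma borel_measurable_Hoelder_comp:
  fixes f :: "'w \<Rightarrow> real" and Y :: "'k::finite \<Rightarrow> 'w \<Rightarrow> real"
  assumes Y: "\<And>i. Y i \<in> borel_measurable N" and C: "0 \<le> C"
    and f: "\<And>x y. x \<in> space N \<Longrightarrow> y \<in> space N \<Longrightarrow> (f x - f y)\<^sup>2 \<le> C * (\<Sum>i\<in>UNIV. \<bar>Y i x - Y i y\<bar>)"
  shows "f \<in> borel_measurable N"
  unfolding borel_measurable_iff_greater
proof
  fix a
  define V where "V x = (\<chi> i. Y i x)" for x
  define K where "K = C * real CARD('k) + 1"
  have K: "0 < K"
    using C by (simp add: K_def add_nonneg_pos)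
  have V: "V \<in> borel_measurable N"
    unfolding borel_measurable_euclidean_space[of V]
    using Y by (auto simp: Basis_vec_def V_def inner_axis)
  define A where "A = (\<Union>x\<in>{x\<in>space N. a < f x}. ball (V x) ((f x - a)\<^sup>2 / K))"
  have "{x \<in> space N. a < f x} = V -` A \<inter> space N"
  proof (intro equalityI subsetI)
    fix x assume "x \<in> {x \<in> space N. a < f x}"
    then show "x \<in> V -` A \<inter> space N"
      using K by (auto simp: A_def intro!: bexI[of _ x])
  next
    fix y assume "y \<in> V -` A \<inter> space N"
    then obtain x where y: "y \<in> space N" and x: "x \<in> space N" "a < f x"
        and d: "dist (V x) (V y) < (f x - a)\<^sup>2 / K"
      by (auto simp: A_def)
    have "\<bar>Y i x - Y i y\<bar> \<le> dist (V x) (V y)" for i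
      using component_le_norm_cart[of "V x - V y" i] by (simp add: V_def dist_norm)
    then have "(\<Sum>i\<in>UNIV. \<bar>Y i x - Y i y\<bar>) \<le> (\<Sum>i\<in>(UNIV::'k set). dist (V x) (V y))"
      by (intro sum_mono) auto
    then have "C * (\<Sum>i\<in>UNIV. \<bar>Y i x - Y i y\<bar>) \<le> C * (real CARD('k) * dist (V x) (V y))"
      using C by (intro mult_left_mono) auto
    also have "\<dots> \<le> K * dist (V x) (V y)"
      by (simp add: K_def algebra_simps)
    also have "\<dots> < (f x - a)\<^sup>2"
      using d K by (simp add: pos_less_divide_eq mult.commute)
    finally have "(f x - f y)\<^sup>2 < (f x - a)\<^sup>2"
      using f[OF x(1) y] by simp
    then have "\<bar>f x - f y\<bar>\<^sup>2 < \<bar>f x - a\<bar>\<^sup>2"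
      by simp
    then have "\<bar>f x - f y\<bar> < \<bar>f x - a\<bar>"
      by (rule power2_less_imp_less) simp
    then show "y \<in> {x \<in> space N. a < f x}"
      using x y by auto
  qed
  moreover have "open A"
    by (auto simp: A_def)
  ultimately show "{x \<in> space N. a < f x} \<in> sets N"
    using V by (simp add: borel_open measurable_sets)
qed

section \<open>Histories and conditioning\<close>

locale bandit = prob_space M for M :: "'w measure" +
  fixes I :: "nat \<Rightarrow> 'w \<Rightarrow> 'k::finite" and l :: "nat \<Rightarrow> 'w \<Rightarrow> 'k \<Rightarrow> real"
  assumes game: "bandit_game M I l"
begin

abbreviation "H \<equiv> history M I l"

lemma action_measurable: "t \<ge> 1 \<Longrightarrow> I t \<in> measurable M (count_space UNIV)"
  and loss_measurable: "t \<ge> 1 \<Longrightarrow> (\<lambda>\<omega>. l t \<omega> i) \<in> borel_measurable M"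
  and loss_range: "t \<ge> 1 \<Longrightarrow> \<omega> \<in> space M \<Longrightarrow> 0 \<le> l t \<omega> i \<and> l t \<omega> i \<le> 1"
  using game by (auto simp: bandit_game_def)

lemma space_history [simp]: "space (H p q) = space M"
  by (simp add: history_def space_measure_of_conv)

lemma history_generator_subset:
  "{I s -` A \<inter> space M | s A. s \<in> {1..p}} \<union>
   {(\<lambda>\<omega>. l s \<omega> i) -` B \<inter> space M | s i B. s \<in> {1..q} \<and> B \<in> sets borel} \<subseteq> Pow (space M)"
  by auto

lemma sets_history:
  "sets (H p q) = sigma_sets (space M) ({I s -` A \<inter> space M | s A. s \<in> {1..p}} \<union>
     {(\<lambda>\<omega>. l s \<omega> i) -` B \<inter> space M | s i B. s \<in> {1..q} \<and> B \<in> sets borel})"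
  unfolding history_def by (rule sets_measure_of[OF history_generator_subset])

lemma subalgebra_history: "subalgebra M (H p q)"
  unfolding subalgebra_def sets_history
proof (intro conjI sets.sigma_sets_subset)
  show "{I s -` A \<inter> space M | s A. s \<in> {1..p}} \<union>
      {(\<lambda>\<omega>. l s \<omega> i) -` B \<inter> space M | s i B. s \<in> {1..q} \<and> B \<in> sets borel} \<subseteq> sets M"
    using action_measurable loss_measurable by (auto intro: measurable_sets)
qed simp

lemma subalgebra_history_mono:
  assumes "p \<le> p'" "q \<le> q'"
  shows "subalgebra (H p' q') (H p q)"
  unfolding subalgebra_def sets_history
proof (intro conjI sigma_sets_mono')
  show "{I s -` A \<inter> space M | s A. s \<in> {1..p}} \<union>
      {(\<lambda>\<omega>. l s \<omega> i) -` B \<inter> space M | s i B. s \<in> {1..q} \<and> B \<in> sets borel}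
    \<subseteq> {I s -` A \<inter> space M | s A. s \<in> {1..p'}} \<union>
      {(\<lambda>\<omega>. l s \<omega> i) -` B \<inter> space M | s i B. s \<in> {1..q'} \<and> B \<in> sets borel}"
    using assms by (auto 0 4 intro: order_trans)
qed simp

lemma action_measurable_history: "1 \<le> s \<Longrightarrow> s \<le> p \<Longrightarrow> I s \<in> measurable (H p q) (count_space UNIV)"
  by (rule measurableI) (auto simp: sets_history intro!: sigma_sets.Basic)

lemma loss_measurable_history:
  assumes "1 \<le> s" "s \<le> q"
  shows "(\<lambda>\<omega>. l s \<omega> i) \<in> borel_measurable (H p q)"
proof (rule measurableI)
  fix B :: "real set" assume "B \<in> sets borel"
  then have "(\<lambda>\<omega>. l s \<omega> i) -` B \<inter> space M \<in> sets (H p q)"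
    unfolding sets_history using assms by (intro sigma_sets.Basic UnI2 CollectI exI[of _ s]) auto
  then show "(\<lambda>\<omega>. l s \<omega> i) -` B \<inter> space (H p q) \<in> sets (H p q)" by simp
qed simp

lemma cond_exp_history: "sigma_finite_subalgebra M (H p q)"
  by (intro finite_measure_subalgebra_is_sigma_finite finite_measure_subalgebra.intro
      finite_measure_subalgebra_axioms.intro subalgebra_history finite_measure_axioms)

lemma measurable_history_M: "f \<in> borel_measurable (H p q) \<Longrightarrow> f \<in> borel_measurable M"
  using subalgebra_history by (rule measurable_from_subalg)

lemma integrable_bounded:
  fixes f :: "'w \<Rightarrow> real"
  assumes "f \<in> borel_measurable M" "\<And>\<omega>. \<omega> \<in> space M \<Longrightarrow> \<bar>f \<omega>\<bar> \<le> B"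
  shows "integrable M f"
  using assms by (intro integrable_const_bound[where B = B] AE_I2) auto

text \<open>A bounded factor known to the history is pulled out of the conditional expectation. Both
  probabilistic hypotheses, the fixed gaps and the sampling rule, are used in this integrated
  form.\<close>

lemma integral_cond_exp_eq:
  assumes Z: "Z \<in> borel_measurable (H p q)" "\<And>\<omega>. \<omega> \<in> space M \<Longrightarrow> \<bar>Z \<omega>\<bar> \<le> B"
    and g: "g \<in> borel_measurable M" "\<And>\<omega>. \<omega> \<in> space M \<Longrightarrow> \<bar>g \<omega>\<bar> \<le> 1"
    and ce: "AE \<omega> in M. real_cond_exp M (H p q) g \<omega> = h \<omega>" and h: "h \<in> borel_measurable M"
  shows "(\<integral>\<omega>. Z \<omega> * g \<omega> \<partial>M) = (\<integral>\<omega>. Z \<omega> * h \<omega> \<partial>M)"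
proof -
  interpret ce: sigma_finite_subalgebra M "H p q"
    by (rule cond_exp_history)
  note ZM = measurable_history_M[OF Z(1)]
  have "integrable M (\<lambda>\<omega>. Z \<omega> * g \<omega>)"
  proof (rule integrable_bounded)
    fix \<omega> assume \<omega>: "\<omega> \<in> space M"
    then have "\<bar>Z \<omega>\<bar> * \<bar>g \<omega>\<bar> \<le> B * 1"
      using Z(2)[OF \<omega>] g(2)[OF \<omega>] by (intro mult_mono) (auto intro: order_trans[OF abs_ge_zero])
    then show "\<bar>Z \<omega> * g \<omega>\<bar> \<le> B"
      by (simp add: abs_mult)
  qed (use ZM g in simp)
  then have "(\<integral>\<omega>. Z \<omega> * g \<omega> \<partial>M) = (\<integral>\<omega>. Z \<omega> * real_cond_exp M (H p q) g \<omega> \<partial>M)"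
    using Z g by (intro ce.real_cond_exp_intg(2)[symmetric]) auto
  also have "\<dots> = (\<integral>\<omega>. Z \<omega> * h \<omega> \<partial>M)"
    using ce ZM h by (intro integral_cong_AE) auto
  finally show ?thesis .
qed

end

locale constrained_bandit = bandit M I l
  for M :: "'w measure" and I :: "nat \<Rightarrow> 'w \<Rightarrow> 'k::finite" and l +
  fixes D :: "'k \<Rightarrow> 'k \<Rightarrow> real"
  assumes constrained: "stochastically_constrained M I l D"
begin

lemma integral_gap:
  assumes t: "t \<ge> 1" and Z: "Z \<in> borel_measurable (H (t - 1) (t - 1))" "\<And>\<omega>. \<omega> \<in> space M \<Longrightarrow> \<bar>Z \<omega>\<bar> \<le> B"
  shows "(\<integral>\<omega>. Z \<omega> * (l t \<omega> i - l t \<omega> j) \<partial>M) = D i j * (\<integral>\<omega>. Z \<omega> \<partial>M)"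
proof -
  have "(\<integral>\<omega>. Z \<omega> * (l t \<omega> i - l t \<omega> j) \<partial>M) = (\<integral>\<omega>. Z \<omega> * D i j \<partial>M)"
  proof (rule integral_cond_exp_eq[OF Z])
    show "\<bar>l t \<omega> i - l t \<omega> j\<bar> \<le> 1" if "\<omega> \<in> space M" for \<omega>
      using loss_range[OF t that, of i] loss_range[OF t that, of j] by auto
    show "AE \<omega> in M. real_cond_exp M (H (t - 1) (t - 1)) (\<lambda>\<omega>. l t \<omega> i - l t \<omega> j) \<omega> = D i j"
      using constrained t by (simp add: stochastically_constrained_def)
  qed (use loss_measurable[OF t] in auto)
  then show ?thesis by (simp add: mult.commute)
qed

lemma integrable_loss:
  assumes t: "t \<ge> 1"
  shows "integrable M (\<lambda>\<omega>. l t \<omega> i)"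
proof (rule integrable_bounded[OF loss_measurable[OF t]])
  show "\<bar>l t \<omega> i\<bar> \<le> 1" if "\<omega> \<in> space M" for \<omega>
    using loss_range[OF t that, of i] by auto
qed

lemma integral_loss_diff:
  assumes t: "t \<ge> 1"
  shows "(\<integral>\<omega>. l t \<omega> i \<partial>M) - (\<integral>\<omega>. l t \<omega> j \<partial>M) = D i j"
  using integral_gap[OF t, of "\<lambda>_. 1" 1 i j] integrable_loss[OF t] by (simp add: prob_space)

lemma integral_loss_range:
  assumes t: "t \<ge> 1"
  shows "0 \<le> (\<integral>\<omega>. l t \<omega> i \<partial>M)" "(\<integral>\<omega>. l t \<omega> i \<partial>M) \<le> 1"
proof -
  show "0 \<le> (\<integral>\<omega>. l t \<omega> i \<partial>M)"
    using loss_range[OF t] by (intro integral_nonneg_AE AE_I2) auto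
  have "(\<integral>\<omega>. l t \<omega> i \<partial>M) \<le> (\<integral>\<omega>. 1 \<partial>M)"
    using loss_range[OF t] integrable_loss[OF t] by (intro integral_mono) auto
  then show "(\<integral>\<omega>. l t \<omega> i \<partial>M) \<le> 1"
    by (simp add: prob_space)
qed

lemma gap_le_1: "D i j \<le> 1"
  using integral_loss_diff[of 1 i j] integral_loss_range(2)[of 1 i] integral_loss_range(1)[of 1 j] by simp

end

section \<open>Boundedness and measurability of the weights\<close>

locale tsallis_bandit = constrained_bandit M I l D + asym_gaps \<alpha> \<Delta> istar
  for M :: "'w measure" and I :: "nat \<Rightarrow> 'w \<Rightarrow> 'k::finite" and l D \<alpha>
    and \<Delta> :: "'k \<Rightarrow> real" and istar :: 'k +
  fixes w :: "nat \<Rightarrow> 'w \<Rightarrow> 'k \<Rightarrow> real"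
  assumes gaps: "\<Delta> = (\<lambda>i. D i istar)"
    and algorithm: "tsallis_inf M I l \<alpha> (asym_param \<alpha> \<Delta> istar) (learning_rate \<alpha>) w"
begin

abbreviation "est \<equiv> iw_estimate I l w"
abbreviation "cum \<equiv> iw_cum_estimate I l w"

lemma cum_0: "cum 0 \<omega> i = 0"
  by (simp add: iw_cum_estimate_def)

lemma cum_Suc: "cum (Suc t) \<omega> i = cum t \<omega> i + est (Suc t) \<omega> i"
  by (simp add: iw_cum_estimate_def)

lemma weights_arg_max:
  assumes "t \<ge> 1" "\<omega> \<in> space M"
  shows "w t \<omega> \<in> ftrl_domain \<alpha>"
    and "v \<in> ftrl_domain \<alpha> \<Longrightarrow>
      ftrl_obj \<alpha> (\<lambda>i. \<eta> t * \<xi> i) (cum (t - 1) \<omega>) (w t \<omega>) \<le> ftrl_obj \<alpha> (\<lambda>i. \<eta> t * \<xi> i) (cum (t - 1) \<omega>) v"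
proof -
  have "is_arg_max (\<lambda>v. ereal (\<Sum>i\<in>UNIV. v i * (- cum (t - 1) \<omega> i)) - tsallis_reg \<alpha> \<xi> v / ereal (\<eta> t))
      (\<lambda>v. v \<in> prob_simplex) (w t \<omega>)"
    using algorithm assms by (simp add: tsallis_inf_def \<xi>_def \<eta>_def)
  note arg_max_ftrl_obj[OF \<alpha>(1) rate_pos[OF assms(1)] param_pos this]
  then show "w t \<omega> \<in> ftrl_domain \<alpha>"
    and "v \<in> ftrl_domain \<alpha> \<Longrightarrow>
      ftrl_obj \<alpha> (\<lambda>i. \<eta> t * \<xi> i) (cum (t - 1) \<omega>) (w t \<omega>) \<le> ftrl_obj \<alpha> (\<lambda>i. \<eta> t * \<xi> i) (cum (t - 1) \<omega>) v"
    by auto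
qed

lemma weights_ge_of_cum_le:
  assumes t: "t \<ge> 1" and B: "\<And>\<omega> i. \<omega> \<in> space M \<Longrightarrow> 0 \<le> cum (t - 1) \<omega> i \<and> cum (t - 1) \<omega> i \<le> B"
  obtains b where "0 < b" "\<And>\<omega> i. \<omega> \<in> space M \<Longrightarrow> b \<le> w t \<omega> i"
proof -
  let ?e = "\<lambda>i. \<eta> t * \<xi> i"
  let ?b = "min (1 / real CARD('k)) (exp (- (sum ?e UNIV * (B
      + (- qlog \<alpha> (1 / (2 * real CARD('k)))) * (\<Sum>j\<in>UNIV. 1 / ?e j)))))"
  show thesis
  proof
    show "0 < ?b" by simp
    fix \<omega> i assume \<omega>: "\<omega> \<in> space M"
    show "?b \<le> w t \<omega> i"
      using \<alpha> rate_pos[OF t] param_pos B[OF \<omega>] weights_arg_max[OF t \<omega>]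
      by (intro ftrl_minimizer_ge[where L = "cum (t - 1) \<omega>"]) auto
  qed
qed

text \<open>Importance weighting divides by weights, so boundedness is not immediate. Inductively,
  bounded past estimates keep the next weights above some \<open>b > 0\<close>, hence the next
  estimate is at most \<open>1 / b\<close>. These bounds depend on \<open>t\<close> but not on
  \<open>\<omega>\<close>.\<close>

lemma cum_bounded: "\<exists>B. \<forall>\<omega>\<in>space M. \<forall>i. 0 \<le> cum t \<omega> i \<and> cum t \<omega> i \<le> B"
proof (induction t)
  case 0
  show ?case by (auto simp: cum_0)
next
  case (Suc t)
  then obtain B where B: "\<And>\<omega> i. \<omega> \<in> space M \<Longrightarrow> 0 \<le> cum t \<omega> i \<and> cum t \<omega> i \<le> B"
    by blast
  obtain b where b: "0 < b" "\<And>\<omega> i. \<omega> \<in> space M \<Longrightarrow> b \<le> w (Suc t) \<omega> i"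
    using weights_ge_of_cum_le[of "Suc t" B] B by auto
  have "0 \<le> est (Suc t) \<omega> i \<and> est (Suc t) \<omega> i \<le> 1 / b" if \<omega>: "\<omega> \<in> space M" for \<omega> i
    using loss_range[of "Suc t" \<omega> i] \<omega> b(1) b(2)[OF \<omega>, of i]
    by (auto simp: iw_estimate_def intro!: frac_le)
  with B have "\<forall>\<omega>\<in>space M. \<forall>i. 0 \<le> cum (Suc t) \<omega> i \<and> cum (Suc t) \<omega> i \<le> B + 1 / b"
    by (auto simp: cum_Suc intro!: add_mono)
  then show ?case by blast
qed

lemma cum_nonneg: "\<omega> \<in> space M \<Longrightarrow> 0 \<le> cum t \<omega> i"
  using cum_bounded[of t] by blast

lemma weights_ge:
  assumes t: "t \<ge> 1"
  obtains b where "0 < b" "\<And>\<omega> i. \<omega> \<in> space M \<Longrightarrow> b \<le> w t \<omega> i"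
proof -
  obtain B where "\<And>\<omega> i. \<omega> \<in> space M \<Longrightarrow> 0 \<le> cum (t - 1) \<omega> i \<and> cum (t - 1) \<omega> i \<le> B"
    using cum_bounded[of "t - 1"] by blast
  then show thesis
    using weights_ge_of_cum_le[OF t] that by metis
qed

lemma weights_simplex: "t \<ge> 1 \<Longrightarrow> \<omega> \<in> space M \<Longrightarrow> w t \<omega> \<in> prob_simplex"
  using weights_arg_max(1) by (simp add: ftrl_domain_def)

lemma weights_pos: "t \<ge> 1 \<Longrightarrow> \<omega> \<in> space M \<Longrightarrow> 0 < w t \<omega> i"
  by (meson weights_ge less_le_trans)

lemma weights_le_1: "t \<ge> 1 \<Longrightarrow> \<omega> \<in> space M \<Longrightarrow> w t \<omega> i \<le> 1"
  by (intro prob_simplex_le_one weights_simplex)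

lemma weights_ftrl_min:
  "t \<ge> 1 \<Longrightarrow> \<omega> \<in> space M \<Longrightarrow> ftrl_min \<alpha> (\<lambda>i. \<eta> t * \<xi> i) (cum (t - 1) \<omega>) (w t \<omega>)"
  using weights_simplex weights_pos weights_arg_max(2) by (simp add: ftrl_min_def ftrl_domain_def)

lemma weights_measurable_of_cum:
  assumes t: "t \<ge> 1" and cum: "\<And>j. (\<lambda>\<omega>. cum (t - 1) \<omega> j) \<in> borel_measurable (H (t - 1) (t - 1))"
  shows "(\<lambda>\<omega>. w t \<omega> i) \<in> borel_measurable (H (t - 1) (t - 1))"
proof (rule borel_measurable_Hoelder_comp[OF cum])
  let ?e = "\<lambda>i. \<eta> t * \<xi> i"
  have e: "0 < ?e i" for i
    using rate_pos[OF t] param_pos by simp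
  then show "0 \<le> sum ?e UNIV"
    by (intro sum_nonneg) (auto intro: less_imp_le)
  show "(w t x i - w t y i)\<^sup>2 \<le> sum ?e UNIV * (\<Sum>j\<in>UNIV. \<bar>cum (t - 1) x j - cum (t - 1) y j\<bar>)"
    if "x \<in> space (H (t - 1) (t - 1))" "y \<in> space (H (t - 1) (t - 1))" for x y
    using that by (intro ftrl_min_Hoelder[OF \<alpha>(2) e] weights_ftrl_min[OF t]) auto
qed

lemma est_measurable_of_weights:
  assumes t: "1 \<le> t" "t \<le> p" "t \<le> q" and w: "(\<lambda>\<omega>. w t \<omega> i) \<in> borel_measurable (H p q)"
  shows "(\<lambda>\<omega>. est t \<omega> i) \<in> borel_measurable (H p q)"
proof -
  note [measurable] = w action_measurable_history[OF t(1,2)] loss_measurable_history[OF t(1,3)]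
  show ?thesis
    unfolding iw_estimate_def by measurable
qed

text \<open>Estimates and weights alternate: the past estimates determine the next weights through
  \<open>ftrl_min_Hoelder\<close>, and these with the action and the loss determine the next
  estimate.\<close>

lemma cum_measurable: "(\<lambda>\<omega>. cum t \<omega> i) \<in> borel_measurable (H t t)"
proof (induction t arbitrary: i)
  case 0
  show ?case by (simp add: cum_0)
next
  case (Suc t)
  have sub: "subalgebra (H (Suc t) (Suc t)) (H t t)"
    by (intro subalgebra_history_mono) auto
  have "(\<lambda>\<omega>. w (Suc t) \<omega> i) \<in> borel_measurable (H t t)"
    using weights_measurable_of_cum[of "Suc t"] Suc by simp
  then have "(\<lambda>\<omega>. est (Suc t) \<omega> i) \<in> borel_measurable (H (Suc t) (Suc t))"
    by (intro est_measurable_of_weights measurable_from_subalg[OF sub]) auto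
  then show ?case
    unfolding cum_Suc by (rule borel_measurable_add[OF measurable_from_subalg[OF sub Suc]])
qed

lemma weights_measurable: "t \<ge> 1 \<Longrightarrow> (\<lambda>\<omega>. w t \<omega> i) \<in> borel_measurable (H (t - 1) (t - 1))"
  by (intro weights_measurable_of_cum cum_measurable)

lemma weights_measurable':
  assumes "t \<ge> 1"
  shows "(\<lambda>\<omega>. w t \<omega> i) \<in> borel_measurable (H (t - 1) t)"
  by (rule measurable_from_subalg[OF subalgebra_history_mono weights_measurable[OF assms]]) auto

text \<open>The conditioning includes the losses of round \<open>t\<close>, so \<open>Z\<close> may
  be the current loss or its ratio to the weight.\<close>

lemma integral_action:
  assumes t: "t \<ge> 1" and Z: "Z \<in> borel_measurable (H (t - 1) t)" "\<And>\<omega>. \<omega> \<in> space M \<Longrightarrow> \<bar>Z \<omega>\<bar> \<le> B"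
  shows "(\<integral>\<omega>. of_bool (I t \<omega> = i) * Z \<omega> \<partial>M) = (\<integral>\<omega>. w t \<omega> i * Z \<omega> \<partial>M)"
proof -
  have "(\<integral>\<omega>. Z \<omega> * of_bool (I t \<omega> = i) \<partial>M) = (\<integral>\<omega>. Z \<omega> * w t \<omega> i \<partial>M)"
  proof (rule integral_cond_exp_eq[OF Z])
    note [measurable] = action_measurable[OF t]
    show "(\<lambda>\<omega>. of_bool (I t \<omega> = i) :: real) \<in> borel_measurable M"
      by measurable
    show "AE \<omega> in M. real_cond_exp M (H (t - 1) t) (\<lambda>\<omega>. of_bool (I t \<omega> = i)) \<omega> = w t \<omega> i"
      using algorithm t by (simp add: tsallis_inf_def)
    show "(\<lambda>\<omega>. w t \<omega> i) \<in> borel_measurable M"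
      using weights_measurable[OF t] by (rule measurable_history_M)
  qed auto
  then show ?thesis by (simp add: mult.commute)
qed

lemma integrable_action:
  assumes t: "t \<ge> 1" and Z: "Z \<in> borel_measurable (H (t - 1) t)" "\<And>\<omega>. \<omega> \<in> space M \<Longrightarrow> \<bar>Z \<omega>\<bar> \<le> B"
  shows "integrable M (\<lambda>\<omega>. of_bool (I t \<omega> = i) * Z \<omega>)" "integrable M (\<lambda>\<omega>. w t \<omega> i * Z \<omega>)"
proof -
  note [measurable] = action_measurable[OF t] measurable_history_M[OF Z(1)]
    measurable_history_M[OF weights_measurable[OF t]]
  show "integrable M (\<lambda>\<omega>. of_bool (I t \<omega> = i) * Z \<omega>)"
  proof (rule integrable_bounded)
    show "(\<lambda>\<omega>. of_bool (I t \<omega> = i) * Z \<omega>) \<in> borel_measurable M" by measurable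
    show "\<bar>of_bool (I t \<omega> = i) * Z \<omega>\<bar> \<le> B" if "\<omega> \<in> space M" for \<omega>
      using Z(2)[OF that] by (cases "I t \<omega> = i") auto
  qed
  show "integrable M (\<lambda>\<omega>. w t \<omega> i * Z \<omega>)"
  proof (rule integrable_bounded)
    show "(\<lambda>\<omega>. w t \<omega> i * Z \<omega>) \<in> borel_measurable M" by measurable
    show "\<bar>w t \<omega> i * Z \<omega>\<bar> \<le> B" if "\<omega> \<in> space M" for \<omega>
    proof -
      have "w t \<omega> i * \<bar>Z \<omega>\<bar> \<le> 1 * B"
        using Z(2)[OF that] weights_pos[OF t that, of i] weights_le_1[OF t that, of i]
        by (intro mult_mono) (auto intro: less_imp_le)
      then show ?thesis
        using weights_pos[OF t that, of i] by (simp add: abs_mult)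
    qed
  qed
qed

lemma integrable_weights:
  assumes t: "t \<ge> 1"
  shows "integrable M (\<lambda>\<omega>. w t \<omega> i)"
  using integrable_action(2)[OF t, of "\<lambda>_. 1" 1 i] by simp

section \<open>Expected regret, stability and penalty\<close>

definition "reg t = (\<Sum>i\<in>others. \<Delta> i * (\<integral>\<omega>. w t \<omega> i \<partial>M))"

lemma reg_eq_integral: "t \<ge> 1 \<Longrightarrow> reg t = (\<integral>\<omega>. (\<Sum>i\<in>others. \<Delta> i * w t \<omega> i) \<partial>M)"
  unfolding reg_def using integrable_weights by (subst Bochner_Integration.integral_sum) auto

lemma integrable_gap_sum: "t \<ge> 1 \<Longrightarrow> integrable M (\<lambda>\<omega>. \<Sum>i\<in>others. \<Delta> i * w t \<omega> i)"
  using integrable_weights by (intro Bochner_Integration.integrable_sum integrable_mult_right) auto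

lemma gap_nonneg: "0 \<le> \<Delta> i"
  using gap_istar gap_pos by (cases "i = istar") (auto intro: less_imp_le)

lemma reg_bounds:
  assumes t: "t \<ge> 1"
  shows "0 \<le> reg t" "reg t \<le> 1"
proof -
  show "0 \<le> reg t"
    unfolding reg_def using weights_pos[OF t] gap_nonneg
    by (intro sum_nonneg mult_nonneg_nonneg integral_nonneg_AE AE_I2) (auto intro: less_imp_le)
  have "reg t \<le> (\<integral>\<omega>. 1 \<partial>M)"
    unfolding reg_eq_integral[OF t]
  proof (rule integral_mono[OF integrable_gap_sum[OF t]])
    fix \<omega> assume \<omega>: "\<omega> \<in> space M"
    have "(\<Sum>i\<in>others. \<Delta> i * w t \<omega> i) \<le> (\<Sum>i\<in>others. 1 * w t \<omega> i)"
      using gap_le_one weights_pos[OF t \<omega>] by (intro sum_mono mult_right_mono) (auto intro: less_imp_le)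
    also have "\<dots> \<le> (\<Sum>i\<in>UNIV. 1 * w t \<omega> i)"
      using weights_pos[OF t \<omega>] by (intro sum_mono2) (auto intro: less_imp_le)
    also have "\<dots> = 1"
      using weights_simplex[OF t \<omega>] by (simp add: prob_simplex_def)
    finally show "(\<Sum>i\<in>others. \<Delta> i * w t \<omega> i) \<le> 1" .
  qed simp
  then show "reg t \<le> 1"
    by (simp add: prob_space)
qed

lemma loss_of_action: "l t \<omega> (I t \<omega>) = (\<Sum>i\<in>UNIV. of_bool (I t \<omega> = i) * l t \<omega> i)"
  by (subst sum.remove[of UNIV "I t \<omega>"]) (auto intro: sum.neutral)

lemma loss_bounded_history:
  assumes t: "t \<ge> 1"
  shows "(\<lambda>\<omega>. l t \<omega> i) \<in> borel_measurable (H (t - 1) t)" "\<omega> \<in> space M \<Longrightarrow> \<bar>l t \<omega> i\<bar> \<le> 1"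
  using loss_measurable_history[of t t i "t - 1"] loss_range[OF t, of \<omega> i] t by auto

lemma integrable_loss_of_action:
  assumes t: "t \<ge> 1"
  shows "integrable M (\<lambda>\<omega>. l t \<omega> (I t \<omega>))"
  unfolding loss_of_action
  by (intro Bochner_Integration.integrable_sum integrable_action(1)[OF t loss_bounded_history[OF t]])

text \<open>Two conditionings: given the current losses, the action is replaced by the weights;
  given the past, to which the weights belong, loss differences become gaps.\<close>

lemma integral_loss_of_action:
  assumes t: "t \<ge> 1"
  shows "(\<integral>\<omega>. l t \<omega> (I t \<omega>) \<partial>M) - (\<integral>\<omega>. l t \<omega> istar \<partial>M) = reg t"
proof -
  note Z = loss_bounded_history[OF t]
  have one: "(\<Sum>i\<in>UNIV. w t \<omega> i) = 1" if "\<omega> \<in> space M" for \<omega>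
    using weights_simplex[OF t that] by (simp add: prob_simplex_def)
  have "(\<integral>\<omega>. l t \<omega> (I t \<omega>) \<partial>M) = (\<Sum>i\<in>UNIV. \<integral>\<omega>. w t \<omega> i * l t \<omega> i \<partial>M)"
    unfolding loss_of_action
    by (subst Bochner_Integration.integral_sum) (auto simp: integral_action[OF t Z] intro: integrable_action(1)[OF t Z])
  moreover have "(\<integral>\<omega>. l t \<omega> istar \<partial>M) = (\<integral>\<omega>. (\<Sum>i\<in>UNIV. w t \<omega> i * l t \<omega> istar) \<partial>M)"
    using one by (intro Bochner_Integration.integral_cong) (auto simp flip: sum_distrib_right)
  moreover have "\<dots> = (\<Sum>i\<in>UNIV. \<integral>\<omega>. w t \<omega> i * l t \<omega> istar \<partial>M)"
    by (intro Bochner_Integration.integral_sum integrable_action(2)[OF t Z])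
  ultimately have "(\<integral>\<omega>. l t \<omega> (I t \<omega>) \<partial>M) - (\<integral>\<omega>. l t \<omega> istar \<partial>M)
      = (\<Sum>i\<in>UNIV. (\<integral>\<omega>. w t \<omega> i * l t \<omega> i \<partial>M) - (\<integral>\<omega>. w t \<omega> i * l t \<omega> istar \<partial>M))"
    by (simp add: sum_subtractf)
  also have "\<dots> = (\<Sum>i\<in>UNIV. \<Delta> i * (\<integral>\<omega>. w t \<omega> i \<partial>M))"
  proof (rule sum.cong)
    fix i
    have "(\<integral>\<omega>. w t \<omega> i * l t \<omega> i \<partial>M) - (\<integral>\<omega>. w t \<omega> i * l t \<omega> istar \<partial>M)
        = (\<integral>\<omega>. w t \<omega> i * (l t \<omega> i - l t \<omega> istar) \<partial>M)"
      using integrable_action(2)[OF t Z, of i] by (simp add: right_diff_distrib)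
    also have "\<dots> = D i istar * (\<integral>\<omega>. w t \<omega> i \<partial>M)"
      using weights_pos[OF t] weights_le_1[OF t]
      by (intro integral_gap[OF t weights_measurable[OF t], where B = 1]) (auto intro: less_imp_le simp: abs_of_pos)
    finally show "(\<integral>\<omega>. w t \<omega> i * l t \<omega> i \<partial>M) - (\<integral>\<omega>. w t \<omega> i * l t \<omega> istar \<partial>M)
        = \<Delta> i * (\<integral>\<omega>. w t \<omega> i \<partial>M)"
      by (simp add: gaps)
  qed simp
  also have "\<dots> = reg t"
    using gap_istar by (simp add: reg_def sum.remove[of UNIV istar])
  finally show ?thesis .
qed

lemma loss_ratio_bounded_history:
  assumes t: "t \<ge> 1"
  obtains B where "(\<lambda>\<omega>. l t \<omega> i / w t \<omega> i) \<in> borel_measurable (H (t - 1) t)"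
    "\<And>\<omega>. \<omega> \<in> space M \<Longrightarrow> \<bar>l t \<omega> i / w t \<omega> i\<bar> \<le> B"
proof -
  obtain b where b: "0 < b" "\<And>\<omega> i. \<omega> \<in> space M \<Longrightarrow> b \<le> w t \<omega> i"
    using weights_ge[OF t] by metis
  show thesis
  proof
    show "(\<lambda>\<omega>. l t \<omega> i / w t \<omega> i) \<in> borel_measurable (H (t - 1) t)"
      by (intro borel_measurable_divide loss_bounded_history[OF t] weights_measurable'[OF t])
    show "\<bar>l t \<omega> i / w t \<omega> i\<bar> \<le> 1 / b" if "\<omega> \<in> space M" for \<omega>
      using loss_range[OF t that, of i] b(1) b(2)[OF that, of i]
      by (auto simp: abs_of_nonneg intro!: frac_le)
  qed
qed

lemma est_integral:
  assumes t: "t \<ge> 1"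
  shows "integrable M (\<lambda>\<omega>. est t \<omega> i)" "(\<integral>\<omega>. est t \<omega> i \<partial>M) = (\<integral>\<omega>. l t \<omega> i \<partial>M)"
proof -
  obtain B where Z: "(\<lambda>\<omega>. l t \<omega> i / w t \<omega> i) \<in> borel_measurable (H (t - 1) t)"
    "\<And>\<omega>. \<omega> \<in> space M \<Longrightarrow> \<bar>l t \<omega> i / w t \<omega> i\<bar> \<le> B"
    using loss_ratio_bounded_history[OF t] by metis
  show "integrable M (\<lambda>\<omega>. est t \<omega> i)"
    using integrable_action(1)[OF t Z] by (simp add: iw_estimate_def)
  have "(\<integral>\<omega>. est t \<omega> i \<partial>M) = (\<integral>\<omega>. w t \<omega> i * (l t \<omega> i / w t \<omega> i) \<partial>M)"
    using integral_action[OF t Z] by (simp add: iw_estimate_def)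
  also have "\<dots> = (\<integral>\<omega>. l t \<omega> i \<partial>M)"
    using weights_pos[OF t] by (intro Bochner_Integration.integral_cong) (auto simp: less_imp_neq[symmetric])
  finally show "(\<integral>\<omega>. est t \<omega> i \<partial>M) = (\<integral>\<omega>. l t \<omega> i \<partial>M)" .
qed

text \<open>Weighting the estimates by \<open>w t\<close> recovers the suffered loss pointwise, and
  for a fixed \<open>u\<close> they are unbiased. As \<open>u\<close> need not be the vertex at
  \<open>istar\<close>, its own expected gap is subtracted.\<close>

lemma estimated_regret_integral:
  assumes t: "t \<ge> 1" and u: "u \<in> prob_simplex"
  shows "integrable M (\<lambda>\<omega>. \<Sum>i\<in>UNIV. (w t \<omega> i - u i) * est t \<omega> i)"
    and "(\<integral>\<omega>. (\<Sum>i\<in>UNIV. (w t \<omega> i - u i) * est t \<omega> i) \<partial>M) = reg t - (\<Sum>i\<in>UNIV. u i * \<Delta> i)"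
proof -
  have eq: "(\<Sum>i\<in>UNIV. (w t \<omega> i - u i) * est t \<omega> i)
      = l t \<omega> (I t \<omega>) - (\<Sum>i\<in>UNIV. u i * est t \<omega> i)" if \<omega>: "\<omega> \<in> space M" for \<omega>
  proof -
    have "w t \<omega> i * est t \<omega> i = of_bool (I t \<omega> = i) * l t \<omega> i" for i
      using weights_pos[OF t \<omega>, of i] by (simp add: iw_estimate_def)
    then show ?thesis
      unfolding loss_of_action by (simp add: left_diff_distrib sum_subtractf)
  qed
  have int: "integrable M (\<lambda>\<omega>. l t \<omega> (I t \<omega>) - (\<Sum>i\<in>UNIV. u i * est t \<omega> i))"
    using est_integral(1)[OF t] integrable_loss_of_action[OF t]
    by (intro Bochner_Integration.integrable_diff Bochner_Integration.integrable_sum integrable_mult_right) auto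
  then show "integrable M (\<lambda>\<omega>. \<Sum>i\<in>UNIV. (w t \<omega> i - u i) * est t \<omega> i)"
    using eq by (subst Bochner_Integration.integrable_cong[OF refl]) auto
  have "(\<integral>\<omega>. (\<Sum>i\<in>UNIV. (w t \<omega> i - u i) * est t \<omega> i) \<partial>M)
      = (\<integral>\<omega>. l t \<omega> (I t \<omega>) - (\<Sum>i\<in>UNIV. u i * est t \<omega> i) \<partial>M)"
    using eq by (intro Bochner_Integration.integral_cong) auto
  also have "\<dots> = (\<integral>\<omega>. l t \<omega> (I t \<omega>) \<partial>M) - (\<Sum>i\<in>UNIV. u i * (\<integral>\<omega>. l t \<omega> i \<partial>M))"
    using est_integral[OF t] integrable_loss_of_action[OF t]
    by (subst Bochner_Integration.integral_diff) (auto intro!: Bochner_Integration.integrable_sum integrable_mult_right)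
  also have "(\<Sum>i\<in>UNIV. u i * (\<integral>\<omega>. l t \<omega> i \<partial>M))
      = (\<Sum>i\<in>UNIV. u i * ((\<integral>\<omega>. l t \<omega> istar \<partial>M) + \<Delta> i))"
  proof (rule sum.cong)
    fix i
    have "(\<integral>\<omega>. l t \<omega> i \<partial>M) = (\<integral>\<omega>. l t \<omega> istar \<partial>M) + \<Delta> i"
      using integral_loss_diff[OF t, of i istar] by (simp add: gaps)
    then show "u i * (\<integral>\<omega>. l t \<omega> i \<partial>M) = u i * ((\<integral>\<omega>. l t \<omega> istar \<partial>M) + \<Delta> i)"
      by simp
  qed simp
  also have "\<dots> = (\<integral>\<omega>. l t \<omega> istar \<partial>M) + (\<Sum>i\<in>UNIV. u i * \<Delta> i)"
    using u by (simp add: distrib_left sum.distrib prob_simplex_def flip: sum_distrib_right)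
  finally show "(\<integral>\<omega>. (\<Sum>i\<in>UNIV. (w t \<omega> i - u i) * est t \<omega> i) \<partial>M) = reg t - (\<Sum>i\<in>UNIV. u i * \<Delta> i)"
    using integral_loss_of_action[OF t] by simp
qed

lemma stab_bound_integral:
  assumes t: "t \<ge> 1"
  shows "integrable M (\<lambda>\<omega>. stab_bound t (I t \<omega>) (w t \<omega>))"
    and "(\<integral>\<omega>. stab_bound t (I t \<omega>) (w t \<omega>) \<partial>M)
      \<le> (\<Sum>i\<in>others. 2 * \<alpha> * c t / (real t * \<Delta> i)) + (if real t < T1 then \<theta> t * \<delta> / 8 else 0)
        + (1/8 + (if real t < T1 then 0 else 1/2 - \<alpha> / 4)) * reg t"
proof -
  obtain b where b: "0 < b" "\<And>\<omega> i. \<omega> \<in> space M \<Longrightarrow> b \<le> w t \<omega> i"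
    using weights_ge[OF t] by metis
  have meas: "(\<lambda>\<omega>. stab_bound t j (w t \<omega>)) \<in> borel_measurable (H (t - 1) t)" for j
  proof -
    note [measurable] = weights_measurable'[OF t]
    show ?thesis
      unfolding stab_bound_def by measurable
  qed
  have e: "0 \<le> \<eta> t * \<xi> i" for i
    using rate_pos[OF t] param_pos[of i] by simp
  \<comment> \<open>A crude deterministic bound for integrability, finite because the weights stay
    above \<open>b\<close>.\<close>
  define B where "B = (\<Sum>i\<in>UNIV. \<kappa>\<^sup>2 / 2 * (\<eta> t * \<xi> i)) / b\<^sup>2 + (\<Sum>i\<in>UNIV. 1/2 * (\<eta> t * \<xi> i)) * b powr (- \<alpha>)"
  have bound: "\<bar>stab_bound t j (w t \<omega>)\<bar> \<le> B" if \<omega>: "\<omega> \<in> space M" for j \<omega>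
  proof -
    note wb = weights_pos[OF t \<omega>] weights_le_1[OF t \<omega>] b(2)[OF \<omega>]
    have 1: "(\<Sum>i\<in>others. \<kappa>\<^sup>2 / 2 * (\<eta> t * \<xi> i) * w t \<omega> i powr (2 - \<alpha>)) / (w t \<omega> istar)\<^sup>2
        \<le> (\<Sum>i\<in>UNIV. \<kappa>\<^sup>2 / 2 * (\<eta> t * \<xi> i)) / b\<^sup>2"
    proof (rule frac_le)
      have "(\<Sum>i\<in>others. \<kappa>\<^sup>2 / 2 * (\<eta> t * \<xi> i) * w t \<omega> i powr (2 - \<alpha>))
          \<le> (\<Sum>i\<in>others. \<kappa>\<^sup>2 / 2 * (\<eta> t * \<xi> i) * 1)"
      proof (intro sum_mono mult_left_mono)
        fix i
        show "w t \<omega> i powr (2 - \<alpha>) \<le> 1"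
          using wb(1,2)[of i] \<alpha> by (intro powr_le1) auto
        show "0 \<le> \<kappa>\<^sup>2 / 2 * (\<eta> t * \<xi> i)"
          using e[of i] by simp
      qed
      also have "\<dots> \<le> (\<Sum>i\<in>UNIV. \<kappa>\<^sup>2 / 2 * (\<eta> t * \<xi> i) * 1)"
        using e by (intro sum_mono2) auto
      finally show "(\<Sum>i\<in>others. \<kappa>\<^sup>2 / 2 * (\<eta> t * \<xi> i) * w t \<omega> i powr (2 - \<alpha>))
          \<le> (\<Sum>i\<in>UNIV. \<kappa>\<^sup>2 / 2 * (\<eta> t * \<xi> i))" by simp
      show "0 \<le> (\<Sum>i\<in>UNIV. \<kappa>\<^sup>2 / 2 * (\<eta> t * \<xi> i))"
        using e by (intro sum_nonneg) auto
      show "0 < b\<^sup>2" "b\<^sup>2 \<le> (w t \<omega> istar)\<^sup>2"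
        using b(1) wb(3) by (auto intro!: power_mono)
    qed
    have 2: "1/2 * (\<eta> t * \<xi> j) * w t \<omega> j powr (- \<alpha>) \<le> (\<Sum>i\<in>UNIV. 1/2 * (\<eta> t * \<xi> i)) * b powr (- \<alpha>)"
    proof (rule mult_mono)
      show "1/2 * (\<eta> t * \<xi> j) \<le> (\<Sum>i\<in>UNIV. 1/2 * (\<eta> t * \<xi> i))"
        using e by (intro member_le_sum) auto
      show "w t \<omega> j powr (- \<alpha>) \<le> b powr (- \<alpha>)"
        using \<alpha> b(1) wb(3) by (intro powr_mono2') auto
      show "0 \<le> (\<Sum>i\<in>UNIV. 1/2 * (\<eta> t * \<xi> i))"
        using e by (intro sum_nonneg) auto
    qed simp
    have 3: "0 \<le> (\<Sum>i\<in>UNIV. \<kappa>\<^sup>2 / 2 * (\<eta> t * \<xi> i)) / b\<^sup>2"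
      "0 \<le> (\<Sum>i\<in>UNIV. 1/2 * (\<eta> t * \<xi> i)) * b powr (- \<alpha>)"
      using e by (auto intro!: divide_nonneg_nonneg mult_nonneg_nonneg[of _ "_ powr _"] sum_nonneg)
    have "0 \<le> stab_bound t j (w t \<omega>)"
      unfolding stab_bound_def using e
      by (auto intro!: divide_nonneg_nonneg mult_nonneg_nonneg[of _ "_ powr _"] sum_nonneg)
    moreover have "stab_bound t j (w t \<omega>) \<le> B"
      unfolding stab_bound_def B_def using 1 2 3 by (auto simp del: times_divide_eq_left)
    ultimately show ?thesis by simp
  qed
  have eq: "stab_bound t (I t \<omega>) (w t \<omega>)
      = (\<Sum>j\<in>UNIV. of_bool (I t \<omega> = j) * stab_bound t j (w t \<omega>))" for \<omega>
    by (subst sum.remove[of UNIV "I t \<omega>"]) (auto intro: sum.neutral)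
  show "integrable M (\<lambda>\<omega>. stab_bound t (I t \<omega>) (w t \<omega>))"
    unfolding eq by (intro Bochner_Integration.integrable_sum integrable_action(1)[OF t meas bound])
  have "(\<integral>\<omega>. stab_bound t (I t \<omega>) (w t \<omega>) \<partial>M)
      = (\<Sum>j\<in>UNIV. \<integral>\<omega>. w t \<omega> j * stab_bound t j (w t \<omega>) \<partial>M)"
    unfolding eq
    by (subst Bochner_Integration.integral_sum)
       (auto simp: integral_action[OF t meas bound] intro: integrable_action(1)[OF t meas bound])
  also have "\<dots> = (\<integral>\<omega>. (\<Sum>j\<in>UNIV. w t \<omega> j * stab_bound t j (w t \<omega>)) \<partial>M)"
    by (intro Bochner_Integration.integral_sum[symmetric] integrable_action(2)[OF t meas bound])
  also have "\<dots> \<le> (\<integral>\<omega>. (\<Sum>i\<in>others. 2 * \<alpha> * c t / (real t * \<Delta> i))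
        + (if real t < T1 then \<theta> t * \<delta> / 8 else 0)
        + (1/8 + (if real t < T1 then 0 else 1/2 - \<alpha> / 4)) * (\<Sum>i\<in>others. \<Delta> i * w t \<omega> i) \<partial>M)"
    using integrable_weights[OF t] weights_simplex[OF t] weights_pos[OF t]
    by (intro integral_mono weighted_stab_bound_le[OF t] Bochner_Integration.integrable_sum
        integrable_action(2)[OF t meas bound] Bochner_Integration.integrable_add integrable_mult_right) auto
  also have "\<dots> = (\<Sum>i\<in>others. 2 * \<alpha> * c t / (real t * \<Delta> i)) + (if real t < T1 then \<theta> t * \<delta> / 8 else 0)
        + (1/8 + (if real t < T1 then 0 else 1/2 - \<alpha> / 4)) * reg t"
    using integrable_gap_sum[OF t] by (simp add: reg_eq_integral[OF t] prob_space)
  finally show "(\<integral>\<omega>. stab_bound t (I t \<omega>) (w t \<omega>) \<partial>M) \<le> \<dots>" .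
qed

lemma cum_integral:
  shows "integrable M (\<lambda>\<omega>. cum t \<omega> i)" "(\<integral>\<omega>. cum t \<omega> i \<partial>M) \<le> real t"
proof -
  show "integrable M (\<lambda>\<omega>. cum t \<omega> i)"
    unfolding iw_cum_estimate_def by (intro Bochner_Integration.integrable_sum est_integral(1)) auto
  have "(\<integral>\<omega>. cum t \<omega> i \<partial>M) = (\<Sum>s=1..t. \<integral>\<omega>. l s \<omega> i \<partial>M)"
    unfolding iw_cum_estimate_def
    by (subst Bochner_Integration.integral_sum) (auto simp: est_integral)
  also have "\<dots> \<le> (\<Sum>s=1..t. 1)"
    using integral_loss_range(2) by (intro sum_mono) auto
  finally show "(\<integral>\<omega>. cum t \<omega> i \<partial>M) \<le> real t" by simp
qed

definition penalty_const :: "nat \<Rightarrow> nat \<Rightarrow> real" where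
  "penalty_const T t =
     (if t = 1 then (\<Sum>i\<in>others. 32/5 * ln (real T) / \<Delta> i)
      else (\<Sum>i\<in>others. 32/5 / (real (t - 1) * \<Delta> i))) + star_penalty T t"

text \<open>An integrable majorant spares the study of the penalty as a random variable. Where the
  rate increases, the comparator's estimated loss has mean at most \<open>t - 1\<close>, which turns
  \<open>32/5 / (t - 1)\<^sup>2\<close> into \<open>32/5 / (t - 1)\<close>; this fits under the
  bound for decreasing rates because \<open>1 / \<Delta> i \<ge> 1\<close>.\<close>

lemma penalty_expectation_le:
  assumes t: "1 \<le> t" "t \<le> T" and T: "2 * Kr \<le> real T"
  obtains f where "integrable M f" "\<And>\<omega>. \<omega> \<in> space M \<Longrightarrow> penalty T t (w t \<omega>) \<le> f \<omega>"
    "(\<integral>\<omega>. f \<omega> \<partial>M) \<le> penalty_const T t + \<alpha> * (\<alpha> + 1 / c t) / 4 * reg t"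
proof -
  let ?a = "\<alpha> * (\<alpha> + 1 / c t) / 4"
  have a: "0 \<le> ?a * reg t"
    using \<alpha> rate_factor_le(1)[OF \<alpha>, of t] reg_bounds[OF t(1)] by simp
  consider "t = 1" | "2 \<le> t" "0 \<le> inv_rate_step \<eta> t" | "2 \<le> t" "inv_rate_step \<eta> t < 0"
    using t by linarith
  then show thesis
  proof cases
    case 1
    show thesis
    proof (rule that[of "\<lambda>_. penalty_const T t"])
      show "penalty T t (w t \<omega>) \<le> penalty_const T t" if "\<omega> \<in> space M" for \<omega>
        using penalty_first_le[of T "w t \<omega>"] 1 t T weights_simplex[OF t(1) that] weights_pos[OF t(1) that]
        by (simp add: penalty_const_def)
    qed (use a in \<open>simp_all add: prob_space\<close>)
  next
    case 2
    show thesis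
    proof (rule that[of "\<lambda>\<omega>. penalty_const T t + ?a * (\<Sum>i\<in>others. \<Delta> i * w t \<omega> i)"])
      show "penalty T t (w t \<omega>) \<le> penalty_const T t + ?a * (\<Sum>i\<in>others. \<Delta> i * w t \<omega> i)"
        if "\<omega> \<in> space M" for \<omega>
        using penalty_le[OF 2(1) t(2) T weights_simplex[OF t(1) that] weights_pos[OF t(1) that] 2(2)] 2(1)
        by (simp add: penalty_const_def)
    qed (use integrable_gap_sum[OF t(1)] in \<open>simp_all add: prob_space reg_eq_integral[OF t(1)]\<close>)
  next
    case 3
    define s where "s = real (t - 1)"
    have s: "1 \<le> s"
      using 3 by (simp add: s_def)
    let ?f = "\<lambda>\<omega>. 32/5 / s\<^sup>2 * (\<Sum>i\<in>UNIV. comparator T i * cum (t - 1) \<omega> i)"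
    show thesis
    proof (rule that[of ?f])
      show "integrable M ?f"
        using cum_integral by (intro integrable_mult_right Bochner_Integration.integrable_sum) auto
      show "penalty T t (w t \<omega>) \<le> ?f \<omega>" if "\<omega> \<in> space M" for \<omega>
        unfolding s_def using 3 T weights_ftrl_min[OF t(1) that] cum_nonneg[OF that]
        by (intro penalty_le_of_decreasing) auto
      have "(\<integral>\<omega>. ?f \<omega> \<partial>M) = 32/5 / s\<^sup>2 * (\<Sum>i\<in>UNIV. comparator T i * (\<integral>\<omega>. cum (t - 1) \<omega> i \<partial>M))"
        using cum_integral(1) by simp
      also have "\<dots> \<le> 32/5 / s\<^sup>2 * (\<Sum>i\<in>UNIV. comparator T i * s)"
        unfolding s_def using comparator_props(2)[OF T] cum_integral(2)
        by (intro mult_left_mono sum_mono) (auto intro: less_imp_le)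
      also have "(\<Sum>i\<in>UNIV. comparator T i * s) = s"
        using comparator_props(1)[OF T] by (simp add: prob_simplex_def flip: sum_distrib_right)
      also have "32/5 / s\<^sup>2 * s = 32/5 / s"
        using s by (simp add: power2_eq_square)
      also have "\<dots> \<le> 32/5 / s * Kr"
        using s Kr_ge mult_left_mono[of 1 Kr "32/5 / s"] by simp
      also have "\<dots> \<le> 32/5 / s * (\<Sum>i\<in>others. 1 / \<Delta> i)"
        using s Kr_le_sum_inverse by (intro mult_left_mono) auto
      also have "\<dots> = (\<Sum>i\<in>others. 32/5 / (s * \<Delta> i))"
        by (simp add: sum_distrib_left mult.assoc)
      finally have "(\<integral>\<omega>. ?f \<omega> \<partial>M) \<le> (\<Sum>i\<in>others. 32/5 / (s * \<Delta> i))" .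
      moreover have "penalty_const T t = (\<Sum>i\<in>others. 32/5 / (s * \<Delta> i)) + star_penalty T t"
        using 3 by (simp add: penalty_const_def s_def)
      ultimately show "(\<integral>\<omega>. ?f \<omega> \<partial>M) \<le> penalty_const T t + ?a * reg t"
        using a star_penalty_nonneg[of T t] by linarith
    qed
  qed
qed

lemma regret_inequality:
  assumes T: "2 * Kr \<le> real T"
  shows "(\<Sum>t\<in>{1..<T}. reg t - (\<Sum>i\<in>UNIV. comparator T i * \<Delta> i))
    \<le> (\<Sum>t\<in>{1..<T}. (\<Sum>i\<in>others. 2 * \<alpha> * c t / (real t * \<Delta> i)) + (if real t < T1 then \<theta> t * \<delta> / 8 else 0)
        + (1/8 + (if real t < T1 then 0 else 1/2 - \<alpha> / 4)) * reg t)
      + (\<Sum>t=1..T. penalty_const T t + \<alpha> * (\<alpha> + 1 / c t) / 4 * reg t)"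
proof -
  have T1: "1 \<le> T"
    using T Kr_ge by (cases T) auto
  let ?u = "comparator T"
  have "\<exists>f. integrable M f \<and> (\<forall>\<omega>\<in>space M. penalty T t (w t \<omega>) \<le> f \<omega>) \<and>
      (\<integral>\<omega>. f \<omega> \<partial>M) \<le> penalty_const T t + \<alpha> * (\<alpha> + 1 / c t) / 4 * reg t" if "t \<in> {1..T}" for t
    using penalty_expectation_le[of t T] that T by (metis atLeastAtMost_iff)
  then obtain f where f: "\<And>t. t \<in> {1..T} \<Longrightarrow> integrable M (f t)"
      "\<And>t \<omega>. t \<in> {1..T} \<Longrightarrow> \<omega> \<in> space M \<Longrightarrow> penalty T t (w t \<omega>) \<le> f t \<omega>"
      "\<And>t. t \<in> {1..T} \<Longrightarrow> (\<integral>\<omega>. f t \<omega> \<partial>M) \<le> penalty_const T t + \<alpha> * (\<alpha> + 1 / c t) / 4 * reg t"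
    by metis
  note u = comparator_props[OF T]
  have "(\<Sum>t\<in>{1..<T}. reg t - (\<Sum>i\<in>UNIV. ?u i * \<Delta> i))
      = (\<Sum>t\<in>{1..<T}. \<integral>\<omega>. (\<Sum>i\<in>UNIV. (w t \<omega> i - ?u i) * est t \<omega> i) \<partial>M)"
    using estimated_regret_integral(2)[OF _ u(1)] by (intro sum.cong) auto
  also have "\<dots> = (\<integral>\<omega>. (\<Sum>t\<in>{1..<T}. \<Sum>i\<in>UNIV. (w t \<omega> i - ?u i) * est t \<omega> i) \<partial>M)"
    by (rule Bochner_Integration.integral_sum[symmetric]) (simp add: estimated_regret_integral(1)[OF _ u(1)])
  also have "\<dots> \<le> (\<integral>\<omega>. (\<Sum>t\<in>{1..<T}. stab_bound t (I t \<omega>) (w t \<omega>)) + (\<Sum>t=1..T. f t \<omega>) \<partial>M)"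
  proof (rule integral_mono)
    show "integrable M (\<lambda>\<omega>. \<Sum>t\<in>{1..<T}. \<Sum>i\<in>UNIV. (w t \<omega> i - ?u i) * est t \<omega> i)"
      by (rule Bochner_Integration.integrable_sum) (simp add: estimated_regret_integral(1)[OF _ u(1)])
    show "integrable M (\<lambda>\<omega>. (\<Sum>t\<in>{1..<T}. stab_bound t (I t \<omega>) (w t \<omega>)) + (\<Sum>t=1..T. f t \<omega>))"
      using stab_bound_integral(1) f(1)
      by (intro Bochner_Integration.integrable_add Bochner_Integration.integrable_sum) auto
    fix \<omega> assume \<omega>: "\<omega> \<in> space M"
    have "(\<Sum>t\<in>{1..<T}. \<Sum>i\<in>UNIV. (w t \<omega> i - ?u i) * est t \<omega> i)
        \<le> (\<Sum>t\<in>{1..<T}. stability \<alpha> (\<lambda>i. \<eta> t * \<xi> i) (est t \<omega>) (w t \<omega>) (w (Suc t) \<omega>))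
          + (\<Sum>t=1..T. inv_rate_step \<eta> t * (\<Sum>i\<in>UNIV. (tent \<alpha> (w t \<omega> i) - tent \<alpha> (?u i)) / \<xi> i))"
    proof (rule ftrl_regret[OF \<alpha>(2) param_pos rate_pos _ u(1,2) T1])
      fix t :: nat assume "t \<ge> 1"
      then show "ftrl_min \<alpha> (\<lambda>i. \<eta> t * \<xi> i) (\<lambda>i. \<Sum>s=1..t-1. est s \<omega> i) (w t \<omega>)"
        using weights_ftrl_min[OF _ \<omega>, of t] by (simp add: iw_cum_estimate_def[abs_def])
    qed
    also have "\<dots> \<le> (\<Sum>t\<in>{1..<T}. stab_bound t (I t \<omega>) (w t \<omega>)) + (\<Sum>t=1..T. f t \<omega>)"
    proof (intro add_mono sum_mono)
      fix t assume "t \<in> {1..<T}"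
      then have t: "1 \<le> t" "1 \<le> Suc t" by auto
      show "stability \<alpha> (\<lambda>i. \<eta> t * \<xi> i) (est t \<omega>) (w t \<omega>) (w (Suc t) \<omega>) \<le> stab_bound t (I t \<omega>) (w t \<omega>)"
      proof -
        \<comment> \<open>The estimate vanishes off the played arm, so one scalar loss can stand in
          every coordinate.\<close>
        have "est t \<omega> = (\<lambda>i. of_bool (I t \<omega> = i) * l t \<omega> (I t \<omega>) / w t \<omega> i)"
          by (auto simp: iw_estimate_def fun_eq_iff)
        then show ?thesis
          using stability_le_stab_bound[OF t(1) weights_simplex[OF t(1) \<omega>] weights_pos[OF t(1) \<omega>]
              weights_simplex[OF t(2) \<omega>] weights_pos[OF t(2) \<omega>], of "l t \<omega> (I t \<omega>)" "I t \<omega>"]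
            loss_range[OF t(1) \<omega>] by simp
      qed
    next
      fix t assume "t \<in> {1..T}"
      then show "inv_rate_step \<eta> t * (\<Sum>i\<in>UNIV. (tent \<alpha> (w t \<omega> i) - tent \<alpha> (?u i)) / \<xi> i) \<le> f t \<omega>"
        using f(2)[OF _ \<omega>] by (simp add: penalty_def)
    qed
    finally show "(\<Sum>t\<in>{1..<T}. \<Sum>i\<in>UNIV. (w t \<omega> i - ?u i) * est t \<omega> i)
        \<le> (\<Sum>t\<in>{1..<T}. stab_bound t (I t \<omega>) (w t \<omega>)) + (\<Sum>t=1..T. f t \<omega>)" .
  qed
  also have "\<dots> = (\<Sum>t\<in>{1..<T}. \<integral>\<omega>. stab_bound t (I t \<omega>) (w t \<omega>) \<partial>M) + (\<Sum>t=1..T. \<integral>\<omega>. f t \<omega> \<partial>M)"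
    using stab_bound_integral(1) f(1)
    by (subst Bochner_Integration.integral_add)
       (auto intro!: Bochner_Integration.integrable_sum Bochner_Integration.integral_sum arg_cong2[where f = "(+)"])
  also have "\<dots> \<le> (\<Sum>t\<in>{1..<T}. (\<Sum>i\<in>others. 2 * \<alpha> * c t / (real t * \<Delta> i))
        + (if real t < T1 then \<theta> t * \<delta> / 8 else 0)
        + (1/8 + (if real t < T1 then 0 else 1/2 - \<alpha> / 4)) * reg t)
      + (\<Sum>t=1..T. penalty_const T t + \<alpha> * (\<alpha> + 1 / c t) / 4 * reg t)"
    using f(3) by (intro add_mono sum_mono stab_bound_integral(2)) auto
  finally show ?thesis .
qed

section \<open>The regret bound\<close>

lemma pseudo_regret_eq: "pseudo_regret M I l T = (\<Sum>t=1..T. reg t)"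
proof -
  have sum_loss: "(\<integral>\<omega>. (\<Sum>t=1..T. l t \<omega> i) \<partial>M) = (\<Sum>t=1..T. \<integral>\<omega>. l t \<omega> i \<partial>M)" for i
    using integrable_loss by (intro Bochner_Integration.integral_sum) auto
  have "(MIN i. (\<integral>\<omega>. (\<Sum>t=1..T. l t \<omega> i) \<partial>M)) = (\<integral>\<omega>. (\<Sum>t=1..T. l t \<omega> istar) \<partial>M)"
  proof (rule Min_eqI)
    fix y assume "y \<in> range (\<lambda>i. \<integral>\<omega>. (\<Sum>t=1..T. l t \<omega> i) \<partial>M)"
    then obtain i where y: "y = (\<integral>\<omega>. (\<Sum>t=1..T. l t \<omega> i) \<partial>M)" by blast
    show "(\<integral>\<omega>. (\<Sum>t=1..T. l t \<omega> istar) \<partial>M) \<le> y"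
      unfolding y sum_loss
    proof (rule sum_mono)
      fix t assume "t \<in> {1..T}"
      then show "(\<integral>\<omega>. l t \<omega> istar \<partial>M) \<le> (\<integral>\<omega>. l t \<omega> i \<partial>M)"
        using integral_loss_diff[of t i istar] gap_nonneg[of i] by (simp add: gaps)
    qed
  qed auto
  moreover have "(\<integral>\<omega>. (\<Sum>t=1..T. l t \<omega> (I t \<omega>)) \<partial>M) = (\<Sum>t=1..T. \<integral>\<omega>. l t \<omega> (I t \<omega>) \<partial>M)"
    using integrable_loss_of_action by (intro Bochner_Integration.integral_sum) auto
  ultimately have "pseudo_regret M I l T
      = (\<Sum>t=1..T. (\<integral>\<omega>. l t \<omega> (I t \<omega>) \<partial>M) - (\<integral>\<omega>. l t \<omega> istar \<partial>M))"
    by (simp only: pseudo_regret_def sum_loss sum_subtractf)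
  also have "\<dots> = (\<Sum>t=1..T. reg t)"
    using integral_loss_of_action by (intro sum.cong) auto
  finally show ?thesis .
qed

lemma sum_penalty_const_le:
  assumes T: "1 \<le> T" "1 \<le> real T * \<delta>"
  shows "(\<Sum>t=1..T. penalty_const T t)
    \<le> 32/5 * (2 * ln (real T) + 1) * (\<Sum>i\<in>others. 1 / \<Delta> i) + 64/5 * Kr\<^sup>2 / real T"
proof -
  define B where "B = (\<Sum>i\<in>others. 1 / \<Delta> i)"
  have B: "0 \<le> B"
    using Kr_le_sum_inverse Kr_ge by (simp add: B_def)
  let ?p = "\<lambda>t. if t = 1 then (\<Sum>i\<in>others. 32/5 * ln (real T) / \<Delta> i)
      else (\<Sum>i\<in>others. 32/5 / (real (t - 1) * \<Delta> i))"
  have p1: "(\<Sum>i\<in>others. 32/5 * ln (real T) / \<Delta> i) = 32/5 * ln (real T) * B"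
    by (simp add: B_def sum_distrib_left)
  have p: "(\<Sum>i\<in>others. 32/5 / (x * \<Delta> i)) = 32/5 * B * (1 / x)" for x
    by (simp add: B_def sum_distrib_left sum_distrib_right mult.commute)
  have "(\<Sum>t=1..T. ?p t) = 32/5 * ln (real T) * B + (\<Sum>t=2..T. 32/5 * B * (1 / real (t - 1)))"
  proof -
    have "(\<Sum>t=1..T. ?p t) = ?p 1 + (\<Sum>t=2..T. ?p t)"
      using T(1) by (simp add: sum.atLeast_Suc_atMost numeral_2_eq_2)
    also have "(\<Sum>t=2..T. ?p t) = (\<Sum>t=2..T. 32/5 * B * (1 / real (t - 1)))"
      by (intro sum.cong refl) (simp only: p, auto)
    finally show ?thesis
      by (simp only: p1 refl if_True)
  qed
  also have "(\<Sum>t=2..T. 32/5 * B * (1 / real (t - 1))) = 32/5 * B * (\<Sum>t=1..T-1. 1 / real t)"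
    unfolding sum_distrib_left
    by (rule sum.reindex_bij_witness[of _ Suc "\<lambda>t. t - 1"]) auto
  also have "\<dots> \<le> 32/5 * B * (1 + ln (real T))"
  proof (intro mult_left_mono)
    have "(\<Sum>t=1..T-1. 1 / real t) \<le> (\<Sum>t=1..T. 1 / real t)"
      by (intro sum_mono2) auto
    also have "\<dots> \<le> 1 + ln (real T)"
      using T(1) by (rule sum_inverse_le_one_plus_ln)
    finally show "(\<Sum>t=1..T-1. 1 / real t) \<le> 1 + ln (real T)" .
  qed (use B in simp)
  finally have "(\<Sum>t=1..T. ?p t) \<le> 32/5 * ln (real T) * B + 32/5 * B * (1 + ln (real T))"
    by simp
  also have "\<dots> = 32/5 * (2 * ln (real T) + 1) * B"
    by (simp add: field_simps)
  finally have "(\<Sum>t=1..T. ?p t) \<le> 32/5 * (2 * ln (real T) + 1) * B" .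
  moreover have "(\<Sum>t=1..T. penalty_const T t) = (\<Sum>t=1..T. ?p t) + (\<Sum>t=1..T. star_penalty T t)"
    by (simp only: penalty_const_def sum.distrib)
  ultimately show ?thesis
    using sum_star_penalty_le[OF T] by (simp add: B_def)
qed

text \<open>The condition \<open>64 * Kr \<le> real T\<close> brings the best arm's total penalty
  below a fifth of the sum of inverse gaps. After multiplication by \<open>4\<close>, the
  logarithm-free coefficient is \<open>192/5\<close> and that of the logarithm is
  \<open>256/5\<close>; \<open>3 \<le> ln (real T)\<close> merges them into
  \<open>64 * ln (real T)\<close>.\<close>

lemma sum_reg_le:
  assumes T: "64 * Kr \<le> real T" "1 \<le> real T * \<delta>" "3 \<le> ln (real T)"
  shows "(\<Sum>t=1..T. reg t)
    \<le> (8 * min_inv_log \<alpha> T + 64) * ln (real T) * (\<Sum>i\<in>others. 1 / \<Delta> i) + 16 * L ^ 4 / \<delta> + 4"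
proof -
  define B where "B = (\<Sum>i\<in>others. 1 / \<Delta> i)"
  define S where "S = (\<Sum>t=1..T. reg t)"
  define m where "m = min_inv_log \<alpha> T"
  define g where "g = (\<lambda>t. 1/8 + (if real t < T1 then 0 else 1/2 - \<alpha> / 4))"
  define h where "h = (\<lambda>t. \<alpha> * (\<alpha> + 1 / c t) / 4)"
  have T2: "2 * Kr \<le> real T" and Tpos: "0 < real T" "1 \<le> T"
    using T(1) Kr_ge by (linarith, linarith, cases T) auto
  have KB: "Kr \<le> B"
    using Kr_le_sum_inverse by (simp add: B_def)
  have expT: "exp 1 \<le> real T"
  proof -
    have "exp 3 \<le> real T"
      using T(3) Tpos by (simp add: ln_ge_iff)
    then show ?thesis
      using exp_le_cancel_iff[of 1 "3::real"] by linarith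
  qed
  have split: "{1..T} = insert T {1..<T}"
    using Tpos by auto
  have S: "S = (\<Sum>t\<in>{1..<T}. reg t) + reg T"
    unfolding S_def split by simp
  have share: "g t + h t \<le> 3/4" "h t \<le> 3/4" for t
  proof -
    show "g t + h t \<le> 3/4"
      unfolding g_def h_def by (rule regret_share_le)
    moreover have "0 \<le> g t"
      using \<alpha> by (simp add: g_def)
    ultimately show "h t \<le> 3/4" by linarith
  qed
  have U: "(\<Sum>t\<in>{1..<T}. \<Sum>i\<in>UNIV. comparator T i * \<Delta> i) \<le> Kr"
  proof -
    have "(\<Sum>i\<in>UNIV. comparator T i * \<Delta> i) = (\<Sum>i\<in>others. 1 / real T * \<Delta> i)"
      using gap_istar by (simp add: sum.remove[of UNIV istar] comparator_def)
    also have "\<dots> \<le> (\<Sum>i\<in>others. 1 / real T * 1)"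
      using gap_le_one by (intro sum_mono mult_left_mono) auto
    also have "\<dots> = Kr / real T"
      by (simp add: Kr_def)
    finally have "(\<Sum>t\<in>{1..<T}. \<Sum>i\<in>UNIV. comparator T i * \<Delta> i) \<le> (\<Sum>t\<in>{1..<T}. Kr / real T)"
      by (intro sum_mono)
    also have "\<dots> = real (T - 1) * (Kr / real T)"
      by simp
    also have "\<dots> \<le> real T * (Kr / real T)"
      using Kr_ge by (intro mult_right_mono) auto
    also have "\<dots> = Kr"
      using Tpos by simp
    finally show ?thesis .
  qed
  have stab: "(\<Sum>t\<in>{1..<T}. \<Sum>i\<in>others. 2 * \<alpha> * c t / (real t * \<Delta> i)) \<le> (2 + 2 * m * ln (real T)) * B"
  proof -
    have "(\<Sum>t\<in>{1..<T}. \<Sum>i\<in>others. 2 * \<alpha> * c t / (real t * \<Delta> i))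
        = (\<Sum>i\<in>others. \<Sum>t\<in>{1..<T}. 2 * \<alpha> * c t / (real t * \<Delta> i))"
      by (rule sum.swap)
    also have "\<dots> \<le> (\<Sum>i\<in>others. (2 + 2 * m * ln (real T)) / \<Delta> i)"
      unfolding m_def using expT by (intro sum_mono stability_sum_le) auto
    also have "\<dots> = (2 + 2 * m * ln (real T)) * B"
      by (simp add: B_def sum_distrib_left)
    finally show ?thesis .
  qed
  have pen: "(\<Sum>t=1..T. penalty_const T t) \<le> 32/5 * (2 * ln (real T) + 1) * B + B / 5"
  proof -
    have "64/5 * Kr\<^sup>2 / real T = (64 * Kr / real T) * (Kr / 5)"
      by (simp add: power2_eq_square)
    also have "\<dots> \<le> 1 * (B / 5)"
      using T(1) Tpos KB Kr_ge by (intro mult_mono) (auto simp: divide_le_eq)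
    finally show ?thesis
      using sum_penalty_const_le[OF Tpos(2) T(2)] by (simp add: B_def)
  qed
  have "(\<Sum>t\<in>{1..<T}. reg t) - (\<Sum>t\<in>{1..<T}. \<Sum>i\<in>UNIV. comparator T i * \<Delta> i)
      \<le> (\<Sum>t\<in>{1..<T}. \<Sum>i\<in>others. 2 * \<alpha> * c t / (real t * \<Delta> i))
        + (\<Sum>t\<in>{1..<T}. if real t < T1 then \<theta> t * \<delta> / 8 else 0) + (\<Sum>t\<in>{1..<T}. g t * reg t)
        + ((\<Sum>t=1..T. penalty_const T t) + (\<Sum>t=1..T. h t * reg t))"
    using regret_inequality[OF T2] unfolding g_def h_def by (simp only: sum_subtractf sum.distrib)
  also have "(\<Sum>t=1..T. h t * reg t) = (\<Sum>t\<in>{1..<T}. h t * reg t) + h T * reg T"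
    unfolding split by simp
  finally have main: "(\<Sum>t\<in>{1..<T}. reg t) \<le> Kr + ((2 + 2 * m * ln (real T)) * B + 4 * L ^ 4 / \<delta>
      + 32/5 * (2 * ln (real T) + 1) * B + B / 5)
      + ((\<Sum>t\<in>{1..<T}. g t * reg t) + (\<Sum>t\<in>{1..<T}. h t * reg t)) + h T * reg T"
    using U stab pen burn_in_sum_le[of T] by linarith
  have "(\<Sum>t\<in>{1..<T}. g t * reg t) + (\<Sum>t\<in>{1..<T}. h t * reg t) = (\<Sum>t\<in>{1..<T}. (g t + h t) * reg t)"
    by (simp add: sum.distrib distrib_right)
  also have "\<dots> \<le> (\<Sum>t\<in>{1..<T}. 3/4 * reg t)"
    using share reg_bounds(1) by (intro sum_mono mult_right_mono) auto
  also have "\<dots> = 3/4 * (\<Sum>t\<in>{1..<T}. reg t)"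
    by (simp add: sum_distrib_left)
  finally have gh: "(\<Sum>t\<in>{1..<T}. g t * reg t) + (\<Sum>t\<in>{1..<T}. h t * reg t) \<le> 3/4 * (\<Sum>t\<in>{1..<T}. reg t)" .
  have hT: "h T * reg T \<le> 3/4 * reg T"
    using share(2) reg_bounds(1)[OF Tpos(2)] by (intro mult_right_mono)
  \<comment> \<open>Moving \<open>3/4 * s\<close> to the left multiplies the rest by
    \<open>4\<close>, and \<open>hh\<close> becomes at most \<open>3 * r\<close>; with the extra
    \<open>r\<close>, the last round costs \<open>4 * r \<le> 4\<close>.\<close>
  have absorb: "s + r \<le> 4 * (b + x) + 4"
    if "s \<le> k + x + gg + hh" "gg \<le> 3/4 * s" "hh \<le> 3/4 * r" "k \<le> b" "r \<le> 1"
    for s r k b x gg hh :: real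
    using that by simp
  have "S \<le> 4 * (B + ((2 + 2 * m * ln (real T)) * B + 4 * L ^ 4 / \<delta>
      + 32/5 * (2 * ln (real T) + 1) * B + B / 5)) + 4"
    unfolding S by (rule absorb[OF main gh hT KB reg_bounds(2)[OF Tpos(2)]])
  also have "\<dots> = (8 * m * ln (real T) + (192/5 + 256/5 * ln (real T))) * B + 16 * L ^ 4 / \<delta> + 4"
    by (simp add: field_simps)
  also have "\<dots> \<le> (8 * m * ln (real T) + 64 * ln (real T)) * B + 16 * L ^ 4 / \<delta> + 4"
    using T(3) KB Kr_ge by (intro add_right_mono mult_right_mono add_left_mono) auto
  finally show ?thesis
    by (simp add: S_def B_def m_def distrib_right)
qed

text \<open>The regret is at most \<open>T\<close>, so only horizons \<open>T\<close> exceeding the bound matter; these are large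
  enough for the burn-in phase and the comparator.\<close>

theorem pseudo_regret_le:
  assumes T: "T \<ge> 1"
  shows "pseudo_regret M I l T
    \<le> (8 * min_inv_log \<alpha> T + 64) * ln (real T) * (\<Sum>i\<in>others. 1 / \<Delta> i) + 16 * L ^ 4 / \<delta> + 4"
proof (cases "real T \<le> (8 * min_inv_log \<alpha> T + 64) * ln (real T) * (\<Sum>i\<in>others. 1 / \<Delta> i) + 16 * L ^ 4 / \<delta> + 4")
  case True
  have "(\<Sum>t=1..T. reg t) \<le> (\<Sum>t=1..T. 1)"
    using reg_bounds(2) by (intro sum_mono) auto
  also have "\<dots> = real T"
    by simp
  finally have "(\<Sum>t=1..T. reg t) \<le> real T" .
  then show ?thesis
    unfolding pseudo_regret_eq using True by linarith
next
  case False
  define B where "B = (\<Sum>i\<in>others. 1 / \<Delta> i)"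
  have KB: "Kr \<le> B"
    using Kr_le_sum_inverse by (simp add: B_def)
  have lnT: "0 \<le> ln (real T)"
    using T by simp
  have m: "0 \<le> min_inv_log \<alpha> T"
    using T \<alpha> by (auto simp: min_inv_log_def)
  have "0 \<le> 8 * min_inv_log \<alpha> T * ln (real T) * B" "0 \<le> 64 * ln (real T) * B"
    using m lnT KB Kr_ge by auto
  moreover have "0 \<le> 16 * L ^ 4 / \<delta>"
    using min_gap_bounds(1) by simp
  moreover have "(8 * min_inv_log \<alpha> T + 64) * ln (real T) * B
      = 8 * min_inv_log \<alpha> T * ln (real T) * B + 64 * ln (real T) * B"
    by (simp add: distrib_right)
  ultimately have big: "64 * ln (real T) * B < real T" "16 * L ^ 4 / \<delta> < real T"
    using False unfolding B_def[symmetric] by linarith+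
  \<comment> \<open>The bound itself is at least \<open>4096\<close>, as \<open>4 \<le> L\<close>
    and \<open>\<delta> \<le> 1\<close>; a horizon beyond it therefore exceeds
    \<open>exp 3\<close>.\<close>
  have "16 * 256 / 1 \<le> 16 * L ^ 4 / \<delta>"
    using min_gap_bounds power_mono[OF L_bounds(2), of 4] by (intro frac_le) auto
  with big(2) have T4096: "4096 \<le> real T"
    by simp
  have "16 * L ^ 4 < real T * \<delta>"
    using big(2) min_gap_bounds(1) by (simp add: pos_divide_less_eq)
  then have Td: "1 \<le> real T * \<delta>"
    using power_mono[OF L_bounds(2), of 4] by simp
  have ln3: "3 \<le> ln (real T)"
  proof -
    have "exp (3::real) = exp 1 ^ 3"
      by (simp flip: exp_of_nat_mult)
    also have "\<dots> \<le> 3 ^ 3"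
      using exp_le by (intro power_mono) auto
    also have "\<dots> \<le> real T"
      using T4096 by simp
    finally show ?thesis
      using T by (simp add: ln_ge_iff)
  qed
  have "64 * 1 * Kr \<le> 64 * ln (real T) * B"
    using ln3 KB Kr_ge by (intro mult_mono) auto
  with big(1) have "64 * Kr \<le> real T" by simp
  from sum_reg_le[OF this Td ln3] show ?thesis
    unfolding pseudo_regret_eq .
qed

end

theorem theorem4:
  fixes M :: "'w measure"
    and I :: "nat \<Rightarrow> 'w \<Rightarrow> 'k::finite"
    and l :: "nat \<Rightarrow> 'w \<Rightarrow> 'k \<Rightarrow> real"
    and w :: "nat \<Rightarrow> 'w \<Rightarrow> 'k \<Rightarrow> real"
    and D :: "'k \<Rightarrow> 'k \<Rightarrow> real"
    and \<Delta> :: "'k \<Rightarrow> real"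
    and istar :: 'k
    and \<alpha> \<Delta>min :: real
    and T :: nat
  assumes "CARD('k) \<ge> 2"
    and "0 \<le> \<alpha>" and "\<alpha> \<le> 1"
    and "bandit_game M I l"
    and "stochastically_constrained M I l D"
    and "optimal_arm D istar"
    and "\<Delta> = (\<lambda>i. D i istar)"
    and "\<Delta> istar = 0" and "\<forall>i. i \<noteq> istar \<longrightarrow> \<Delta> i > 0"
    and "\<Delta>min = min_gap \<Delta> istar"
    and "tsallis_inf M I l \<alpha> (asym_param \<alpha> \<Delta> istar) (learning_rate \<alpha>) w"
    and "T \<ge> 1"
  shows "pseudo_regret M I l T
    \<le> (\<Sum>i\<in>UNIV - {istar}. (8 * min_inv_log \<alpha> T + 64) * ln (real T) / \<Delta> i)
      + 16 * (ln (16 / \<Delta>min\<^sup>2 * (ln (16 / \<Delta>min\<^sup>2))\<^sup>2)) ^ 4 / \<Delta>min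
      + 4"
proof -
  interpret prob_space M
    using assms(4) by (simp add: bandit_game_def)
  interpret constrained_bandit M I l D
    using assms(4,5) by unfold_locales
  \<comment> \<open>The locale's requirement that gaps are at most \<open>1\<close> holds because
    the losses lie in \<open>{0..1}\<close>; this is \<open>gap_le_1\<close>.\<close>
  interpret tsallis_bandit M I l D \<alpha> \<Delta> istar w
    using assms gap_le_1 by unfold_locales auto
  have "(\<Sum>i\<in>UNIV - {istar}. (8 * min_inv_log \<alpha> T + 64) * ln (real T) / \<Delta> i)
      = (8 * min_inv_log \<alpha> T + 64) * ln (real T) * (\<Sum>i\<in>UNIV - {istar}. 1 / \<Delta> i)"
    by (simp add: sum_distrib_left)
  with pseudo_regret_le[OF assms(12)] show ?thesis
    by (simp add: assms(10) \<delta>_def L_def X_def)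
qed

end
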